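(* Let $D\ge4$ and $q\ge2$ be integers. There is no non-bipartite distance-regular graph $\Gamma=(X,\mathcal{R})$ with classical parameters $(D,q,\alpha,\beta)=\left(D,q,q+1,\frac{q^{D+1}(q+1)-q^2-1}{q-1}\right)$ possessing a vertex $x\in X$ such that every irreducible $T(x)$-module with endpoint $1$ is thin and $\Gamma$ supports a uniform structure with respect to $x$.
   Context: All graphs are finite, simple, connected, undirected; $\partial$ denotes path-length distance. $\Gamma$ is distance-regular with diameter $D$ if for all $0\le h,i,j\le D$ and all $y,z$ with $\partial(y,z)=h$ the number $p^h_{ij}=|\{w:\partial(y,w)=i,\ \partial(z,w)=j\}|$ depends only on $h,i,j$; write $c_i=p^i_{1,i-1}$, $b_i=p^i_{1,i+1}$. $\Gamma$ has classical parameters $(D,q,\alpha,\beta)$ if $c_i=[i](1+\alpha[i-1])$ for $1\le i\le D$ and $b_i=([D]-[i])(\beta-\alpha[i])$ for $0\le i\le D-1$, where $[j]=1+q+\cdots+q^{j-1}$. Let $V=\mathbb{C}^X$ and $A$ the adjacency matrix. For fixed $x$ and $0\le i\le D$, $E_i^*$ is the diagonal matrix with $(y,y)$-entry $1$ if $\partial(x,y)=i$ and $0$ otherwise. $T=T(x)$ is the algebra generated by $A$ and $E_0^*,\dots,E_D^*$. A $T$-module is a subspace $W\subseteq V$ with $TW\subseteq W$; irreducible if $W\ne0$ with only submodules $0,W$; its endpoint is $\min\{i:E_i^*W\ne0\}$; thin if $\dim E_i^*W\le1$ for all $i$. $L=\sum_{i=1}^{D}E^*_{i-1}AE^*_i$,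 $R=\sum_{i=0}^{D-1}E^*_{i+1}AE^*_i$. $\Gamma$ supports a uniform structure with respect to $x$ if there exist a tridiagonal complex matrix $U=(e_{ij})_{1\le i,j\le D}$ with $e_{ii}=1$, such that either $e_{i,i-1}\ne0$ for all $2\le i\le D$ or $e_{i-1,i}\ne0$ for all $2\le i\le D$, and every principal submatrix $(e_{ij})_{s\le i,j\le t}$ is nonsingular, and scalars $f_1,\dots,f_D$ such that, with $e_i^-=e_{i,i-1}$ ($e_1^-=0$) and $e_i^+=e_{i,i+1}$ ($e_D^+=0$), $e_i^-RL^2+LRL+e_i^+L^2R=f_iL$ holds on $E_i^*V$ for $1\le i\le D$. *)

theory Defs
  imports "Jordan_Normal_Form.Determinant" "HOL-Analysis.Analysis"
begin

(* The vertex set X is the universe of a finite type 'a; a graph on X is its adjacency relation.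
   X-indexed complex vectors and matrices are those of HOL-Analysis. The matrices of
   Jordan_Normal_Form are used only for submatrices of varying size in uniform structures. *)

no_notation Matrix.vec_index (infixl "$" 100)

type_synonym 'a graph = "'a \<Rightarrow> 'a \<Rightarrow> bool"


definition simple_connected_graph :: "('a::finite) graph \<Rightarrow> bool" where
  "simple_connected_graph G \<longleftrightarrow> symp G \<and> irreflp G \<and> (\<forall>x y. G\<^sup>*\<^sup>* x y)"

definition graph_dist :: "('a::finite) graph \<Rightarrow> 'a \<Rightarrow> 'a \<Rightarrow> nat" where
  "graph_dist G x y = (LEAST n. (G ^^ n) x y)"

definition graph_diameter :: "('a::finite) graph \<Rightarrow> nat" where
  "graph_diameter G = Max {graph_dist G x y | x y. True}"

definition bipartite_graph :: "('a::finite) graph \<Rightarrow> bool" where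
  "bipartite_graph G \<longleftrightarrow> (\<exists>S. \<forall>y z. G y z \<longrightarrow> (y \<in> S \<longleftrightarrow> z \<notin> S))"

definition distance_regular :: "('a::finite) graph \<Rightarrow> bool" where
  "distance_regular G \<longleftrightarrow>
     simple_connected_graph G \<and>
     (\<forall>h\<le>graph_diameter G. \<forall>i\<le>graph_diameter G. \<forall>j\<le>graph_diameter G.
        \<exists>p. \<forall>y z. graph_dist G y z = h \<longrightarrow>
          card {w. graph_dist G y w = i \<and> graph_dist G z w = j} = p)"

(* The value is determined when G is distance-regular and h is at most the diameter. *)
definition intersection_number :: "('a::finite) graph \<Rightarrow> nat \<Rightarrow> nat \<Rightarrow> nat \<Rightarrow> nat" where
  "intersection_number G h i j =
     (THE p. \<forall>y z. graph_dist G y z = h \<longrightarrow>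
        card {w. graph_dist G y w = i \<and> graph_dist G z w = j} = p)"

definition c_number :: "('a::finite) graph \<Rightarrow> nat \<Rightarrow> nat" where
  "c_number G i = intersection_number G i 1 (i - 1)"

definition b_number :: "('a::finite) graph \<Rightarrow> nat \<Rightarrow> nat" where
  "b_number G i = intersection_number G i 1 (i + 1)"

definition q_bracket :: "real \<Rightarrow> nat \<Rightarrow> real" where
  "q_bracket q j = (\<Sum>k<j. q ^ k)"

definition has_classical_parameters ::
  "('a::finite) graph \<Rightarrow> nat \<Rightarrow> real \<Rightarrow> real \<Rightarrow> real \<Rightarrow> bool" where
  "has_classical_parameters G D q \<alpha> \<beta> \<longleftrightarrow>
     distance_regular G \<and> graph_diameter G = D \<and>
     (\<forall>i\<in>{1..D}. real (c_number G i) = q_bracket q i * (1 + \<alpha> * q_bracket q (i - 1))) \<and>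
     (\<forall>i\<in>{0..<D}. real (b_number G i) =
        (q_bracket q D - q_bracket q i) * (\<beta> - \<alpha> * q_bracket q i))"


inductive_set generated_algebra :: "(complex^'a^'a) set \<Rightarrow> (complex^('a::finite)^'a) set"
  for S :: "(complex^'a^'a) set" where
  gen: "M \<in> S \<Longrightarrow> M \<in> generated_algebra S"
| one: "Finite_Cartesian_Product.mat 1 \<in> generated_algebra S"
| add: "M \<in> generated_algebra S \<Longrightarrow> N \<in> generated_algebra S \<Longrightarrow> M + N \<in> generated_algebra S"
| scale: "M \<in> generated_algebra S \<Longrightarrow> (\<chi> y z. c * M $ y $ z) \<in> generated_algebra S"
| mult: "M \<in> generated_algebra S \<Longrightarrow> N \<in> generated_algebra S \<Longrightarrow> M ** N \<in> generated_algebra S"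

definition adjacency_matrix :: "('a::finite) graph \<Rightarrow> complex^'a^'a" where
  "adjacency_matrix G = (\<chi> y z. if G y z then 1 else 0)"

definition dual_idempotent :: "('a::finite) graph \<Rightarrow> 'a \<Rightarrow> nat \<Rightarrow> complex^'a^'a" where
  "dual_idempotent G x i = (\<chi> y z. if y = z \<and> graph_dist G x y = i then 1 else 0)"

definition terwilliger_algebra :: "('a::finite) graph \<Rightarrow> 'a \<Rightarrow> (complex^'a^'a) set" where
  "terwilliger_algebra G x =
     generated_algebra
       (insert (adjacency_matrix G) (dual_idempotent G x ` {0..graph_diameter G}))"

definition T_module :: "('a::finite) graph \<Rightarrow> 'a \<Rightarrow> (complex^'a) set \<Rightarrow> bool" where
  "T_module G x W \<longleftrightarrow>
     vec.subspace W \<and> (\<forall>M\<in>terwilliger_algebra G x. \<forall>v\<in>W. M *v v \<in> W)"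

definition irreducible_T_module :: "('a::finite) graph \<Rightarrow> 'a \<Rightarrow> (complex^'a) set \<Rightarrow> bool" where
  "irreducible_T_module G x W \<longleftrightarrow>
     T_module G x W \<and> W \<noteq> {0} \<and>
     (\<forall>W'. T_module G x W' \<and> W' \<subseteq> W \<longrightarrow> W' = {0} \<or> W' = W)"

definition module_component ::
  "('a::finite) graph \<Rightarrow> 'a \<Rightarrow> nat \<Rightarrow> (complex^'a) set \<Rightarrow> (complex^'a) set" where
  "module_component G x i W = (\<lambda>v. dual_idempotent G x i *v v) ` W"

definition module_endpoint :: "('a::finite) graph \<Rightarrow> 'a \<Rightarrow> (complex^'a) set \<Rightarrow> nat" where
  "module_endpoint G x W = Min {i. i \<le> graph_diameter G \<and> module_component G x i W \<noteq> {0}}"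

definition thin_module :: "('a::finite) graph \<Rightarrow> 'a \<Rightarrow> (complex^'a) set \<Rightarrow> bool" where
  "thin_module G x W \<longleftrightarrow> (\<forall>i\<le>graph_diameter G. vec.dim (module_component G x i W) \<le> 1)"


definition lowering_matrix :: "('a::finite) graph \<Rightarrow> 'a \<Rightarrow> complex^'a^'a" where
  "lowering_matrix G x =
     (\<Sum>i=1..graph_diameter G.
        dual_idempotent G x (i - 1) ** adjacency_matrix G ** dual_idempotent G x i)"

definition raising_matrix :: "('a::finite) graph \<Rightarrow> 'a \<Rightarrow> complex^'a^'a" where
  "raising_matrix G x =
     (\<Sum>i\<in>{0..<graph_diameter G}.
        dual_idempotent G x (i + 1) ** adjacency_matrix G ** dual_idempotent G x i)"

(* The matrix (e s .. t) with rows and columns s, ..., t, re-indexed from 0. *)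
definition principal_submatrix ::
  "(nat \<Rightarrow> nat \<Rightarrow> complex) \<Rightarrow> nat \<Rightarrow> nat \<Rightarrow> complex Matrix.mat" where
  "principal_submatrix e s t =
     Matrix.mat (t + 1 - s) (t + 1 - s) (\<lambda>(i, j). e (s + i) (s + j))"

(* A D by D matrix is a function on indices, of which only the values at 1 \<le> i, j \<le> D matter. *)
definition parameter_matrix :: "nat \<Rightarrow> (nat \<Rightarrow> nat \<Rightarrow> complex) \<Rightarrow> bool" where
  "parameter_matrix D e \<longleftrightarrow>
     (\<forall>i\<in>{1..D}. \<forall>j\<in>{1..D}. i + 1 < j \<or> j + 1 < i \<longrightarrow> e i j = 0) \<and>
     (\<forall>i\<in>{1..D}. e i i = 1) \<and>
     ((\<forall>i\<in>{2..D}. e i (i - 1) \<noteq> 0) \<or> (\<forall>i\<in>{2..D}. e (i - 1) i \<noteq> 0)) \<and>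
     (\<forall>s t. 1 \<le> s \<and> s \<le> t \<and> t \<le> D \<longrightarrow> Determinant.det (principal_submatrix e s t) \<noteq> 0)"

definition e_minus :: "(nat \<Rightarrow> nat \<Rightarrow> complex) \<Rightarrow> nat \<Rightarrow> complex" where
  "e_minus e i = (if i = 1 then 0 else e i (i - 1))"

definition e_plus :: "nat \<Rightarrow> (nat \<Rightarrow> nat \<Rightarrow> complex) \<Rightarrow> nat \<Rightarrow> complex" where
  "e_plus D e i = (if i = D then 0 else e i (i + 1))"

definition supports_uniform_structure :: "('a::finite) graph \<Rightarrow> 'a \<Rightarrow> bool" where
  "supports_uniform_structure G x \<longleftrightarrow>
     (let D = graph_diameter G; L = lowering_matrix G x; R = raising_matrix G x in
       \<exists>e f. parameter_matrix D e \<and>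
         (\<forall>i\<in>{1..D}. \<forall>v\<in>module_component G x i UNIV.
            e_minus e i *s (R *v (L *v (L *v v))) + L *v (R *v (L *v v))
              + e_plus D e i *s (L *v (L *v (R *v v))) = f i *s (L *v v)))"

end

theory Submission
  imports Defs
begin

text \<open>
  Put \<open>n = q + 1\<close>, \<open>N = [D]\<close> and \<open>r = n N\<close>. For a thin irreducible module of endpoint 1 with local
  eigenvalue \<open>h\<close>, the vanishing of the Krein parameters \<open>q\<^sub>1\<^sub>1\<^sup>i\<close> for \<open>i \<ge> 3\<close> forces \<open>h\<close> to be one of
  \<open>-n\<close>, \<open>-1\<close>, \<open>n (N - 1) - 1\<close>, \<open>n (q N - 1)\<close>. Such a module has diameter \<open>D - 1\<close> or \<open>D - 2\<close>, and the
  uniform relations say that the diameter determines the action of \<open>LR\<close>, hence \<open>h\<close>. So at most two local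
  eigenvalues occur, and a trace computation leaves only the pair \<open>-n\<close>, \<open>n (N - 1) - 1\<close>: the local
  graph at \<open>x\<close> is strongly regular with the parameters of the block graph of a Steiner system
  \<open>S(2, n, (n - 1) r + 1)\<close>. As \<open>D \<ge> 4\<close>, the claw argument of Bose and Neumaier produces the points of this
  Steiner system as large cliques, at least locally.

  For \<open>y\<close> at distance 2 from \<open>x\<close>, the common neighbours of \<open>x\<close> and \<open>y\<close> turn out to be the \<open>n (n + 1)\<close> lines
  of an affine plane of order \<open>n \<ge> 3\<close>. Such a plane is generated by two intersecting lines \<open>z\<close>, \<open>u\<close>, so all
  \<open>n q (N - 1)\<close> vertices \<open>y\<close> adjacent to both \<open>z\<close> and \<open>u\<close> are adjacent to a common line \<open>w\<close>
  parallel to \<open>z\<close>; but only \<open>n - 1\<close> vertices at distance 2 from \<open>x\<close> are adjacent to both \<open>z\<close> and \<open>w\<close>.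
\<close>

text \<open>The four local eigenvalues come from elimination. Evaluating A^2 f and A^3 f at a
  neighbour of x gives two equations for the scalars of the module, the Krein condition gives a
  third, and what remains is a cubic in h with roots -1, \<open>E\<close>, \<open>E'\<close>. The
  value -n stands apart: there the inner product to be cancelled from the Krein equation is zero.
  The scalar of LR is quadratic in h, so two eigenvalues that share it add up to
  \<open>a 1 - c 2\<close>, which no two of the four do. The trace computation is the diagonal entry
  of (B - h1)(B - h2) = l J for the local adjacency matrix B. Two eigenvalues help once more: any
  function of h is then affine in h, and this fixes the numbers of paths of length 2 from a
  neighbour of x to y. The obstacle is that modules are abstract and complex whereas all counting is
  real. Hence a module is replaced by the real functions it yields (\<open>thin_vector\<close>), and
  \<open>local_completeness\<close> says that these functions test whether a function of sum 0 on
  the neighbours of x vanishes. The hypothesis D >= 4 yields N >= 1 + q + q^2 + q^3, the size on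
  which the claw argument relies.\<close>

no_notation Matrix.scalar_prod (infix "\<bullet>" 70)

section \<open>Strongly regular graphs with the parameters of a Steiner graph\<close>

lemma double_count:
  assumes "finite X" "finite Y"
  shows "(\<Sum>u\<in>X. card {w\<in>Y. Q u w}) = (\<Sum>w\<in>Y. card {u\<in>X. Q u w})"
proof -
  have "(\<Sum>u\<in>X. card {w\<in>Y. Q u w}) = (\<Sum>u\<in>X. \<Sum>w\<in>Y. if Q u w then 1 else 0)"
    using assms by (intro sum.cong refl) (simp add: sum.If_cases Int_def)
  also have "\<dots> = (\<Sum>w\<in>Y. \<Sum>u\<in>X. if Q u w then 1 else 0)" by (rule sum.swap)
  also have "\<dots> = (\<Sum>w\<in>Y. card {u\<in>X. Q u w})"
    using assms by (intro sum.cong refl) (simp add: sum.If_cases Int_def)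
  finally show ?thesis .
qed

lemma max_card_exists:
  assumes "finite S" "A \<in> S"
  shows "\<exists>I\<in>S. \<forall>J\<in>S. card J \<le> card I"
proof -
  have "Max (card ` S) \<in> card ` S" using assms by (intro Max_in) auto
  then obtain I where "I \<in> S" "card I = Max (card ` S)" by auto
  then show ?thesis using assms by (metis Max_ge finite_imageI imageI)
qed

text \<open>Vertices stand for blocks and adjacency for meeting. A block has \<open>n\<close>
  points, each on \<open>r - 1\<close> further blocks; two meeting blocks have \<open>r - 2\<close>
  common neighbours through the shared point and (n-1)^2 joining their other points; two disjoint
  ones have n^2. With n - 1 = q and r = n N, \<open>r_large\<close> is n times the bound N >= 1 + q
  + q^2 + q^3.\<close>

locale steiner_parameters =
  fixes V :: "'b set" and adj :: "'b \<Rightarrow> 'b \<Rightarrow> bool" and n r :: int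
  assumes fin: "finite V"
    and sym: "\<And>z w. adj z w \<Longrightarrow> adj w z"
    and irrefl: "\<And>z. \<not> adj z z"
    and degree: "\<And>z. z \<in> V \<Longrightarrow> int (card {w\<in>V. adj z w}) = n * (r - 1)"
    and adjacent: "\<And>z w. z \<in> V \<Longrightarrow> w \<in> V \<Longrightarrow> adj z w \<Longrightarrow>
        int (card {u\<in>V. adj z u \<and> adj w u}) = r - 2 + (n - 1)^2"
    and nonadjacent: "\<And>z w. z \<in> V \<Longrightarrow> w \<in> V \<Longrightarrow> z \<noteq> w \<Longrightarrow> \<not> adj z w \<Longrightarrow>
        int (card {u\<in>V. adj z u \<and> adj w u}) = n^2"
    and n3: "n \<ge> 3"
    and r_large: "r \<ge> n * (1 + (n-1) + (n-1)^2 + (n-1)^3)"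
begin

section \<open>Claws and large cliques\<close>

definition nb where "nb z = {w\<in>V. adj z w}"

definition indep where "indep I \<longleftrightarrow> (\<forall>a\<in>I. \<forall>b\<in>I. \<not> adj a b)"

definition clique where "clique K \<longleftrightarrow> K \<subseteq> V \<and> (\<forall>a\<in>K. \<forall>b\<in>K. a \<noteq> b \<longrightarrow> adj a b)"

text \<open>The points of the Steiner system, seen as the sets of blocks through them. The expected
  size is \<open>r\<close>; the slack (n-1)^3 is what \<open>outside_large\<close> loses.\<close>

definition points where
  "points = {K. clique K \<and> (\<forall>K'. clique K' \<and> K \<subseteq> K' \<longrightarrow> K' = K) \<and> int (card K) \<ge> r - (n-1)^3}"

lemma finite_nb [simp]: "finite (nb z)" using fin by (simp add: nb_def)
lemma nb_sub: "nb z \<subseteq> V" by (auto simp: nb_def)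
lemma card_nb: "z \<in> V \<Longrightarrow> int (card (nb z)) = n * (r - 1)" using degree by (simp add: nb_def)
lemma card_nb_adj: "z \<in> V \<Longrightarrow> w \<in> V \<Longrightarrow> adj z w \<Longrightarrow> int (card (nb z \<inter> nb w)) = r - 2 + (n - 1)^2"
  using adjacent[of z w] by (simp add: nb_def Int_def conj_ac cong: conj_cong)
lemma card_nb_nonadj: "z \<in> V \<Longrightarrow> w \<in> V \<Longrightarrow> z \<noteq> w \<Longrightarrow> \<not> adj z w \<Longrightarrow> int (card (nb z \<inter> nb w)) = n^2"
  using nonadjacent[of z w] by (simp add: nb_def Int_def conj_ac cong: conj_cong)

text \<open>In order, these serve \<open>claw_le\<close>, \<open>point_unique\<close>, the valency
  comparisons (\<open>outside_nonempty\<close>, \<open>card_pts\<close>) and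
  \<open>planar_point_le\<close>. In terms of m = n - 1 all follow from r >= m^4 + 2 m^3 + 2 m^2 + 2
  m + 1.\<close>

lemma
  shows claw_bound: "2 * (r - 1) > (n\<^sup>2 - 1) * (n\<^sup>2 - n + 2)"
    and clique_bound: "r > 2 * (n-1)^3 + (n-1)^2 + n^2"
    and valency_bound: "r - 1 > (n + 1) * (n - 1)^3"
    and size_bound: "r - (n-1)^3 > n * (n+1)"
proof -
  define m where "m = n - 1"
  have m: "n = m + 1" "m \<ge> 2" using n3 by (auto simp: m_def)
  have r: "r \<ge> m^4 + 2*m^3 + 2*m^2 + 2*m + 1" using r_large unfolding m by (simp add: algebra_simps power4_eq_xxxx power3_eq_cube power2_eq_square)
  have p: "m^2 \<ge> 2 * m" "m^3 \<ge> 2 * m^2" "m^4 \<ge> 2 * m^3"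
    using mult_right_mono[of 2 m m] mult_right_mono[of 2 m "m^2"] mult_right_mono[of 2 m "m^3"] m(2)
    by (simp_all add: power2_eq_square power3_eq_cube power4_eq_xxxx mult.assoc)
  have "(n\<^sup>2 - 1) * (n\<^sup>2 - n + 2) = m^4 + 3*m^3 + 4 * m^2 + 4 * m"
    unfolding m by (simp add: algebra_simps power4_eq_xxxx power3_eq_cube power2_eq_square)
  moreover have "m^4 > 0" "m^3 > 0" using m(2) by auto
  then have "2 * (r - 1) > m^4 + 3*m^3 + 4 * m^2 + 4 * m" using r by (smt (verit))
  ultimately show "2 * (r - 1) > (n\<^sup>2 - 1) * (n\<^sup>2 - n + 2)" by (simp only:)
  have "2 * (n-1)^3 + (n-1)^2 + n^2 = 2 * m^3 + 2 * m^2 + 2 * m + 1"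
    unfolding m by (simp add: algebra_simps power3_eq_cube power2_eq_square)
  then show "r > 2 * (n-1)^3 + (n-1)^2 + n^2" using r p m by linarith
  have "(n + 1) * (n - 1)^3 = m^4 + 2 * m^3" unfolding m by (simp add: algebra_simps power4_eq_xxxx power3_eq_cube)
  then show "r - 1 > (n + 1) * (n - 1)^3" using r p m by linarith
  have "(n-1)^3 + n * (n+1) = m^3 + m^2 + 3 * m + 2" unfolding m by (simp add: algebra_simps power3_eq_cube power2_eq_square)
  then show "r - (n-1)^3 > n * (n+1)" using r p m by linarith
qed

text \<open>Suppose \<open>s = n + 1\<close> neighbours of z are pairwise nonadjacent, and let
  \<open>j u\<close> count those adjacent to another neighbour u. The sum of (j-1)(j-2) is
  nonnegative because j is an integer. The first moment of j is exact and the second is bounded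
  through common neighbours of pairs, so the sum is at most (n^2-1)(n^2-n+2) - 2(r-1), which is
  negative by \<open>claw_bound\<close>.\<close>

lemma claw_le:
  assumes z: "z \<in> V" and I: "I \<subseteq> nb z" "indep I"
  shows "int (card I) \<le> n"
proof (rule ccontr)
  assume "\<not> int (card I) \<le> n"
  then have "nat (n + 1) \<le> card I" using n3 by linarith
  then obtain J where J: "J \<subseteq> I" "card J = nat (n+1)" by (rule obtain_subset_with_card_n)
  have fJ: "finite J" using J I finite_nb by (meson finite_subset)
  have JV: "J \<subseteq> nb z" "indep J" using J I by (auto simp: indep_def)
  define s where "s = n + 1"
  have cJ: "int (card J) = s" using J n3 by (simp add: s_def)
  define U where "U = nb z - J"
  have fU: "finite U" by (simp add: U_def)
  define j where "j u = int (card {w\<in>J. adj u w})" for u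
  have cU: "int (card U) = n * (r - 1) - s"
    using card_nb[OF z] JV fJ cJ unfolding U_def
    by (simp add: card_Diff_subset of_nat_diff card_mono)
  have s1: "(\<Sum>u\<in>U. j u) = s * (r - 2 + (n - 1)^2)"
  proof -
    have "(\<Sum>u\<in>U. j u) = int (\<Sum>w\<in>J. card {u\<in>U. adj u w})"
      unfolding j_def of_nat_sum[symmetric] using double_count[OF fU fJ] by simp
    also have "\<dots> = (\<Sum>w\<in>J. int (card (nb z \<inter> nb w)))"
    proof -
      have "{u\<in>U. adj u w} = nb z \<inter> nb w" if "w \<in> J" for w
        using that JV sym unfolding U_def indep_def nb_def by blast
      then show ?thesis by simp
    qed
    also have "\<dots> = (\<Sum>w\<in>J. r - 2 + (n - 1)^2)"
      using JV z by (intro sum.cong refl card_nb_adj) (auto simp: nb_def)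
    finally show ?thesis using cJ by simp
  qed
  have s2: "(\<Sum>u\<in>U. j u * j u) \<le> s * (r - 2 + (n - 1)^2) + s * (s - 1) * (n^2 - 1)"
  proof -
    have "(\<Sum>u\<in>U. j u * j u) = (\<Sum>u\<in>U. int (card {p\<in>J\<times>J. adj u (fst p) \<and> adj u (snd p)}))"
    proof (rule sum.cong[OF refl])
      fix u
      have "{p\<in>J\<times>J. adj u (fst p) \<and> adj u (snd p)} = {w\<in>J. adj u w} \<times> {w\<in>J. adj u w}" by auto
      then show "j u * j u = int (card {p\<in>J\<times>J. adj u (fst p) \<and> adj u (snd p)})"
        by (simp add: j_def card_cartesian_product)
    qed
    also have "\<dots> = (\<Sum>p\<in>J\<times>J. int (card {u\<in>U. adj u (fst p) \<and> adj u (snd p)}))"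
      unfolding of_nat_sum[symmetric] using double_count[of U "J\<times>J"] fU fJ by simp
    also have "\<dots> \<le> (\<Sum>p\<in>J\<times>J. if fst p = snd p then r - 2 + (n - 1)^2 else n^2 - 1)"
    proof (rule sum_mono)
      fix p assume p: "p \<in> J \<times> J"
      obtain w w' where pw: "p = (w, w')" by (cases p)
      have ww: "w \<in> J" "w' \<in> J" "w \<in> V" "w' \<in> V" "adj z w" "adj z w'" using p pw JV by (auto simp: nb_def)
      show "int (card {u\<in>U. adj u (fst p) \<and> adj u (snd p)}) \<le> (if fst p = snd p then r - 2 + (n - 1)^2 else n^2 - 1)"
      proof (cases "w = w'")
        case True
        have "{u\<in>U. adj u w \<and> adj u w'} \<subseteq> nb z \<inter> nb w" using sym by (auto simp: U_def nb_def)
        then have "card {u\<in>U. adj u w \<and> adj u w'} \<le> card (nb z \<inter> nb w)" by (intro card_mono) auto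
        then show ?thesis using True card_nb_adj[of z w] ww z pw by simp
      next
        case False
        \<comment> \<open>The vertex z is itself a common neighbour of w and w', but outside
          \<open>U\<close>; hence n^2 - 1 instead of n^2.\<close>
        have "insert z {u\<in>U. adj u w \<and> adj u w'} \<subseteq> nb w \<inter> nb w'" using sym ww z by (auto simp: U_def nb_def)
        then have "card (insert z {u\<in>U. adj u w \<and> adj u w'}) \<le> card (nb w \<inter> nb w')" by (intro card_mono) auto
        moreover have "z \<notin> {u\<in>U. adj u w \<and> adj u w'}" using irrefl by (auto simp: U_def nb_def)
        ultimately have "card {u\<in>U. adj u w \<and> adj u w'} + 1 \<le> card (nb w \<inter> nb w')" using fU by simp
        moreover have "int (card (nb w \<inter> nb w')) = n^2"
          using False ww JV(2) by (intro card_nb_nonadj) (auto simp: indep_def)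
        ultimately show ?thesis using False pw by simp
      qed
    qed
    also have "\<dots> = (\<Sum>w\<in>J. \<Sum>w'\<in>J. if w = w' then r - 2 + (n - 1)^2 else n^2 - 1)"
      by (simp add: sum.cartesian_product case_prod_beta)
    also have "\<dots> = (\<Sum>w\<in>J. (r - 2 + (n - 1)^2 - (n^2 - 1)) + s * (n^2 - 1))"
    proof (rule sum.cong[OF refl])
      fix w assume w: "w \<in> J"
      have "(\<Sum>w'\<in>J. if w = w' then r - 2 + (n - 1)^2 else n^2 - 1)
        = (\<Sum>w'\<in>J. (if w = w' then r - 2 + (n - 1)^2 - (n^2 - 1) else 0) + (n^2 - 1))"
        by (intro sum.cong refl) auto
      also have "\<dots> = (r - 2 + (n - 1)^2 - (n^2 - 1)) + int (card J) * (n^2 - 1)"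
        using fJ w by (simp only: sum.distrib sum.delta') simp
      finally show "(\<Sum>w'\<in>J. if w = w' then r - 2 + (n - 1)^2 else n^2 - 1)
        = (r - 2 + (n - 1)^2 - (n^2 - 1)) + s * (n^2 - 1)" by (simp only: cJ)
    qed
    also have "\<dots> = s * ((r - 2 + (n - 1)^2 - (n^2 - 1)) + s * (n^2 - 1))"
      by (simp only: sum_constant cJ) 
    finally show ?thesis by (simp add: algebra_simps)
  qed
  have "0 \<le> (\<Sum>u\<in>U. (j u - 1) * (j u - 2))"
  proof (rule sum_nonneg)
    fix u show "0 \<le> (j u - 1) * (j u - 2)"
      by (cases "j u \<le> 1") (auto simp: mult_nonpos_nonpos)
  qed
  also have "\<dots> = (\<Sum>u\<in>U. j u * j u) - 3 * (\<Sum>u\<in>U. j u) + 2 * int (card U)"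
    by (simp add: algebra_simps sum.distrib sum_subtractf sum_distrib_left[symmetric] sum_distrib_right[symmetric])
  finally have "0 \<le> (\<Sum>u\<in>U. j u * j u) - 3 * (\<Sum>u\<in>U. j u) + 2 * int (card U)" .
  then have "0 \<le> (s * (r - 2 + (n - 1)^2) + s * (s - 1) * (n^2 - 1)) - 3 * (s * (r - 2 + (n - 1)^2)) + 2 * (n * (r - 1) - s)"
    using s2 unfolding s1 cU by (smt (verit))
  then have "0 \<le> s * (s - 1) * (n^2 - 1) - 2 * (s * (r - 2 + (n - 1)^2)) + 2 * (n * (r - 1) - s)"
    by (simp add: algebra_simps)
  moreover have "s * (s - 1) * (n^2 - 1) - 2 * (s * (r - 2 + (n - 1)^2)) + 2 * (n * (r - 1) - s)
     = (n\<^sup>2 - 1) * (n\<^sup>2 - n + 2) - 2 * (r - 1)"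
    unfolding s_def by (simp add: algebra_simps power2_eq_square)
  ultimately show False using claw_bound by linarith
qed

definition outside where "outside z I = {u\<in>nb z - I. \<forall>w\<in>I. \<not> adj u w}"

text \<open>A leaf of the claw and its neighbours account for at most r - 1 + (n-1)^2 of the n (r-1)
  neighbours of z; n - 1 leaves therefore leave r - 1 - (n-1)^3 of them free.\<close>

lemma outside_large:
  assumes z: "z \<in> V" and I: "I \<subseteq> nb z" and s: "int (card I) \<le> n - 1"
  shows "int (card (outside z I)) \<ge> r - 1 - (n-1)^3"
proof -
  have fI: "finite I" using I finite_nb by (meson finite_subset)
  have "nb z \<subseteq> outside z I \<union> (I \<union> (\<Union>w\<in>I. nb z \<inter> nb w))"
    using sym by (auto simp: outside_def nb_def)
  moreover have "finite (outside z I)" by (auto simp: outside_def)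
  ultimately have "card (nb z) \<le> card (outside z I \<union> (I \<union> (\<Union>w\<in>I. nb z \<inter> nb w)))"
    using fI by (intro card_mono) auto
  also have "\<dots> \<le> card (outside z I) + (card I + card (\<Union>w\<in>I. nb z \<inter> nb w))"
    by (meson add_left_mono card_Un_le le_trans)
  also have "\<dots> \<le> card (outside z I) + (card I + (\<Sum>w\<in>I. card (nb z \<inter> nb w)))"
    using card_UN_le[OF fI, of "\<lambda>w. nb z \<inter> nb w"] by simp
  finally have "int (card (nb z)) \<le> int (card (outside z I)) + (int (card I) + (\<Sum>w\<in>I. int (card (nb z \<inter> nb w))))"
    unfolding of_nat_sum[symmetric] of_nat_add[symmetric] by (simp only: of_nat_le_iff)
  moreover have "(\<Sum>w\<in>I. int (card (nb z \<inter> nb w))) = (\<Sum>w\<in>I. r - 2 + (n - 1)^2)"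
    using I z by (intro sum.cong refl card_nb_adj) (auto simp: nb_def)
  ultimately have "n * (r - 1) \<le> int (card (outside z I)) + int (card I) * (r - 1 + (n-1)^2)"
    using card_nb[OF z] by (simp add: algebra_simps)
  moreover have "r \<ge> 1" using valency_bound n3 by (smt (verit) mult_nonneg_nonneg zero_le_power)
  then have "int (card I) * (r - 1 + (n-1)^2) \<le> (n - 1) * (r - 1 + (n-1)^2)"
    using s by (intro mult_right_mono) auto
  ultimately show ?thesis by (simp add: algebra_simps power2_eq_square power3_eq_cube)
qed

lemma outside_nonempty:
  assumes "z \<in> V" "I \<subseteq> nb z" "int (card I) \<le> n - 1"
  shows "outside z I \<noteq> {}"
proof -
  have "(n + 1) * (n - 1)^3 \<ge> 1 * (n-1)^3" using n3 by (intro mult_right_mono) auto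
  then have "int (card (outside z I)) > 0" using outside_large[OF assms] valency_bound by linarith
  then show ?thesis by auto
qed

text \<open>A claw of largest size through u cannot have fewer than \<open>n\<close> leaves, since
  then \<open>outside\<close> offers another one.\<close>

lemma extend_claw:
  assumes z: "z \<in> V" and u: "u \<in> nb z"
  obtains I where "I \<subseteq> nb z" "indep I" "u \<in> I" "int (card I) = n"
proof -
  define S where "S = {I. I \<subseteq> nb z \<and> indep I \<and> u \<in> I}"
  have fS: "finite S" unfolding S_def by (rule finite_subset[of _ "Pow (nb z)"]) auto
  have "{u} \<in> S" using u irrefl by (auto simp: S_def indep_def)
  then obtain I where I: "I \<in> S" "\<And>J. J \<in> S \<Longrightarrow> card J \<le> card I"
    using max_card_exists[OF fS] by blast
  have "int (card I) = n"
  proof (rule ccontr)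
    assume "int (card I) \<noteq> n"
    then have "int (card I) \<le> n - 1" using claw_le[OF z, of I] I by (auto simp: S_def)
    then obtain w where w: "w \<in> outside z I" using outside_nonempty[OF z, of I] I by (auto simp: S_def)
    then have "insert w I \<in> S" using I sym irrefl by (auto simp: S_def outside_def indep_def)
    moreover have "finite I" using I finite_nb by (auto simp: S_def intro: finite_subset)
    ultimately show False using I(2)[of "insert w I"] w by (simp add: outside_def)
  qed
  then show ?thesis using that I by (auto simp: S_def)
qed

lemma finite_clique: "clique K \<Longrightarrow> finite K" using fin by (auto simp: clique_def intro: finite_subset)

lemma clique_extend:
  assumes "clique K" obtains K' where "clique K'" "K \<subseteq> K'" "\<And>K''. clique K'' \<Longrightarrow> K' \<subseteq> K'' \<Longrightarrow> K'' = K'"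
proof -
  define S where "S = {K'. clique K' \<and> K \<subseteq> K'}"
  have fS: "finite S" unfolding S_def by (rule finite_subset[of _ "Pow V"]) (auto simp: clique_def fin)
  have "K \<in> S" using assms by (auto simp: S_def)
  then obtain K' where K': "K' \<in> S" "\<And>J. J \<in> S \<Longrightarrow> card J \<le> card K'"
    using max_card_exists[OF fS] by blast
  show ?thesis
  proof (rule that)
    fix K'' assume "clique K''" "K' \<subseteq> K''"
    then show "K'' = K'" using K'(1) K'(2)[of K''] finite_clique[of K''] card_seteq[of K'' K'] by (auto simp: S_def)
  qed (use K' in \<open>auto simp: S_def\<close>)
qed

text \<open>Remove u from an \<open>n\<close>-claw at z. The vertices that can take its place, u
  among them, are pairwise adjacent, as two nonadjacent ones would complete a claw with n + 1
  leaves. Together with z they form a clique of the required size.\<close>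

lemma point_exists:
  assumes z: "z \<in> V" "u \<in> V" and zu: "adj z u"
  obtains K where "K \<in> points" "z \<in> K" "u \<in> K"
proof -
  have u: "u \<in> nb z" using assms by (simp add: nb_def)
  obtain I where I: "I \<subseteq> nb z" "indep I" "u \<in> I" "int (card I) = n" using extend_claw[OF z(1) u] by blast
  have fI: "finite I" using I finite_nb by (meson finite_subset)
  define J where "J = I - {u}"
  have cJ: "int (card J) = n - 1" using I fI by (simp add: J_def card_Diff_singleton of_nat_diff card_gt_0_iff Suc_leI)
      (metis One_nat_def Suc_leI card_gt_0_iff empty_iff of_nat_1 of_nat_diff)
  have J: "J \<subseteq> nb z" "indep J" using I by (auto simp: J_def indep_def)
  have fJ: "finite J" using fI J_def by simp
  have uJ: "u \<in> outside z J" using I u by (auto simp: outside_def J_def indep_def)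
  have "clique (insert z (outside z J))"
    unfolding clique_def
  proof (intro conjI ballI impI)
    show "insert z (outside z J) \<subseteq> V" using z by (auto simp: outside_def nb_def)
    fix a b assume ab: "a \<in> insert z (outside z J)" "b \<in> insert z (outside z J)" "a \<noteq> b"
    show "adj a b"
    proof (cases "a = z \<or> b = z")
      case True then show ?thesis using ab sym by (auto simp: outside_def nb_def)
    next
      case False
      show ?thesis
      proof (rule ccontr)
        assume nab: "\<not> adj a b"
        have "indep (insert a (insert b J))" using J nab ab False sym irrefl by (auto simp: indep_def outside_def)
        moreover have "insert a (insert b J) \<subseteq> nb z" using J ab False by (auto simp: outside_def)
        ultimately have "int (card (insert a (insert b J))) \<le> n" by (intro claw_le[OF z(1)])
        moreover have "card (insert a (insert b J)) = card J + 2" using ab False fJ by (auto simp: outside_def)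
        ultimately show False using cJ by linarith
      qed
    qed
  qed
  then obtain K where K: "clique K" "insert z (outside z J) \<subseteq> K" "\<And>K''. clique K'' \<Longrightarrow> K \<subseteq> K'' \<Longrightarrow> K'' = K"
    using clique_extend by blast
  have "card (insert z (outside z J)) = card (outside z J) + 1"
    using irrefl by (subst card_insert_disjoint) (auto simp: outside_def nb_def fin)
  moreover have "card (insert z (outside z J)) \<le> card K" using K finite_clique by (intro card_mono) auto
  ultimately have "int (card K) \<ge> r - (n-1)^3" using outside_large[OF z(1) J(1)] cJ by linarith
  then have "K \<in> points" using K by (auto simp: points_def)
  then show ?thesis using that K uJ by blast
qed

lemma point_clique: "K \<in> points \<Longrightarrow> z \<in> K \<Longrightarrow> w \<in> K \<Longrightarrow> z \<noteq> w \<Longrightarrow> adj z w"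
  by (auto simp: points_def clique_def)
lemma point_sub: "K \<in> points \<Longrightarrow> K \<subseteq> V" by (auto simp: points_def clique_def)
lemma finite_point: "K \<in> points \<Longrightarrow> finite K" using point_sub fin finite_subset by blast
lemma finite_points [simp]: "finite points"
  by (rule finite_subset[of _ "Pow V"]) (use point_sub fin in auto)

text \<open>The intersection lies in the common neighbourhood of a nonadjacent pair, which exists by
  maximality, and the union consists of z, u and common neighbours of z and u. Thus |K1| + |K2| <=
  n^2 + r + (n-1)^2, against \<open>clique_bound\<close>.\<close>

lemma point_unique:
  assumes K: "K1 \<in> points" "K2 \<in> points" "z \<in> K1" "u \<in> K1" "z \<in> K2" "u \<in> K2" "z \<noteq> u"
  shows "K1 = K2"
proof (rule ccontr)
  assume ne: "K1 \<noteq> K2"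
  have zV: "z \<in> V" "u \<in> V" using K point_sub by auto
  have zu: "adj z u" using K point_clique by auto
  have "\<not> K2 \<subseteq> K1" using ne K by (auto simp: points_def)
  then obtain b where b: "b \<in> K2" "b \<notin> K1" by auto
  have "\<not> clique (insert b K1)" using K b by (auto simp: points_def)
  then obtain a where a: "a \<in> K1" "\<not> adj a b"
    using K b sym by (auto simp: points_def clique_def)
  have aK2: "a \<notin> K2" using a b point_clique[OF K(2)] by auto
  have "K1 \<inter> K2 \<subseteq> nb a \<inter> nb b" using a b aK2 point_clique[OF K(1)] point_clique[OF K(2)] point_sub[OF K(1)]
    by (auto simp: nb_def)
  then have "card (K1 \<inter> K2) \<le> card (nb a \<inter> nb b)" by (intro card_mono) auto
  moreover have "int (card (nb a \<inter> nb b)) = n^2"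
    using a b point_sub K by (intro card_nb_nonadj) auto
  moreover have "K1 \<union> K2 \<subseteq> insert z (insert u (nb z \<inter> nb u))"
    using K point_clique point_sub by (fastforce simp: nb_def)
  then have "card (K1 \<union> K2) \<le> card (insert z (insert u (nb z \<inter> nb u)))" by (intro card_mono) auto
  moreover have "card (insert z (insert u (nb z \<inter> nb u))) \<le> card (nb z \<inter> nb u) + 2"
    by (simp add: card_insert_if)
  moreover have "int (card (nb z \<inter> nb u)) = r - 2 + (n - 1)^2" using card_nb_adj zV zu by blast
  moreover have "card (K1 \<union> K2) + card (K1 \<inter> K2) = card K1 + card K2"
    using card_Un_Int[of K1 K2] K finite_point by auto
  moreover have "int (card K1) \<ge> r - (n-1)^3" "int (card K2) \<ge> r - (n-1)^3" using K by (auto simp: points_def)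
  ultimately show False using clique_bound by linarith
qed

section \<open>The points on a block\<close>

definition pts where "pts z = {K\<in>points. z \<in> K}"

lemma finite_pts [simp]: "finite (pts z)" by (simp add: pts_def)

text \<open>The points on z, with z removed, partition its neighbourhood. The set \<open>M\<close>
  allows the count to be made in all of \<open>V\<close> or inside a planar set.\<close>

lemma nb_partition:
  assumes z: "z \<in> V" and M: "M \<subseteq> V"
  shows "int (card (nb z \<inter> M)) = (\<Sum>K\<in>pts z. int (card (K \<inter> M - {z})))"
proof -
  have "nb z \<inter> M = (\<Union>K\<in>pts z. K \<inter> M - {z})"
  proof (intro equalityI subsetI)
    fix w assume "w \<in> nb z \<inter> M"
    then have w: "w \<in> V" "w \<in> M" "adj z w" by (auto simp: nb_def)
    then obtain K where "K \<in> points" "z \<in> K" "w \<in> K" using point_exists[OF z] by blast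
    then show "w \<in> (\<Union>K\<in>pts z. K \<inter> M - {z})" using w irrefl by (auto simp: pts_def)
  next
    fix w assume "w \<in> (\<Union>K\<in>pts z. K \<inter> M - {z})"
    then obtain K where "K \<in> points" "z \<in> K" "w \<in> K" "w \<in> M" "w \<noteq> z" by (auto simp: pts_def)
    then show "w \<in> nb z \<inter> M" using point_clique[of K z w] M by (auto simp: nb_def)
  qed
  moreover have "card (\<Union>K\<in>pts z. K \<inter> M - {z}) = (\<Sum>K\<in>pts z. card (K \<inter> M - {z}))"
    by (rule card_UN_disjoint) (use point_unique finite_point in \<open>auto simp: pts_def\<close>)
  ultimately show ?thesis by simp
qed

text \<open>Above: n + 1 cliques of size at least r - (n-1)^3 would exceed the valency. Below: the
  leaves of an \<open>n\<close>-claw lie on different points, being pairwise nonadjacent.\<close>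

lemma card_pts:
  assumes z: "z \<in> V"
  shows "int (card (pts z)) = n"
proof (rule antisym)
  have eq: "n * (r - 1) = (\<Sum>K\<in>pts z. int (card (K \<inter> V - {z})))"
    using nb_partition[OF z, of V] card_nb[OF z] nb_sub[of z] by (simp add: Int_absorb2)
  have "(\<Sum>K\<in>pts z. r - 1 - (n-1)^3) \<le> (\<Sum>K\<in>pts z. int (card (K \<inter> V - {z})))"
  proof (rule sum_mono)
    fix K assume K: "K \<in> pts z"
    then have K': "K \<in> points" "z \<in> K" by (simp_all add: pts_def)
    then have "K \<inter> V = K" using point_sub by blast
    moreover have "finite K" using K'(1) by (rule finite_point)
    moreover have "card K \<noteq> 0" using calculation K' by auto
    moreover have "int (card K) \<ge> r - (n-1)^3" using K'(1) by (simp add: points_def)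
    ultimately show "r - 1 - (n-1)^3 \<le> int (card (K \<inter> V - {z}))"
      using K'(2) by (simp add: card_Diff_singleton of_nat_diff)
  qed
  then have *: "int (card (pts z)) * (r - 1 - (n-1)^3) \<le> n * (r - 1)" using eq by simp
  have nn: "n * (n + 1) \<ge> 1" using n3 by (simp add: int_one_le_iff_zero_less)
  show "int (card (pts z)) \<le> n"
  proof (rule ccontr)
    assume "\<not> int (card (pts z)) \<le> n"
    then have "(n + 1) * (r - 1 - (n-1)^3) \<le> int (card (pts z)) * (r - 1 - (n-1)^3)"
      using size_bound nn by (intro mult_right_mono) linarith+
    then show False using * valency_bound by (simp add: algebra_simps)
  qed
  have "nb z \<noteq> {}" using outside_nonempty[OF z, of "{}"] n3 by (auto simp: outside_def)
  then obtain u where "u \<in> nb z" by auto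
  then obtain I where I: "I \<subseteq> nb z" "indep I" "int (card I) = n" using extend_claw[OF z] by metis
  have "\<forall>w\<in>I. \<exists>K. K \<in> pts z \<and> w \<in> K"
    using I z point_exists[of z] unfolding pts_def nb_def by blast
  then obtain k where k: "\<And>w. w \<in> I \<Longrightarrow> k w \<in> pts z \<and> w \<in> k w" by metis
  have "inj_on k I"
  proof (rule inj_onI)
    fix a b assume "a \<in> I" "b \<in> I" "k a = k b"
    then show "a = b" using k[of a] k[of b] I(2) point_clique[of "k a" a b] by (auto simp: pts_def indep_def)
  qed
  moreover have "k ` I \<subseteq> pts z" using k by auto
  ultimately have "card I \<le> card (pts z)" by (metis card_inj_on_le finite_pts)
  then show "n \<le> int (card (pts z))" using I by linarith
qed

text \<open>The counts of an affine plane of order \<open>n\<close> inside the Steiner system: each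
  line meets the n^2 lines outside its parallel class, and a further block has at most one point in
  the plane, so it meets no line or the n + 1 lines through that point.\<close>

definition planar where
  "planar M \<longleftrightarrow> M \<subseteq> V \<and> int (card M) = n * (n + 1) \<and>
     (\<forall>z\<in>M. int (card (nb z \<inter> M)) = n^2) \<and>
     (\<forall>z\<in>V - M. nb z \<inter> M = {} \<or> int (card (nb z \<inter> M)) = n + 1)"

text \<open>By \<open>size_bound\<close> the clique is too large to lie inside \<open>M\<close>; a
  member outside \<open>M\<close> is adjacent to all of \<open>K \<inter> M\<close>, hence to at
  most n + 1 vertices there.\<close>

lemma planar_point_le:
  assumes M: "planar M" and K: "K \<in> points"
  shows "int (card (K \<inter> M)) \<le> n + 1"
proof -
  have fM: "finite M" using M fin by (auto simp: planar_def intro: finite_subset)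
  have "\<not> K \<subseteq> M"
  proof
    assume "K \<subseteq> M"
    then have "card K \<le> card M" using fM by (rule card_mono[rotated])
    then show False using M K size_bound by (auto simp: planar_def points_def)
  qed
  then obtain z where z: "z \<in> K" "z \<notin> M" by auto
  have zV: "z \<in> V" using z K point_sub by auto
  have "K \<inter> M \<subseteq> nb z \<inter> M" using z point_clique[OF K] point_sub[OF K] by (auto simp: nb_def)
  then have "card (K \<inter> M) \<le> card (nb z \<inter> M)" by (intro card_mono) auto
  moreover have "nb z \<inter> M = {} \<or> int (card (nb z \<inter> M)) = n + 1"
    using M z zV by (auto simp: planar_def)
  then have "int (card (nb z \<inter> M)) \<le> n + 1" using n3 by fastforce
  ultimately show ?thesis by linarith
qed

text \<open>The \<open>n\<close> points on z contribute at most \<open>n\<close> neighbours each,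
  and the total is n^2, so every bound is attained.\<close>

lemma planar_point:
  assumes M: "planar M" and K: "K \<in> points" and z: "z \<in> K" "z \<in> M"
  shows "int (card (K \<inter> M)) = n + 1"
proof -
  have zV: "z \<in> V" using M z by (auto simp: planar_def)
  have MV: "M \<subseteq> V" using M by (auto simp: planar_def)
  have le: "int (card (L \<inter> M - {z})) \<le> n" if "L \<in> pts z" for L
  proof -
    have L: "L \<in> points" "z \<in> L \<inter> M" using that z by (auto simp: pts_def)
    have "Suc (card (L \<inter> M - {z})) = card (L \<inter> M)"
      using L finite_point[of L] by (intro card_Suc_Diff1) auto
    then show ?thesis using planar_point_le[OF M L(1)] by linarith
  qed
  have "(\<Sum>L\<in>pts z. n - int (card (L \<inter> M - {z}))) = 0"
    using nb_partition[OF zV MV] M z card_pts[OF zV]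
    by (simp add: sum_subtractf planar_def power2_eq_square)
  then have "\<forall>L\<in>pts z. n - int (card (L \<inter> M - {z})) = 0"
    by (subst (asm) sum_nonneg_eq_0_iff) (use le in auto)
  then have "int (card (K \<inter> M - {z})) = n" using K z by (auto simp: pts_def)
  moreover have "card (K \<inter> M) \<noteq> 0" using z K finite_point by auto
  ultimately show ?thesis using z by (simp add: card_Diff_singleton)
qed

text \<open>A block with two of its points in the plane belongs to the plane: otherwise it would
  meet two disjoint sets of n + 1 lines.\<close>

lemma planar_closed:
  assumes M: "planar M" and K: "K1 \<in> pts z" "K2 \<in> pts z" "K1 \<noteq> K2"
    and c: "K1 \<inter> M \<noteq> {}" "K2 \<inter> M \<noteq> {}"
  shows "z \<in> M"
proof (rule ccontr)
  assume z: "z \<notin> M"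
  have K': "K1 \<in> points" "K2 \<in> points" "z \<in> K1" "z \<in> K2" using K by (auto simp: pts_def)
  have zV: "z \<in> V" using K' point_sub by auto
  have "(K1 \<inter> M) \<inter> (K2 \<inter> M) = {}" using point_unique[OF K'(1,2)] K' K(3) z by blast
  moreover have "finite (K1 \<inter> M)" "finite (K2 \<inter> M)" using finite_point K' by auto
  ultimately have "card (K1 \<inter> M \<union> K2 \<inter> M) = card (K1 \<inter> M) + card (K2 \<inter> M)"
    by (intro card_Un_disjoint)
  moreover have "int (card (K1 \<inter> M)) = n + 1" "int (card (K2 \<inter> M)) = n + 1"
    using c planar_point[OF M] K' by blast+
  moreover have "K1 \<inter> M \<union> K2 \<inter> M \<subseteq> nb z \<inter> M"
    using z K' point_clique M unfolding nb_def planar_def by blast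
  then have "card (K1 \<inter> M \<union> K2 \<inter> M) \<le> card (nb z \<inter> M)" by (intro card_mono) auto
  moreover have "nb z \<inter> M = {} \<or> int (card (nb z \<inter> M)) = n + 1"
    using M z zV by (auto simp: planar_def)
  then have "int (card (nb z \<inter> M)) \<le> n + 1" using n3 by fastforce
  ultimately show False using n3 by linarith
qed

definition covered where "covered M = {K\<in>points. K \<inter> M \<noteq> {}}"

lemma incidence_sum:
  assumes "M \<subseteq> V"
  shows "(\<Sum>K\<in>points. int (card (K \<inter> M))) = int (card M) * n"
proof -
  have fM: "finite M" using assms fin finite_subset by blast
  have "(\<Sum>K\<in>points. int (card (K \<inter> M))) = int (\<Sum>K\<in>points. card {z\<in>M. z \<in> K})"
    by (simp add: Int_def conj_commute)
  also have "\<dots> = (\<Sum>z\<in>M. int (card (pts z)))"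
    using double_count[OF finite_points fM, of "\<lambda>K z. z \<in> K"] by (simp add: pts_def)
  also have "\<dots> = (\<Sum>z\<in>M. n)" using assms card_pts by (intro sum.cong refl) auto
  finally show ?thesis by simp
qed

lemma card_covered:
  assumes M: "planar M"
  shows "int (card (covered M)) = n^2"
proof -
  have "int (card M) * n = (\<Sum>K\<in>points. int (card (K \<inter> M)))"
    using M by (intro incidence_sum[symmetric]) (auto simp: planar_def)
  also have "\<dots> = (\<Sum>K\<in>covered M. int (card (K \<inter> M)))"
    by (rule sum.mono_neutral_right) (auto simp: covered_def)
  also have "\<dots> = (\<Sum>K\<in>covered M. n + 1)"
    using planar_point[OF M] by (intro sum.cong refl) (auto simp: covered_def)
  finally have "(n + 1) * n^2 = (n + 1) * int (card (covered M))"
    using M by (simp add: planar_def power2_eq_square algebra_simps)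
  then show ?thesis using n3 by simp
qed

text \<open>The members of a planar set are the lines of an affine plane of order \<open>n\<close>, and the cliques
  meeting it are the points of that plane.\<close>

lemma planar_parallel:
  assumes M: "planar M" and z: "z \<in> M" and K: "K \<in> covered M" "z \<notin> K"
  shows "card {w\<in>K\<inter>M. \<not> adj w z} = 1"
proof -
  have zV: "z \<in> V" and MV: "M \<subseteq> V" using M z by (auto simp: planar_def)
  have fM: "finite M" using MV fin finite_subset by blast
  \<comment> \<open>The n - 1 other lines of the parallel class of z.\<close>
  define NZ where "NZ = {w\<in>M. w \<noteq> z \<and> \<not> adj w z}"
  have "NZ = M - {z} - (nb z \<inter> M)" using sym MV by (auto simp: NZ_def nb_def)
  moreover have "card (M - {z} - (nb z \<inter> M)) = card (M - {z}) - card (nb z \<inter> M)"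
    using irrefl fM by (intro card_Diff_subset) (auto simp: nb_def)
  moreover have "card (nb z \<inter> M) \<le> card (M - {z})"
    using irrefl fM by (intro card_mono) (auto simp: nb_def)
  moreover have "int (card (M - {z})) = n * (n + 1) - 1" 
    using M z fM by (auto simp: planar_def card_Diff_singleton of_nat_diff card_gt_0_iff Suc_leI)
      (metis One_nat_def Suc_leI card_gt_0_iff empty_iff of_nat_1 of_nat_diff)
  moreover have "int (card (nb z \<inter> M)) = n^2" using M z by (auto simp: planar_def)
  ultimately have cNZ: "int (card NZ) = n - 1" by (simp add: of_nat_diff algebra_simps power2_eq_square)
  have fN: "finite NZ" using fM by (auto simp: NZ_def)
  define C where "C = covered M - pts z"
  have ptsM: "pts z \<subseteq> covered M" using z by (auto simp: covered_def pts_def)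
  have fC: "finite (covered M)" by (auto simp: covered_def)
  have cC: "int (card C) = n^2 - n"
    using card_covered[OF M] card_pts[OF zV] ptsM card_mono[OF fC ptsM] fC
    by (simp add: C_def card_Diff_subset of_nat_diff)
  \<comment> \<open>The n + 1 lines through \<open>L\<close> that meet z do so in distinct points of
    z, of which there are only \<open>n\<close>; so at least one of them is parallel to z.\<close>
  have ge: "int (card (L \<inter> NZ)) \<ge> 1" if L: "L \<in> C" for L
  proof -
    have L': "L \<in> points" "z \<notin> L" "L \<inter> M \<noteq> {}" using L by (auto simp: C_def covered_def pts_def)
    have fL: "finite L" using L' finite_point by auto
    have "\<forall>w\<in>L \<inter> M - NZ. \<exists>P. P \<in> pts z \<and> w \<in> P"
    proof
      fix w assume w: "w \<in> L \<inter> M - NZ"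
      then have "adj z w" using L' sym by (auto simp: NZ_def)
      then show "\<exists>P. P \<in> pts z \<and> w \<in> P" using point_exists[of z w] zV w MV by (auto simp: pts_def)
    qed
    then obtain p where p: "\<And>w. w \<in> L \<inter> M - NZ \<Longrightarrow> p w \<in> pts z \<and> w \<in> p w" by metis
    have "inj_on p (L \<inter> M - NZ)"
    proof (rule inj_onI)
      fix a b assume ab: "a \<in> L \<inter> M - NZ" "b \<in> L \<inter> M - NZ" "p a = p b"
      show "a = b"
      proof (rule ccontr)
        assume "a \<noteq> b"
        then have "L = p a" using point_unique[OF L'(1), of "p a" a b] p[of a] p[of b] ab by (auto simp: pts_def)
        then show False using p[OF ab(1)] L' by (auto simp: pts_def)
      qed
    qed
    then have "card (L \<inter> M - NZ) \<le> card (pts z)" using p by (intro card_inj_on_le[of p]) auto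
    moreover have "card (L \<inter> M) = card (L \<inter> M \<inter> NZ) + card (L \<inter> M - NZ)"
      using fL by (metis card_Int_Diff finite_Int)
    moreover have "L \<inter> M \<inter> NZ = L \<inter> NZ" by (auto simp: NZ_def)
    ultimately show ?thesis using planar_point[OF M L'(1)] L' card_pts[OF zV] by fastforce
  qed
  have "(\<Sum>L\<in>C. int (card (L \<inter> NZ))) = (\<Sum>L\<in>points. int (card (L \<inter> NZ)))"
  proof (rule sum.mono_neutral_left)
    have "L \<inter> NZ = {}" if L: "L \<in> points - C" for L
    proof (cases "z \<in> L")
      case True
      then show ?thesis using point_clique[of L _ z] L by (auto simp: NZ_def)
    next
      case False
      then show ?thesis using L by (auto simp: C_def covered_def pts_def NZ_def)
    qed
    then show "\<forall>L\<in>points - C. int (card (L \<inter> NZ)) = 0" by simp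
  qed (auto simp: C_def covered_def)
  also have "\<dots> = n * (n - 1)"
  proof -
    have "NZ \<subseteq> V" using MV by (auto simp: NZ_def)
    then show ?thesis using incidence_sum[of NZ] cNZ by (simp add: mult.commute)
  qed
  \<comment> \<open>There are n^2 - n points off z, and the n - 1 parallels have \<open>n\<close>
    points each; hence the average number of parallels through such a point is exactly 1.\<close>
  finally have "(\<Sum>L\<in>C. int (card (L \<inter> NZ)) - 1) = 0"
    using cC by (simp add: sum_subtractf power2_eq_square algebra_simps)
  then have "\<forall>L\<in>C. int (card (L \<inter> NZ)) - 1 = 0"
    by (subst (asm) sum_nonneg_eq_0_iff) (use ge fC in \<open>auto simp: C_def Suc_le_eq\<close>)
  moreover have "K \<in> C" using K by (auto simp: C_def pts_def)
  moreover have "{w\<in>K\<inter>M. \<not> adj w z} = K \<inter> NZ" using K by (auto simp: NZ_def)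
  ultimately show ?thesis by simp
qed

text \<open>This is where \<open>n \<ge> 3\<close> is needed: an affine plane of order at least three is generated by
  any two of its intersecting lines.\<close>

lemma planar_subset:
  assumes M: "planar M" "planar M'" and z: "z \<in> M" "z \<in> M'" and u: "u \<in> M" "u \<in> M'" and zu: "adj z u"
  shows "M \<subseteq> M'"
proof -
  have MV: "M \<subseteq> V" using M by (auto simp: planar_def)
  have fM: "finite M" using MV fin finite_subset by blast
  obtain P where P: "P \<in> points" "z \<in> P" "u \<in> P" using point_exists[of z u] z u zu MV by auto
  \<comment> \<open>Of the n + 1 >= 4 lines through a point \<open>K\<close> off z and u, at most
    one is parallel to z, one is parallel to u and one passes through the common point
    \<open>P\<close>. Another line w meets z and u in different points, so it lies in
    \<open>M'\<close> and \<open>K\<close> meets \<open>M'\<close>.\<close>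
  have cov: "K \<inter> M' \<noteq> {}" if K: "K \<in> covered M" for K
  proof (cases "z \<in> K \<or> u \<in> K")
    case True then show ?thesis using z u by auto
  next
    case False
    have K': "K \<in> points" "K \<inter> M \<noteq> {}" using K by (auto simp: covered_def)
    have fK: "finite K" using finite_point K' by auto
    have c: "int (card (K \<inter> M)) = n + 1" using planar_point[OF M(1) K'(1)] K' by auto
    have 1: "card {w\<in>K\<inter>M. \<not> adj w z} = 1" "card {w\<in>K\<inter>M. \<not> adj w u} = 1"
      using planar_parallel[OF M(1) _ K] z u False by auto
    have 2: "card (K \<inter> P) \<le> 1"
    proof (rule ccontr)
      assume "\<not> card (K \<inter> P) \<le> 1"
      then obtain a b where "a \<in> K \<inter> P" "b \<in> K \<inter> P" "a \<noteq> b" using fK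
        by (metis card_le_Suc0_iff_eq finite_Int One_nat_def)
      then have "K = P" using point_unique[OF K'(1) P(1)] by auto
      then show False using P False by auto
    qed
    have "\<not> K \<inter> M \<subseteq> {w\<in>K\<inter>M. \<not> adj w z} \<union> ({w\<in>K\<inter>M. \<not> adj w u} \<union> (K \<inter> P))"
    proof
      assume "K \<inter> M \<subseteq> {w\<in>K\<inter>M. \<not> adj w z} \<union> ({w\<in>K\<inter>M. \<not> adj w u} \<union> (K \<inter> P))"
      then have "card (K \<inter> M) \<le> card ({w\<in>K\<inter>M. \<not> adj w z} \<union> ({w\<in>K\<inter>M. \<not> adj w u} \<union> (K \<inter> P)))"
        using fK by (intro card_mono) auto
      also have "\<dots> \<le> card {w\<in>K\<inter>M. \<not> adj w z} + (card {w\<in>K\<inter>M. \<not> adj w u} + card (K \<inter> P))"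
        by (meson add_left_mono card_Un_le le_trans)
      finally show False using 1 2 c n3 by linarith
    qed
    then obtain w where w: "w \<in> K" "w \<in> M" "adj w z" "adj w u" "w \<notin> P" by auto
    have wV: "w \<in> V" "z \<in> V" "u \<in> V" using w z u MV by auto
    obtain Kz where Kz: "Kz \<in> points" "w \<in> Kz" "z \<in> Kz" using point_exists[of w z] w wV by auto
    obtain Ku where Ku: "Ku \<in> points" "w \<in> Ku" "u \<in> Ku" using point_exists[of w u] w wV by auto
    have "z \<noteq> u" using zu irrefl by auto
    then have "Kz \<noteq> Ku" using point_unique[OF P(1) Kz(1), of z u] P Kz Ku w by auto
    then have "w \<in> M'"
      using Kz Ku z u by (intro planar_closed[OF M(2), of Kz w Ku]) (auto simp: pts_def)
    then show ?thesis using w by auto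
  qed
  show ?thesis
  proof
    fix w assume w: "w \<in> M"
    have "int (card (pts w)) = n" using card_pts w MV by auto
    then have "\<not> card (pts w) \<le> 1" using n3 by linarith
    then obtain K1 K2 where K: "K1 \<in> pts w" "K2 \<in> pts w" "K1 \<noteq> K2"
      by (metis card_le_Suc0_iff_eq finite_pts One_nat_def)
    then have "K1 \<in> covered M" "K2 \<in> covered M" using w by (auto simp: pts_def covered_def)
    then show "w \<in> M'" using planar_closed[OF M(2) K] cov by auto
  qed
qed

end

section \<open>Distance-regular graphs\<close>

locale drg =
  fixes G :: "('a::finite) graph" and D :: nat
  assumes dr: "distance_regular G" and diam: "graph_diameter G = D" and D4: "D \<ge> 4"
begin

abbreviation d where "d \<equiv> graph_dist G"

section \<open>The path metric and the intersection numbers\<close>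

lemma G_sym: "G y z \<Longrightarrow> G z y"
  using dr by (auto simp: distance_regular_def simple_connected_graph_def symp_def)
lemma G_irrefl: "\<not> G y y"
  using dr by (auto simp: distance_regular_def simple_connected_graph_def irreflp_def)

lemma d_path: "(G ^^ d y z) y z"
proof -
  have "G\<^sup>*\<^sup>* y z" using dr by (auto simp: distance_regular_def simple_connected_graph_def)
  then obtain m where "(G ^^ m) y z" using rtranclp_imp_relpowp by metis
  then show ?thesis unfolding graph_dist_def by (rule LeastI)
qed

lemma d_least: "(G ^^ m) y z \<Longrightarrow> d y z \<le> m"
  unfolding graph_dist_def by (rule Least_le)

lemma path_sym: "(G ^^ m) y z \<Longrightarrow> (G ^^ m) z y"
proof (induction m arbitrary: z)
  case (Suc m)
  then obtain w where "(G ^^ m) y w" "G w z" by auto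
  then show ?case using Suc.IH[of w] G_sym relpowp_Suc_I2[of G z w m y] by blast
qed auto

lemma d_sym: "d y z = d z y"
  by (meson antisym d_least d_path path_sym)

lemma d_0 [simp]: "d y z = 0 \<longleftrightarrow> y = z"
proof
  assume "d y z = 0" then show "y = z" using d_path[of y z] by simp
next
  assume "y = z"
  moreover have "d y y \<le> 0" by (rule d_least) simp
  ultimately show "d y z = 0" by simp
qed

lemma d_refl [simp]: "d y y = 0" by simp

lemma d_tri: "d y z \<le> d y w + d w z"
proof (rule d_least)
  show "(G ^^ (d y w + d w z)) y z" using d_path relpowp_trans by metis
qed

lemma G_iff: "G y z \<longleftrightarrow> d y z = 1"
proof
  assume G: "G y z"
  then have "(G ^^ 1) y z" by auto
  then have "d y z \<le> 1" by (rule d_least)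
  moreover have "d y z \<noteq> 0" using G G_irrefl by auto
  ultimately show "d y z = 1" by linarith
next
  assume "d y z = 1" then show "G y z" using d_path[of y z] by auto
qed

lemma d_split: assumes "d y z = i + j" obtains w where "d y w = i" "d w z = j"
proof -
  have "(G ^^ (i + j)) y z" using d_path[of y z] assms by simp
  then obtain w where w: "(G ^^ i) y w" "(G ^^ j) w z" by (auto simp: relpowp_add)
  then have "d y w \<le> i" "d w z \<le> j" using d_least by auto
  moreover have "i + j \<le> d y w + d w z" using d_tri[of y z w] assms by simp
  ultimately show ?thesis using that[of w] by linarith
qed

lemma d_le: "d y z \<le> D"
proof -
  have "finite {d x y | x y. True}" by (rule finite_subset[of _ "(\<lambda>(x,y). d x y) ` UNIV"]) auto
  then show ?thesis unfolding diam[symmetric] graph_diameter_def by (intro Max_ge) auto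
qed

lemma d_attained: assumes "h \<le> D" obtains y z where "d y z = h"
proof -
  have "finite {d x y | x y. True}" by (rule finite_subset[of _ "(\<lambda>(x,y). d x y) ` UNIV"]) auto
  then have "D \<in> {d x y | x y. True}" unfolding diam[symmetric] graph_diameter_def by (intro Max_in) auto
  then obtain y z where "d y z = D" by auto
  then have "d y z = h + (D - h)" using assms by simp
  then show ?thesis using that d_split by metis
qed

lemma intersection:
  assumes "i \<le> D" "j \<le> D"
  shows "card {w. d y w = i \<and> d z w = j} = intersection_number G (d y z) i j"
proof -
  define h where "h = d y z"
  have "h \<le> D" by (simp add: h_def d_le)
  then obtain p where p: "\<forall>y z. d y z = h \<longrightarrow> card {w. d y w = i \<and> d z w = j} = p"
    using dr assms diam unfolding distance_regular_def by blast
  have "intersection_number G h i j = p"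
    unfolding intersection_number_def
  proof (rule the_equality)
    show "\<forall>y z. d y z = h \<longrightarrow> card {w. d y w = i \<and> d z w = j} = p" by (rule p)
  next
    fix p' assume "\<forall>y z. d y z = h \<longrightarrow> card {w. d y w = i \<and> d z w = j} = p'"
    then show "p' = p" using p h_def by metis
  qed
  then show ?thesis using p h_def by metis
qed

text \<open>The boundary values \<open>c 0 = 0\<close> and \<open>b D = 0\<close> are built in: at 0
  the index \<open>h - 1\<close> is truncated, and at D the index \<open>h + 1\<close> leaves the
  range of \<open>intersection\<close>.\<close>

definition c where "c h = (if h = 0 then 0 else real (c_number G h))"
definition b where "b h = (if h < D then real (b_number G h) else 0)"
definition a where "a h = b 0 - b h - c h"

lemma G_dist: "G y w \<Longrightarrow> d w z = d y z \<or> d w z = Suc (d y z) \<or> Suc (d w z) = d y z"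
  using d_tri[of w z y] d_tri[of y z w] G_iff[of y w] d_sym[of y w] by force

lemma card_c: "real (card {w. G y w \<and> Suc (d w z) = d y z}) = c (d y z)"
proof (cases "d y z")
  case (Suc h)
  have "{w. G y w \<and> Suc (d w z) = d y z} = {w. d y w = 1 \<and> d z w = h}"
    using Suc G_iff by (auto simp: d_sym[of z])
  then show ?thesis using intersection[of 1 h y z] d_le[of y z] D4 Suc by (simp add: c_def c_number_def)
qed (simp add: c_def)

lemma card_b: "real (card {w. G y w \<and> d w z = Suc (d y z)}) = b (d y z)"
proof (cases "d y z < D")
  case True
  have "{w. G y w \<and> d w z = Suc (d y z)} = {w. d y w = 1 \<and> d z w = Suc (d y z)}"
    using G_iff by (auto simp: d_sym[of z])
  then show ?thesis using intersection[of 1 "Suc (d y z)" y z] True D4 by (simp add: b_def b_number_def)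
next
  case False
  then have "{w. G y w \<and> d w z = Suc (d y z)} = {}" using d_le by (metis (mono_tags, lifting) Collect_empty_eq Suc_le_lessD)
  then show ?thesis using False by (simp add: b_def)
qed

lemma card_G: "real (card {w. G y w}) = b 0"
proof -
  have "{w. G y w \<and> d w y = Suc (d y y)} = {w. G y w}" using G_iff d_sym[of y] by auto
  then show ?thesis using card_b[of y y] by simp
qed

lemma G_split: "{w. G y w} = {w. G y w \<and> Suc (d w z) = d y z} \<union> ({w. G y w \<and> d w z = d y z} \<union> {w. G y w \<and> d w z = Suc (d y z)})"
  using G_dist[of y _ z] by auto

lemma card_a: "real (card {w. G y w \<and> d w z = d y z}) = a (d y z)"
proof -
  have "card {w. G y w} = card {w. G y w \<and> Suc (d w z) = d y z} + (card {w. G y w \<and> d w z = d y z} + card {w. G y w \<and> d w z = Suc (d y z)})"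
    by (subst G_split[of y z], subst card_Un_disjoint, (auto)[3], subst card_Un_disjoint) auto
  then have "real (card {w. G y w}) = real (card {w. G y w \<and> Suc (d w z) = d y z}) + (real (card {w. G y w \<and> d w z = d y z}) + real (card {w. G y w \<and> d w z = Suc (d y z)}))"
    by linarith
  then show ?thesis using card_G card_b[of y z] card_c[of y z] by (simp add: a_def)
qed

section \<open>The adjacency operator on real functions\<close>

definition adj_op :: "('a \<Rightarrow> real) \<Rightarrow> 'a \<Rightarrow> real" where
  "adj_op f y = (\<Sum>w | G y w. f w)"

text \<open>The tridiagonal intersection matrix acting on functions of the distance. The values of
  \<phi> at the truncated index for h = 0 and at D + 1 for h = D are multiplied by 0.\<close>

definition transfer :: "(nat \<Rightarrow> real) \<Rightarrow> nat \<Rightarrow> real" where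
  "transfer \<phi> h = c h * \<phi> (h - 1) + a h * \<phi> h + b h * \<phi> (Suc h)"

lemma adj_op_dist: "adj_op (\<lambda>w. \<phi> (d w z)) y = transfer \<phi> (d y z)"
proof -
  have "adj_op (\<lambda>w. \<phi> (d w z)) y = (\<Sum>w | G y w \<and> Suc (d w z) = d y z. \<phi> (d w z)) +
     ((\<Sum>w | G y w \<and> d w z = d y z. \<phi> (d w z)) + (\<Sum>w | G y w \<and> d w z = Suc (d y z). \<phi> (d w z)))"
    unfolding adj_op_def by (subst G_split[of y z], subst sum.union_disjoint, (auto)[3], subst sum.union_disjoint) auto
  also have "(\<Sum>w | G y w \<and> Suc (d w z) = d y z. \<phi> (d w z)) = (\<Sum>w | G y w \<and> Suc (d w z) = d y z. \<phi> (d y z - 1))"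
    by (rule sum.cong[OF refl]) (metis (mono_tags, lifting) diff_Suc_1 mem_Collect_eq)
  also have "\<dots> = c (d y z) * \<phi> (d y z - 1)" using card_c[of y z] by simp
  also have "(\<Sum>w | G y w \<and> d w z = d y z. \<phi> (d w z)) = (\<Sum>w | G y w \<and> d w z = d y z. \<phi> (d y z))"
    by (intro sum.cong refl) auto
  also have "\<dots> = a (d y z) * \<phi> (d y z)" using card_a[of y z] by simp
  also have "(\<Sum>w | G y w \<and> d w z = Suc (d y z). \<phi> (d w z)) = (\<Sum>w | G y w \<and> d w z = Suc (d y z). \<phi> (Suc (d y z)))"
    by (intro sum.cong refl) auto
  also have "\<dots> = b (d y z) * \<phi> (Suc (d y z))" using card_b[of y z] by simp
  finally show ?thesis by (simp add: transfer_def)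
qed

lemma adj_op_add: "adj_op (\<lambda>y. f y + g y) y = adj_op f y + adj_op g y"
  by (simp add: adj_op_def sum.distrib)
lemma adj_op_scale: "adj_op (\<lambda>y. s * f y) y = s * adj_op f y"
  by (simp add: adj_op_def sum_distrib_left)
lemma adj_op_sum: "adj_op (\<lambda>y. \<Sum>z\<in>Z. f z y) y = (\<Sum>z\<in>Z. adj_op (f z) y)"
  unfolding adj_op_def by (rule sum.swap)
lemma adj_op_const: "adj_op (\<lambda>y. s) y = b 0 * s"
  using card_G[of y] by (simp add: adj_op_def)

lemma sum_G_swap: "(\<Sum>y\<in>UNIV. \<Sum>w | G y w. F y w) = (\<Sum>w\<in>UNIV. \<Sum>y | G w y. F y w)"
  for F :: "'a \<Rightarrow> 'a \<Rightarrow> 'b::comm_monoid_add"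
proof -
  have "(\<Sum>y\<in>UNIV. \<Sum>w | G y w. F y w) = (\<Sum>y\<in>UNIV. \<Sum>w\<in>UNIV. if G y w then F y w else 0)"
    by (rule sum.cong[OF refl]) (simp add: sum.If_cases)
  also have "\<dots> = (\<Sum>w\<in>UNIV. \<Sum>y\<in>UNIV. if G y w then F y w else 0)" by (rule sum.swap)
  also have "\<dots> = (\<Sum>w\<in>UNIV. \<Sum>y\<in>UNIV. if G w y then F y w else 0)"
    using G_sym by (intro sum.cong refl) metis
  also have "\<dots> = (\<Sum>w\<in>UNIV. \<Sum>y | G w y. F y w)"
    by (rule sum.cong[OF refl]) (simp add: sum.If_cases)
  finally show ?thesis .
qed

lemma adj_op_self_adjoint: "(\<Sum>y\<in>UNIV. adj_op f y * g y) = (\<Sum>y\<in>UNIV. f y * adj_op g y)"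
proof -
  have "(\<Sum>y\<in>UNIV. adj_op f y * g y) = (\<Sum>y\<in>UNIV. \<Sum>w | G y w. f w * g y)"
    by (simp add: adj_op_def sum_distrib_right)
  also have "\<dots> = (\<Sum>w\<in>UNIV. \<Sum>y | G w y. f w * g y)" by (rule sum_G_swap)
  finally show ?thesis by (simp add: adj_op_def sum_distrib_left)
qed

end

section \<open>The Krein condition\<close>

locale classical_drg = drg G D for G :: "('a::finite) graph" and D :: nat +
  fixes qi :: int
  assumes q2: "qi \<ge> 2"
    and parameters: "has_classical_parameters G D (of_int qi) (of_int qi + 1)
      ((of_int qi ^ (D + 1) * (of_int qi + 1) - of_int qi ^ 2 - 1) / (of_int qi - 1))"
begin

section \<open>The intersection numbers in terms of q, n and N\<close>

definition q :: real where "q = of_int qi"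
definition n :: real where "n = q + 1"
definition N :: real where "N = q_bracket q D"

lemma q_ge: "q \<ge> 2" using q2 by (simp add: q_def)

lemma bracket: "q_bracket q j = (q ^ j - 1) / (q - 1)"
  using q_ge by (simp add: q_bracket_def sum_gp0 geometric_sum)

lemma q_D: "q ^ D = (q - 1) * N + 1"
  using q_ge by (simp add: N_def bracket)

lemma N_ge: "N \<ge> 1 + q + q^2 + q^3"
proof -
  have "1 + q + q^2 + q^3 = (\<Sum>k<4. q ^ k)" by (simp add: eval_nat_numeral)
  also have "\<dots> \<le> (\<Sum>k<D. q ^ k)" using D4 q_ge by (intro sum_mono2) auto
  finally show ?thesis by (simp add: N_def q_bracket_def)
qed

lemma N_gt: "N > q + 1" "N > 7"
proof -
  have "q^2 \<ge> 2^2" "q^3 \<ge> 2^3" using q_ge by (intro power_mono; simp)+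
  then show "N > q + 1" "N > 7" using N_ge q_ge by auto
qed

lemma beta: "(q ^ (D + 1) * (q + 1) - q ^ 2 - 1) / (q - 1) = q * n * N + 1"
proof -
  have "q ^ (D + 1) * (q + 1) - q ^ 2 - 1 = (q * n * N + 1) * (q - 1)"
    by (simp add: q_D n_def algebra_simps power2_eq_square)
  then show ?thesis using q_ge by simp
qed

lemma c_eq:
  assumes "h \<le> D"
  shows "c h = (q ^ h - 1) * (n / q * q ^ h - 2) / (q - 1)^2"
proof (cases h)
  case 0 then show ?thesis by (simp add: c_def)
next
  case (Suc m)
  have "c h = q_bracket q h * (1 + n * q_bracket q (h - 1))"
    using parameters assms Suc by (simp add: has_classical_parameters_def c_def q_def n_def)
  also have "\<dots> = (q ^ h - 1) * (n / q * q ^ h - 2) / (q - 1)^2"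
    unfolding bracket n_def Suc using q_ge by (simp add: divide_simps power2_eq_square) (auto simp: algebra_simps)
  finally show ?thesis .
qed

lemma b_eq:
  assumes "h \<le> D"
  shows "b h = (N - q_bracket q h) * (q * n * N + 1 - n * q_bracket q h)"
proof (cases "h = D")
  case True then show ?thesis by (simp add: b_def N_def)
next
  case False
  then have "h < D" using assms by simp
  then show ?thesis
    using parameters beta by (simp add: has_classical_parameters_def b_def q_def n_def N_def)
qed

lemma b0: "b 0 = N * (q * n * N + 1)"
  using b_eq[of 0] by (simp add: bracket)
lemma b1: "b 1 = q * (N - 1) * (n * N - 1)"
  using b_eq[of 1] D4 by (simp add: q_bracket_def n_def algebra_simps)
lemma b2: "b 2 = q * (N - n) * (n * N - q - 2)"
  using b_eq[of 2] D4 by (simp add: q_bracket_def n_def algebra_simps eval_nat_numeral)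
lemma c1: "c 1 = 1"
proof -
  have "(q ^ 1 - 1) * (n / q * q ^ 1 - 2) = (q - 1)^2"
    using q_ge by (simp add: n_def power2_eq_square)
  then show ?thesis using c_eq[of 1] D4 q_ge by simp
qed
lemma c2: "c 2 = n * (n + 1)"
proof -
  have "(q ^ 2 - 1) * (n / q * q ^ 2 - 2) = n * (n + 1) * (q - 1)^2"
    using q_ge by (simp add: n_def field_simps power2_eq_square)
  then show ?thesis using c_eq[of 2] D4 q_ge by simp
qed
lemma a1: "a 1 = n * (n * N - 1)"
  unfolding a_def b0 b1 c1 by (simp add: n_def algebra_simps)
lemma a2: "a 2 = n^2 * (n * N - n - 1)"
  unfolding a_def b0 b2 c2 by (simp add: n_def algebra_simps power2_eq_square)
lemma c0: "c 0 = 0" by (simp add: c_def)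
lemma a0: "a 0 = 0" by (simp add: a_def c_def)

lemma n_ge: "n \<ge> 3" using q_ge by (simp add: n_def)
lemma c_pos: assumes "1 \<le> h" "h \<le> D" shows "c h > 0"
proof -
  have "q ^ h \<ge> q ^ 1" using assms q_ge by (intro power_increasing) auto
  then have "q ^ h \<ge> q" by simp
  moreover have "n / q * q ^ h \<ge> n / q * q" using calculation q_ge by (intro mult_left_mono) (auto simp: n_def)
  ultimately have "q ^ h - 1 > 0" "n / q * q ^ h - 2 > 0" using q_ge by (auto simp: n_def)
  then show ?thesis using c_eq[OF assms(2)] q_ge by simp
qed
lemma b_pos: "b 1 > 0" "b 2 > 0" "a 2 > 0" "c 2 > 0" "a 1 > 0" "b 0 > 0"
proof -
  have "n * N \<ge> 3 * N" using n_ge N_gt by (intro mult_right_mono) auto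
  moreover have "N > n" using N_gt by (simp add: n_def)
  ultimately have *: "n * N - 1 > 0" "n * N - q - 2 > 0" "n * N - n - 1 > 0" "N - n > 0" "N - 1 > 0"
    using N_gt n_ge unfolding n_def by linarith+
  then show "b 1 > 0" "b 2 > 0" "a 2 > 0" "c 2 > 0" "a 1 > 0" "b 0 > 0"
    using q_ge n_ge N_gt unfolding b0 b1 b2 a1 a2 c2 by (auto intro!: mult_pos_pos add_pos_pos)
qed

text \<open>The eigenvalues [D-i](\<beta> - \<alpha>[i]) - [i] of a graph with classical parameters,
  for i = 1 and i = 2, in terms of \<open>q\<close>, \<open>n\<close> and \<open>N\<close>.\<close>

definition theta1 where "theta1 = (N - 1) * (n * N - 1) - 1"
definition theta2 where "theta2 = (N - n) * (n * N - q - 2) / q - n"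

lemma transfer_power:
  assumes "h \<le> D"
  shows "transfer (\<lambda>i. w ^ i) h = b 0 * w ^ h + c h * (if h = 0 then 0 else w ^ (h - 1) - w ^ h) + b h * (w ^ Suc h - w ^ h)"
  using assms by (cases h) (auto simp: transfer_def a_def c_def algebra_simps)

lemma b_power:
  assumes "h \<le> D"
  shows "b h = ((q - 1) * N + 1 - q ^ h) * ((q - 1) * (q * n * N + 1) + n - n * q ^ h) / (q - 1)^2"
  unfolding b_eq[OF assms] bracket using q_ge by (simp add: field_simps power2_eq_square)

text \<open>Both \<open>c h\<close> and \<open>b h\<close> are quadratic in Q = q^h, and the
  differences of powers of 1/q are multiples of 1/Q. Only 1/Q, 1 and Q can occur, and the
  coefficient of Q cancels.\<close>

lemma transfer_1:
  assumes h: "h \<le> D"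
  shows "transfer (\<lambda>i. (1/q) ^ i) h = theta1 * (1/q) ^ h + (b 0 / q - theta1)"
proof -
  define Q where "Q = q ^ h"
  have Q: "Q > 0" "(1/q)^h = 1 / Q" using q_ge by (auto simp: Q_def power_one_over)
  have "c h * (if h = 0 then 0 else (1/q) ^ (h - 1) - (1/q) ^ h) = c h * (q / Q - 1 / Q)"
    using q_ge by (cases h) (auto simp: c_def Q_def power_one_over field_simps)
  then have "transfer (\<lambda>i. (1/q) ^ i) h = b 0 / Q + c h * (q / Q - 1 / Q) + b h * (1 / (Q * q) - 1 / Q)"
    unfolding transfer_power[OF h] using Q by (simp add: mult.commute)
  also have "\<dots> = theta1 * (1 / Q) + (b 0 / q - theta1)"
    unfolding c_eq[OF h] b_power[OF h] Q_def[symmetric] b0 theta1_def n_def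
    using Q(1) q_ge by (simp add: divide_simps power2_eq_square) (simp add: algebra_simps)
  also have "\<dots> = theta1 * (1/q) ^ h + (b 0 / q - theta1)" by (simp only: Q(2))
  finally show ?thesis .
qed

text \<open>Now the differences are multiples of 1/Q^2, and a quadratic in Q times 1/Q^2 is a
  combination of 1/Q^2, 1/Q and 1; \<open>s\<close> and \<open>t\<close> are its coefficients at Q
  and Q^2.\<close>

lemma transfer_2:
  obtains s t where "\<And>h. h \<le> D \<Longrightarrow> transfer (\<lambda>i. (1/q^2) ^ i) h = theta2 * (1/q^2) ^ h + s * (1/q) ^ h + t"
proof
  fix h assume h: "h \<le> D"
  define Q where "Q = q ^ h"
  define s where "s = (- (2 + n / q) * (q^2 - 1) - (n * ((q-1)*N+1) + (q - 1) * (q * n * N + 1) + n) * (1/q^2 - 1)) / (q - 1)^2"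
  define t where "t = (n / q * (q^2 - 1) + n * (1/q^2 - 1)) / (q - 1)^2"
  have Q: "Q > 0" "(1/q)^h = 1 / Q" "(1/q^2)^h = 1 / (Q * Q)" using q_ge
    by (auto simp: Q_def power_one_over power2_eq_square power_mult_distrib)
  have "c h * (if h = 0 then 0 else (1/q^2) ^ (h - 1) - (1/q^2) ^ h) = c h * (q^2 - 1) * (1 / (Q * Q))"
  proof (cases h)
    case (Suc m)
    then show ?thesis using q_ge unfolding Q(3)[symmetric] by (simp add: field_simps)
  qed (simp add: c_def)
  then have "transfer (\<lambda>i. (1/q^2) ^ i) h = (b 0 + c h * (q^2 - 1) + b h * (1/q^2 - 1)) * (1 / (Q * Q))"
    unfolding transfer_power[OF h] by (simp add: Q algebra_simps)
  moreover have "b 0 + c h * (q^2 - 1) + b h * (1/q^2 - 1) = theta2 + s * Q + t * (Q * Q)"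
    unfolding c_eq[OF h] b_power[OF h] Q_def[symmetric] b0 theta2_def n_def s_def t_def
    using q_ge by (simp add: divide_simps power2_eq_square) (simp add: algebra_simps)
  ultimately have "transfer (\<lambda>i. (1/q^2) ^ i) h = (theta2 + s * Q + t * (Q * Q)) * (1 / (Q * Q))" by simp
  also have "\<dots> = theta2 * (1/q^2) ^ h + s * (1/q) ^ h + t"
    using Q by (simp add: field_simps)
  finally show "transfer (\<lambda>i. (1/q^2) ^ i) h = theta2 * (1/q^2) ^ h + 
   ((- (2 + n / q) * (q^2 - 1) - (n * ((q-1)*N+1) + (q - 1) * (q * n * N + 1) + n) * (1/q^2 - 1)) / (q - 1)^2) * (1/q) ^ h 
   + (n / q * (q^2 - 1) + n * (1/q^2 - 1)) / (q - 1)^2" by (simp add: s_def t_def)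
qed

text \<open>By \<open>adj_K\<close>, each column is, up to an additive constant, an eigenvector of A
  for \<open>theta1\<close>.\<close>

definition K :: "'a \<Rightarrow> 'a \<Rightarrow> real" where "K z y = (1/q) ^ d y z"

lemma K_sym: "K y z = K z y" by (simp add: K_def d_sym)

lemma adj_K: "adj_op (K z) y = theta1 * K z y + (b 0 / q - theta1)"
  unfolding K_def using adj_op_dist[of "\<lambda>i. (1/q)^i" z y] transfer_1[OF d_le] by simp

lemma adj_K2: obtains s t where "\<And>z y. adj_op (\<lambda>w. K z w ^ 2) y = theta2 * K z y ^ 2 + s * K z y + t"
proof -
  obtain s t where st: "\<And>h. h \<le> D \<Longrightarrow> transfer (\<lambda>i. (1/q^2) ^ i) h = theta2 * (1/q^2) ^ h + s * (1/q) ^ h + t"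
    using transfer_2 by blast
  have K2: "K z y ^ 2 = (1/q^2) ^ d y z" for z y
    by (simp add: K_def power_one_over power_mult[symmetric] mult.commute)
  show ?thesis
  proof
    fix z y
    show "adj_op (\<lambda>w. K z w ^ 2) y = theta2 * K z y ^ 2 + s * K z y + t"
      unfolding K2 using adj_op_dist[of "\<lambda>i. (1/q^2)^i" z y] st[OF d_le] by (simp add: K_def)
  qed
qed

text \<open>\<open>A\<close> generates the Bose--Mesner algebra and preserves the span of \<open>K\<close> and the all-ones matrix.\<close>

lemma kernel_K: "\<exists>s t. \<forall>y z. (\<Sum>w\<in>UNIV. \<phi> (d y w) * K z w) = s * K z y + t"
proof -
  define S where "S = {\<phi>. \<exists>s t. \<forall>y z. (\<Sum>w\<in>UNIV. \<phi> (d y w) * K z w) = s * K z y + t}"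
  have add: "(\<lambda>i. \<phi> i + \<psi> i) \<in> S" if "\<phi> \<in> S" "\<psi> \<in> S" for \<phi> \<psi> :: "nat \<Rightarrow> real"
  proof -
    obtain s t where "\<forall>y z. (\<Sum>w\<in>UNIV. \<phi> (d y w) * K z w) = s * K z y + t"
      using \<open>\<phi> \<in> S\<close> unfolding S_def by blast
    moreover obtain s' t' where "\<forall>y z. (\<Sum>w\<in>UNIV. \<psi> (d y w) * K z w) = s' * K z y + t'"
      using \<open>\<psi> \<in> S\<close> unfolding S_def by blast
    ultimately have "\<forall>y z. (\<Sum>w\<in>UNIV. (\<phi> (d y w) + \<psi> (d y w)) * K z w) = (s + s') * K z y + (t + t')"
      by (simp add: algebra_simps sum.distrib)
    then show ?thesis unfolding S_def by blast
  qed
  have scale: "(\<lambda>i. l * \<phi> i) \<in> S" if "\<phi> \<in> S" for \<phi> :: "nat \<Rightarrow> real" and l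
  proof -
    obtain s t where "\<forall>y z. (\<Sum>w\<in>UNIV. \<phi> (d y w) * K z w) = s * K z y + t"
      using \<open>\<phi> \<in> S\<close> unfolding S_def by blast
    then have "\<forall>y z. (\<Sum>w\<in>UNIV. (l * \<phi> (d y w)) * K z w) = (l * s) * K z y + l * t"
      by (simp add: algebra_simps sum_distrib_left[symmetric])
    then show ?thesis unfolding S_def by blast
  qed
  have cong: "\<psi> \<in> S" if "\<phi> \<in> S" "\<And>i. i \<le> D \<Longrightarrow> \<psi> i = \<phi> i" for \<phi> \<psi> :: "nat \<Rightarrow> real"
    using that d_le by (simp add: S_def)
  have trans: "transfer \<phi> \<in> S" if "\<phi> \<in> S" for \<phi>
  proof -
    obtain s t where st: "\<And>y z. (\<Sum>w\<in>UNIV. \<phi> (d y w) * K z w) = s * K z y + t"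
      using \<open>\<phi> \<in> S\<close> unfolding S_def by blast
    have "(\<Sum>w\<in>UNIV. transfer \<phi> (d y w) * K z w) = (s * theta1) * K z y + (s * (b 0 / q - theta1) + b 0 * t)" for y z
    proof -
      have "(\<Sum>w\<in>UNIV. transfer \<phi> (d y w) * K z w) = (\<Sum>w\<in>UNIV. adj_op (\<lambda>u. \<phi> (d u w)) y * K z w)"
        by (simp add: adj_op_dist)
      also have "\<dots> = (\<Sum>w\<in>UNIV. adj_op (\<lambda>u. \<phi> (d u w) * K z w) y)"
        by (simp add: adj_op_def sum_distrib_right)
      also have "\<dots> = adj_op (\<lambda>u. \<Sum>w\<in>UNIV. \<phi> (d u w) * K z w) y"
        by (simp add: adj_op_sum)
      also have "\<dots> = s * adj_op (K z) y + b 0 * t"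
        unfolding st by (simp add: adj_op_add adj_op_scale adj_op_const)
      finally show ?thesis by (simp add: adj_K algebra_simps)
    qed
    then show ?thesis unfolding S_def by blast
  qed
  have deltas: "(\<lambda>i. if i = h then 1 else 0) \<in> S" if "h \<le> D" for h
    using that
  proof (induction h rule: less_induct)
    case (less h)
    show ?case
    proof (cases h)
      case 0
      have "(\<Sum>w\<in>UNIV. (if d y w = 0 then 1 else 0) * K z w) = 1 * K z y + 0" for y z
        by (simp add: if_distrib[of "\<lambda>u. u * _"] cong: if_cong)
      then show ?thesis unfolding 0 S_def by blast
    next
      case (Suc m)
      \<comment> \<open>The transfer of the delta at m has the values b (m-1), a m, c (m+1) at m-1,
        m, m+1. Removing the first two leaves a nonzero multiple of the delta at m+1.\<close>
      define del where "del i = (\<lambda>j. if j = i then 1 else (0::real))" for i :: nat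
      have em: "del m \<in> S" "m = 0 \<or> del (m - 1) \<in> S" using less Suc by (auto simp: del_def)
      have ch: "c h > 0" using less Suc by (intro c_pos) auto
      define \<psi> where "\<psi> = (\<lambda>i. transfer (del m) i + - a m * del m i)"
      have "\<psi> \<in> S" unfolding \<psi>_def using trans em scale add by blast
      define \<xi> where "\<xi> = (\<lambda>i. if m = 0 then \<psi> i else \<psi> i + - b (m - 1) * del (m - 1) i)"
      have "\<xi> \<in> S"
      proof (cases "m = 0")
        case False
        then have "(\<lambda>i. \<psi> i + - b (m - 1) * del (m - 1) i) \<in> S" using em scale add \<open>\<psi> \<in> S\<close> by blast
        then show ?thesis using False by (simp add: \<xi>_def)
      qed (use \<open>\<psi> \<in> S\<close> in \<open>simp add: \<xi>_def\<close>)
      then have "(\<lambda>i. 1 / c h * \<xi> i) \<in> S" by (rule scale)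
      then show ?thesis
      proof (rule cong)
        fix i
        have "\<xi> i = (if i = h then c h else 0)"
          using Suc c0 by (cases m; cases i) (auto simp: \<xi>_def \<psi>_def transfer_def del_def)
        then show "(if i = h then 1 else 0) = 1 / c h * \<xi> i" using ch by simp
      qed
    qed
  qed
  have "(\<lambda>i. \<Sum>h\<le>m. \<phi> h * (if i = h then 1 else 0)) \<in> S" if "m \<le> D" for m
    using that
  proof (induction m)
    case 0 then show ?case using scale[OF deltas[of 0], of "\<phi> 0"] by simp
  next
    case (Suc m) then show ?case using add[OF Suc.IH scale[OF deltas[of "Suc m"], of "\<phi> (Suc m)"]] by simp
  qed
  then have "(\<lambda>i. \<Sum>h\<le>D. \<phi> h * (if i = h then 1 else 0)) \<in> S" by simp
  then have "\<phi> \<in> S"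
    by (rule cong) (simp add: if_distrib[of "\<lambda>u. _ * u"] cong: if_cong)
  then show ?thesis by (simp add: S_def)
qed

lemma K_K: obtains s t where "\<And>y z. (\<Sum>w\<in>UNIV. K y w * K z w) = s * K z y + t"
proof -
  have "\<exists>s t. \<forall>y z. (\<Sum>w\<in>UNIV. K y w * K z w) = s * K z y + t"
    using kernel_K[of "\<lambda>i. (1/q)^i"] by (simp add: K_def d_sym)
  then show ?thesis using that by blast
qed

text \<open>\<open>F = (A - theta1)(A - theta2)\<close> kills, up to constants, the squares of \<open>K\<close> and hence
  (by a sum-of-squares argument) all products of two columns of \<open>K\<close>; this is the vanishing of
  the Krein parameters \<open>q\<^sub>1\<^sub>1\<^sup>h\<close> for \<open>h \<ge> 3\<close>.\<close>

definition F where "F f y = adj_op (adj_op f) y - (theta1 + theta2) * adj_op f y + theta1 * theta2 * f y"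

lemma F_scale: "F (\<lambda>y. s * f y) y = s * F f y"
  by (simp add: F_def adj_op_scale[abs_def] adj_op_scale algebra_simps)

lemma F_sum: "F (\<lambda>y. \<Sum>z\<in>Z. f z y) y = (\<Sum>z\<in>Z. F (f z) y)"
proof -
  have "adj_op (\<lambda>y. \<Sum>z\<in>Z. f z y) = (\<lambda>y. \<Sum>z\<in>Z. adj_op (f z) y)" by (rule ext) (rule adj_op_sum)
  then show ?thesis by (simp add: F_def adj_op_sum sum.distrib sum_subtractf sum_distrib_left)
qed

lemma F_const: "F (\<lambda>y. s) y = (b 0 - theta1) * (b 0 - theta2) * s"
proof -
  have "adj_op (\<lambda>y. s) = (\<lambda>y. b 0 * s)" by (rule ext) (rule adj_op_const)
  then show ?thesis by (simp add: F_def adj_op_const algebra_simps)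
qed

lemma F_self_adjoint: "(\<Sum>y\<in>UNIV. F f y * g y) = (\<Sum>y\<in>UNIV. f y * F g y)"
proof -
  have "(\<Sum>y\<in>UNIV. F f y * g y) = (\<Sum>y\<in>UNIV. adj_op (adj_op f) y * g y) - (theta1 + theta2) * (\<Sum>y\<in>UNIV. adj_op f y * g y) + theta1 * theta2 * (\<Sum>y\<in>UNIV. f y * g y)"
    by (simp add: F_def algebra_simps sum.distrib sum_subtractf sum_distrib_left)
  also have "\<dots> = (\<Sum>y\<in>UNIV. f y * adj_op (adj_op g) y) - (theta1 + theta2) * (\<Sum>y\<in>UNIV. f y * adj_op g y) + theta1 * theta2 * (\<Sum>y\<in>UNIV. f y * g y)"
    by (simp add: adj_op_self_adjoint)
  also have "\<dots> = (\<Sum>y\<in>UNIV. f y * F g y)"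
    by (simp add: F_def algebra_simps sum.distrib sum_subtractf sum_distrib_left)
  finally show ?thesis .
qed

lemma F_K: obtains s where "\<And>z y. F (K z) y = s"
proof
  fix z y
  define e where "e = b 0 / q - theta1"
  have 1: "adj_op (K z) = (\<lambda>y. theta1 * K z y + e)" by (rule ext) (simp add: adj_K e_def)
  have 2: "adj_op (K z) y = theta1 * K z y + e" by (simp add: 1)
  have "adj_op (adj_op (K z)) y = theta1 * adj_op (K z) y + b 0 * e"
    by (subst 1) (simp only: adj_op_add adj_op_scale adj_op_const)
  then have "F (K z) y = e * (b 0 - theta2)" by (simp add: F_def 2 algebra_simps)
  then show "F (K z) y = (b 0 / q - theta1) * (b 0 - theta2)"
    by (simp only: e_def)
qed

lemma F_K2: obtains s where "\<And>z y. F (\<lambda>w. K z w ^ 2) y = s"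
proof -
  obtain s t where st: "\<And>z y. adj_op (\<lambda>w. K z w ^ 2) y = theta2 * K z y ^ 2 + s * K z y + t"
    using adj_K2 by blast
  show ?thesis
  proof
    fix z y
    have "adj_op (\<lambda>w. K z w ^ 2) = (\<lambda>y. theta2 * K z y ^ 2 + s * K z y + t)" by (rule ext) (rule st)
    then have "adj_op (adj_op (\<lambda>w. K z w ^ 2)) y = theta2 * adj_op (\<lambda>w. K z w ^ 2) y + s * adj_op (K z) y + b 0 * t"
      by (simp only: adj_op_add adj_op_scale adj_op_const)
    then show "F (\<lambda>w. K z w ^ 2) y = s * (b 0 / q - theta1) + (b 0 - theta1) * t"
      by (simp add: F_def adj_K st algebra_simps)
  qed
qed

text \<open>Each row \<open>f u\<close> of the corrected operator annihilates constants, the columns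
  of \<open>K\<close> and their squares. Summing the squares of its values \<open>T u x z\<close> on
  all products of two columns turns the columns into the squared Gram entries (s K + t)^2, a
  combination of precisely those annihilated functions. So the sum of squares is 0 and every
  \<open>T u x z\<close> vanishes.\<close>

lemma F_product: "\<exists>s. \<forall>u. F (\<lambda>y. K x y * K z y) u = s"
proof -
  define m where "m = real (card (UNIV :: 'a set))"
  have m: "m > 0" by (simp add: m_def card_gt_0_iff)
  define \<delta> where "\<delta> y = (\<lambda>w. if w = y then 1 else (0::real))" for y :: 'a
  define \<kappa> where "\<kappa> = (b 0 - theta1) * (b 0 - theta2)"
  \<comment> \<open>\<open>\<kappa>\<close> is the eigenvalue of \<open>F\<close> on constants;
    subtracting \<open>\<kappa> / m\<close> makes each row annihilate every g for which F g is
    constant, by self-adjointness.\<close>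
  define f where "f u y = F (\<delta> y) u - \<kappa> / m" for u y
  have F_f: "(\<Sum>y\<in>UNIV. f u y * g y) = F g u - \<kappa> / m * (\<Sum>y\<in>UNIV. g y)" for u g
  proof -
    have g: "g = (\<lambda>w. \<Sum>y\<in>UNIV. g y * \<delta> y w)"
      by (rule ext) (simp add: \<delta>_def if_distrib[of "\<lambda>u. _ * u"] cong: if_cong)
    have "F g u = F (\<lambda>w. \<Sum>y\<in>UNIV. g y * \<delta> y w) u" using g by simp
    also have "\<dots> = (\<Sum>y\<in>UNIV. g y * F (\<delta> y) u)" by (simp add: F_sum F_scale)
    finally show ?thesis by (simp add: f_def algebra_simps sum_subtractf sum_distrib_left sum_divide_distrib)
  qed
  have const: "(\<Sum>y\<in>UNIV. f u y * g y) = 0" if "\<And>u. F g u = s" for g s u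
  proof -
    have "(\<Sum>y\<in>UNIV. F g y * 1) = (\<Sum>y\<in>UNIV. g y * F (\<lambda>_. 1) y)" by (rule F_self_adjoint)
    then have "m * s = \<kappa> * (\<Sum>y\<in>UNIV. g y)"
      using that by (simp add: F_const m_def \<kappa>_def sum_distrib_right[symmetric] mult.commute)
    then show ?thesis using m unfolding F_f that by (simp add: field_simps)
  qed
  obtain s1 where s1: "\<And>z y. F (K z) y = s1" using F_K by blast
  obtain s2 where s2: "\<And>z y. F (\<lambda>w. K z w ^ 2) y = s2" using F_K2 by blast
  obtain s t where st: "\<And>y z. (\<Sum>w\<in>UNIV. K y w * K z w) = s * K z y + t" using K_K by blast
  define T where "T u x z = (\<Sum>y\<in>UNIV. f u y * (K x y * K z y))" for u x z
  have "(\<Sum>x\<in>UNIV. \<Sum>z\<in>UNIV. T u x z ^ 2) = 0" for u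
  proof -
    have "(\<Sum>x\<in>UNIV. \<Sum>z\<in>UNIV. T u x z ^ 2) =
       (\<Sum>x\<in>UNIV. \<Sum>z\<in>UNIV. \<Sum>y\<in>UNIV. \<Sum>y'\<in>UNIV. f u y * f u y' * ((K x y * K x y') * (K z y * K z y')))"
      unfolding T_def power2_eq_square sum_product by (simp add: mult_ac)
    also have "\<dots> = (\<Sum>x\<in>UNIV. \<Sum>y\<in>UNIV. \<Sum>z\<in>UNIV. \<Sum>y'\<in>UNIV. f u y * f u y' * ((K x y * K x y') * (K z y * K z y')))"
      by (rule sum.cong[OF refl]) (rule sum.swap)
    also have "\<dots> = (\<Sum>y\<in>UNIV. \<Sum>x\<in>UNIV. \<Sum>z\<in>UNIV. \<Sum>y'\<in>UNIV. f u y * f u y' * ((K x y * K x y') * (K z y * K z y')))"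
      by (rule sum.swap)
    also have "\<dots> = (\<Sum>y\<in>UNIV. \<Sum>x\<in>UNIV. \<Sum>y'\<in>UNIV. \<Sum>z\<in>UNIV. f u y * f u y' * ((K x y * K x y') * (K z y * K z y')))"
      by (rule sum.cong[OF refl], rule sum.cong[OF refl]) (rule sum.swap)
    also have "\<dots> = (\<Sum>y\<in>UNIV. \<Sum>y'\<in>UNIV. \<Sum>x\<in>UNIV. \<Sum>z\<in>UNIV. f u y * f u y' * ((K x y * K x y') * (K z y * K z y')))"
      by (rule sum.cong[OF refl]) (rule sum.swap)
    also have "\<dots> = (\<Sum>y\<in>UNIV. \<Sum>y'\<in>UNIV. f u y * f u y' * ((\<Sum>x\<in>UNIV. K x y * K x y') * (\<Sum>z\<in>UNIV. K z y * K z y')))"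
      unfolding sum_product by (simp add: sum_distrib_left)
    also have "\<dots> = (\<Sum>y\<in>UNIV. \<Sum>y'\<in>UNIV. f u y * f u y' * (s * K y y' + t)^2)"
    proof -
      have "(\<Sum>x\<in>UNIV. K x y * K x y') = s * K y y' + t" for y y'
      proof -
        have "(\<Sum>x\<in>UNIV. K x y * K x y') = (\<Sum>x\<in>UNIV. K y' x * K y x)"
          by (rule sum.cong[OF refl]) (metis K_sym mult.commute)
        then show ?thesis by (simp only: st)
      qed
      then show ?thesis by (simp add: power2_eq_square)
    qed
    also have "\<dots> = (\<Sum>y\<in>UNIV. f u y * (s^2 * (\<Sum>y'\<in>UNIV. f u y' * K y y' ^ 2) + 2 * s * t * (\<Sum>y'\<in>UNIV. f u y' * K y y') + t^2 * (\<Sum>y'\<in>UNIV. f u y' * 1)))"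
      by (simp add: power2_eq_square algebra_simps sum.distrib sum_distrib_left)
    also have "\<dots> = 0"
    proof -
      have "(\<Sum>y\<in>UNIV. f u y * 1) = 0" by (rule const) (rule F_const)
      then show ?thesis by (simp add: const[OF s1] const[OF s2])
    qed
    finally show ?thesis .
  qed
  then have "(\<Sum>z\<in>UNIV. T u x z ^ 2) = 0" for u x
    by (subst (asm) sum_nonneg_eq_0_iff) (auto intro: sum_nonneg)
  then have T0: "T u x z = 0" for u x z
    by (subst (asm) sum_nonneg_eq_0_iff) auto
  have "F (\<lambda>y. K x y * K z y) u = \<kappa> / m * (\<Sum>y\<in>UNIV. K x y * K z y)" for u
    using T0[of u x z] F_f[of u "\<lambda>y. K x y * K z y"] by (simp add: T_def)
  then show ?thesis by blast
qed

end

section \<open>Thin modules of endpoint one\<close>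

locale pointed_drg = classical_drg G D qi for G :: "('a::finite) graph" and D qi +
  fixes x :: 'a
begin

section \<open>Raising, lowering and flat parts of A with respect to x\<close>

definition raise where "raise f y = (\<Sum>w | G y w \<and> d x y = Suc (d x w). f w)" for f :: "'a \<Rightarrow> real"
definition lower where "lower f y = (\<Sum>w | G y w \<and> d x w = Suc (d x y). f w)" for f :: "'a \<Rightarrow> real"
definition flat where "flat f y = (\<Sum>w | G y w \<and> d x w = d x y. f w)" for f :: "'a \<Rightarrow> real"
definition ip where "ip f g = (\<Sum>y\<in>UNIV. f y * g y)" for f g :: "'a \<Rightarrow> real"
definition lev where "lev i f \<longleftrightarrow> (\<forall>y. f y \<noteq> 0 \<longrightarrow> d x y = i)" for f :: "'a \<Rightarrow> real"

lemma adj_op_split: "adj_op f y = raise f y + flat f y + lower f y"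
proof -
  have eq: "{w. G y w} = {w. G y w \<and> d x y = Suc (d x w)} \<union> ({w. G y w \<and> d x w = d x y} \<union> {w. G y w \<and> d x w = Suc (d x y)})"
    using G_dist[of y _ x] d_sym[of x] by force
  have "adj_op f y = raise f y + (flat f y + lower f y)" unfolding adj_op_def raise_def lower_def flat_def
    by (subst eq, subst sum.union_disjoint, (auto)[3], subst sum.union_disjoint) auto
  then show ?thesis by simp
qed

lemma op_scale:
  "raise (\<lambda>y. s * f y) y = s * raise f y"
  "lower (\<lambda>y. s * f y) y = s * lower f y"
  "flat (\<lambda>y. s * f y) y = s * flat f y"
  by (simp_all add: raise_def lower_def flat_def sum_distrib_left)

lemma op_cond: "(\<Sum>y\<in>UNIV. (\<Sum>w | G y w \<and> Q (d x y) (d x w). f w) * g y) = (\<Sum>w\<in>UNIV. f w * (\<Sum>y | G w y \<and> Q (d x y) (d x w). g y))"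
  for f g :: "'a \<Rightarrow> real"
proof -
  have "(\<Sum>y\<in>UNIV. (\<Sum>w | G y w \<and> Q (d x y) (d x w). f w) * g y) = (\<Sum>y\<in>UNIV. \<Sum>w | G y w. if Q (d x y) (d x w) then f w * g y else 0)"
  proof (rule sum.cong[OF refl])
    fix y
    have "{w. G y w \<and> Q (d x y) (d x w)} = {w. G y w} \<inter> {w. Q (d x y) (d x w)}" by auto
    then show "(\<Sum>w | G y w \<and> Q (d x y) (d x w). f w) * g y = (\<Sum>w | G y w. if Q (d x y) (d x w) then f w * g y else 0)"
      by (simp add: sum.If_cases sum_distrib_right)
  qed
  also have "\<dots> = (\<Sum>w\<in>UNIV. \<Sum>y | G w y. if Q (d x y) (d x w) then f w * g y else 0)"
    by (rule sum_G_swap)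
  also have "\<dots> = (\<Sum>w\<in>UNIV. f w * (\<Sum>y | G w y \<and> Q (d x y) (d x w). g y))"
  proof (rule sum.cong[OF refl])
    fix w
    have "{y. G w y \<and> Q (d x y) (d x w)} = {y. G w y} \<inter> {y. Q (d x y) (d x w)}" by auto
    then show "(\<Sum>y | G w y. if Q (d x y) (d x w) then f w * g y else 0) = f w * (\<Sum>y | G w y \<and> Q (d x y) (d x w). g y)"
      by (simp add: sum.If_cases sum_distrib_left)
  qed
  finally show ?thesis .
qed

lemma ip_raise: "ip (raise f) g = ip f (lower g)"
  unfolding ip_def raise_def lower_def using op_cond[where Q = "\<lambda>i j. i = Suc j" and f = f and g = g] by simp

lemma ip_flat: "ip (flat f) g = ip f (flat g)"
  unfolding ip_def flat_def using op_cond[where Q = "\<lambda>i j. j = i" and f = f and g = g] by (simp add: eq_commute)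

lemma ip_sym: "ip f g = ip g f" by (simp add: ip_def mult.commute)
lemma ip_add: "ip f (\<lambda>y. g y + h y) = ip f g + ip f h" by (simp add: ip_def algebra_simps sum.distrib)
lemma ip_scale: "ip f (\<lambda>y. s * g y) = s * ip f g" by (simp add: ip_def algebra_simps sum_distrib_left)
lemma ip_adj: "ip (adj_op f) g = ip f (adj_op g)" by (simp add: ip_def adj_op_self_adjoint)
lemma ip_pos: assumes "f y \<noteq> 0" shows "ip f f > 0"
  unfolding ip_def by (rule sum_pos2[of _ y]) (use assms in \<open>auto simp: zero_less_mult_iff\<close>)

lemma lev_raise: "lev i f \<Longrightarrow> lev (Suc i) (raise f)"
  unfolding lev_def raise_def by (auto elim!: sum.not_neutral_contains_not_neutral)
lemma lev_lower: "lev (Suc i) f \<Longrightarrow> lev i (lower f)"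
  unfolding lev_def lower_def by (auto elim!: sum.not_neutral_contains_not_neutral)
lemma lev_flat: "lev i f \<Longrightarrow> lev i (flat f)"
  unfolding lev_def flat_def by (auto elim!: sum.not_neutral_contains_not_neutral)

text \<open>What remains of a thin irreducible module of endpoint 1: f lies in its first component,
  the iterates of \<open>raise\<close> give the further ones, and one-dimensionality turns
  \<open>flat\<close> and \<open>lower\<close> into scalars on them. Real functions suffice, since
  those scalars are real.\<close>

definition thin_vector where
  "thin_vector f \<longleftrightarrow> lev 1 f \<and> (\<exists>y. f y \<noteq> 0) \<and> lower f = (\<lambda>_. 0) \<and>
     (\<forall>j. \<exists>s. flat ((raise ^^ j) f) = (\<lambda>y. s * (raise ^^ j) f y)) \<and>
     (\<forall>j. \<exists>s. lower ((raise ^^ Suc j) f) = (\<lambda>y. s * (raise ^^ j) f y))"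

lemma thin_lev: "thin_vector f \<Longrightarrow> lev (Suc j) ((raise ^^ j) f)"
  by (induction j) (auto simp: thin_vector_def intro: lev_raise)

lemma lev1_dist: "lev 1 f \<Longrightarrow> f z \<noteq> 0 \<Longrightarrow> d x y = 1 \<Longrightarrow> d y z \<le> 2"
  using d_tri[of y z x] d_sym[of x y] by (simp add: lev_def)

lemma sum_lev1: "lev 1 f \<Longrightarrow> lower f x = (\<Sum>z\<in>UNIV. f z)"
  unfolding lower_def lev_def by (rule sum.mono_neutral_left) (auto simp: G_iff)

text \<open>Two neighbours of x have distance at most 2, so on them the kernel is \<phi> 0 I +
  \<phi> 1 B + \<phi> 2 (J - I - B) with B the local adjacency matrix; J annihilates f.\<close>

lemma local_kernel:
  assumes f: "lev 1 f" and s: "(\<Sum>z\<in>UNIV. f z) = 0" and e: "flat f y = \<eta> * f y" and y: "d x y = 1"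
  shows "(\<Sum>z\<in>UNIV. \<phi> (d y z) * f z) = (\<phi> 0 + \<eta> * \<phi> 1 - (1 + \<eta>) * \<phi> 2) * f y"
proof -
  have "(\<Sum>z\<in>UNIV. \<phi> (d y z) * f z) = (\<Sum>z\<in>UNIV. (\<phi> 0 - \<phi> 2) * (if z = y then f z else 0) + (\<phi> 1 - \<phi> 2) * (if G y z then f z else 0) + \<phi> 2 * f z)"
  proof (rule sum.cong[OF refl])
    fix z
    show "\<phi> (d y z) * f z = (\<phi> 0 - \<phi> 2) * (if z = y then f z else 0) + (\<phi> 1 - \<phi> 2) * (if G y z then f z else 0) + \<phi> 2 * f z"
    proof (cases "f z = 0")
      case False
      then have "d y z = 0 \<or> d y z = 1 \<or> d y z = 2" using lev1_dist[OF f False y] by linarith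
      then show ?thesis using G_iff[of y z] G_irrefl by (auto simp: algebra_simps)
    qed auto
  qed
  also have "\<dots> = (\<phi> 0 - \<phi> 2) * f y + (\<phi> 1 - \<phi> 2) * (\<Sum>z\<in>UNIV. if G y z then f z else 0) + \<phi> 2 * (\<Sum>z\<in>UNIV. f z)"
    by (simp add: sum.distrib sum_distrib_left[symmetric])
  also have "(\<Sum>z\<in>UNIV. if G y z then f z else 0) = flat f y"
  proof -
    have "(\<Sum>z\<in>UNIV. if G y z then f z else 0) = (\<Sum>z | G y z. f z)" by (simp add: sum.If_cases)
    also have "\<dots> = flat f y" unfolding flat_def
      by (rule sum.mono_neutral_right) (use f y in \<open>auto simp: lev_def\<close>)
    finally show ?thesis .
  qed
  finally show ?thesis using e s by (simp add: algebra_simps)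
qed

lemma kernel_mult: "\<exists>\<psi>. \<forall>y z. (\<Sum>w\<in>UNIV. \<phi> (d y w) * \<phi>' (d w z)) = \<psi> (d y z)" for \<phi> \<phi>' :: "nat \<Rightarrow> real"
proof -
  have "(\<Sum>w\<in>UNIV. \<phi> (d y w) * \<phi>' (d w z)) = (\<Sum>i\<le>D. \<Sum>j\<le>D. \<phi> i * \<phi>' j * real (intersection_number G (d y z) i j))" for y z
  proof -
    have "(\<Sum>w\<in>UNIV. \<phi> (d y w) * \<phi>' (d w z)) = (\<Sum>w\<in>UNIV. \<Sum>i\<le>D. \<Sum>j\<le>D. if d y w = i \<and> d z w = j then \<phi> i * \<phi>' j else 0)"
    proof (rule sum.cong[OF refl])
      fix w
      have "(\<Sum>i\<le>D. \<Sum>j\<le>D. if d y w = i \<and> d z w = j then \<phi> i * \<phi>' j else 0) = (\<Sum>i\<le>D. if d y w = i then \<phi> i * \<phi>' (d z w) else 0)"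
        using d_le by (intro sum.cong refl) (simp add: sum.delta)
      also have "\<dots> = \<phi> (d y w) * \<phi>' (d z w)" using d_le by (simp add: sum.delta)
      finally show "\<phi> (d y w) * \<phi>' (d w z) = (\<Sum>i\<le>D. \<Sum>j\<le>D. if d y w = i \<and> d z w = j then \<phi> i * \<phi>' j else 0)"
        by (simp add: d_sym)
    qed
    also have "\<dots> = (\<Sum>i\<le>D. \<Sum>w\<in>UNIV. \<Sum>j\<le>D. if d y w = i \<and> d z w = j then \<phi> i * \<phi>' j else 0)"
      by (rule sum.swap)
    also have "\<dots> = (\<Sum>i\<le>D. \<Sum>j\<le>D. \<Sum>w\<in>UNIV. if d y w = i \<and> d z w = j then \<phi> i * \<phi>' j else 0)"
      by (rule sum.cong[OF refl]) (rule sum.swap)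
    also have "\<dots> = (\<Sum>i\<le>D. \<Sum>j\<le>D. \<phi> i * \<phi>' j * real (intersection_number G (d y z) i j))"
      by (intro sum.cong refl) (simp add: sum.If_cases intersection)
    finally show ?thesis .
  qed
  then show ?thesis by (intro exI[of _ "\<lambda>h. \<Sum>i\<le>D. \<Sum>j\<le>D. \<phi> i * \<phi>' j * real (intersection_number G h i j)"]) simp
qed

text \<open>The iterate is a polynomial of degree m in A applied to f, as \<open>raise\<close> is A
  minus its flat and lowering parts, which give multiples of earlier iterates. Each step multiplies
  the leading coefficient by \<open>c m\<close>, which is not 0.\<close>

lemma thin_kernel:
  assumes f: "thin_vector f" and m: "m < D"
  shows "\<exists>\<phi>. \<phi> m \<noteq> 0 \<and> (\<forall>i>m. \<phi> i = 0) \<and> (\<forall>y. (raise ^^ m) f y = (\<Sum>z\<in>UNIV. \<phi> (d y z) * f z))"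
  using m
proof (induction m rule: less_induct)
  case (less m)
  show ?case
  proof (cases m)
    case 0
    show ?thesis
    proof (intro exI[of _ "\<lambda>i. if i = 0 then 1 else 0"] conjI allI impI)
      fix y show "(raise ^^ m) f y = (\<Sum>z\<in>UNIV. (if d y z = 0 then 1 else 0) * f z)"
        by (simp add: 0 if_distrib[of "\<lambda>u. u * _"] cong: if_cong)
    qed (auto simp: 0)
  next
    case (Suc l)
    obtain \<phi> where \<phi>: "\<phi> l \<noteq> 0" "\<And>i. i > l \<Longrightarrow> \<phi> i = 0" "\<And>y. (raise ^^ l) f y = (\<Sum>z\<in>UNIV. \<phi> (d y z) * f z)"
      using less.IH[of l] less.prems Suc by auto
    obtain s where s: "flat ((raise ^^ l) f) = (\<lambda>y. s * (raise ^^ l) f y)" using f unfolding thin_vector_def by blast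
    obtain \<psi> where \<psi>: "\<And>i. i \<ge> l \<Longrightarrow> \<psi> i = 0" "\<And>y. lower ((raise ^^ l) f) y = (\<Sum>z\<in>UNIV. \<psi> (d y z) * f z)"
    proof (cases l)
      case 0
      then show ?thesis using f that[of "\<lambda>_. 0"] by (simp add: thin_vector_def)
    next
      case (Suc k)
      obtain t where t: "lower ((raise ^^ l) f) = (\<lambda>y. t * (raise ^^ k) f y)" using f Suc unfolding thin_vector_def by blast
      obtain \<phi>' where \<phi>': "\<And>i. i > k \<Longrightarrow> \<phi>' i = 0" "\<And>y. (raise ^^ k) f y = (\<Sum>z\<in>UNIV. \<phi>' (d y z) * f z)"
        using less.IH[of k] less.prems Suc \<open>m = Suc l\<close> by auto
      show ?thesis
        by (rule that[of "\<lambda>i. t * \<phi>' i"]) (use \<phi>' t Suc in \<open>auto simp: sum_distrib_left mult.assoc\<close>)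
    qed
    define \<xi> where "\<xi> i = transfer \<phi> i - s * \<phi> i - \<psi> i" for i
    show ?thesis
    proof (intro exI[of _ \<xi>] conjI allI impI)
      have "\<xi> m = c m * \<phi> l" using \<phi>(2) \<psi>(1) Suc by (simp add: \<xi>_def transfer_def)
      moreover have "c m > 0" using less.prems Suc by (intro c_pos) auto
      ultimately show "\<xi> m \<noteq> 0" using \<phi>(1) by simp
    next
      fix i assume "i > m"
      then show "\<xi> i = 0" using \<phi>(2) \<psi>(1) Suc by (simp add: \<xi>_def transfer_def)
    next
      fix y
      have "(raise ^^ m) f y = raise ((raise ^^ l) f) y" by (simp add: Suc)
      also have "\<dots> = adj_op ((raise ^^ l) f) y - s * (raise ^^ l) f y - lower ((raise ^^ l) f) y"
        using adj_op_split[of "(raise ^^ l) f" y] s by simp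
      also have "adj_op ((raise ^^ l) f) y = (\<Sum>z\<in>UNIV. transfer \<phi> (d y z) * f z)"
      proof -
        have "(raise ^^ l) f = (\<lambda>y. \<Sum>z\<in>UNIV. f z * \<phi> (d y z))" using \<phi>(3) by (auto simp: mult.commute)
        then show ?thesis by (simp add: adj_op_sum adj_op_scale adj_op_dist mult.commute)
      qed
      finally show "(raise ^^ m) f y = (\<Sum>z\<in>UNIV. \<xi> (d y z) * f z)"
        unfolding \<psi>(2) unfolding \<phi>(3) \<xi>_def by (simp add: left_diff_distrib sum_subtractf sum_distrib_left mult.assoc)
    qed
  qed
qed

text \<open>Otherwise a distance kernel of degree m kills f. Composing it with the distance-(m+h)
  matrix yields a kernel that kills f, vanishes below distance h by the triangle inequality, and is
  nonzero at h. By \<open>local_kernel\<close>, h = 2 gives \<eta> = -1 and then h = 1 is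
  impossible.\<close>

lemma thin_raise_nonzero:
  assumes f: "thin_vector f" and m: "m + 2 \<le> D"
  shows "\<exists>y. (raise ^^ m) f y \<noteq> 0"
proof (rule ccontr)
  assume "\<nexists>y. (raise ^^ m) f y \<noteq> 0"
  then obtain \<phi> where \<phi>: "\<phi> m \<noteq> 0" "\<And>i. i > m \<Longrightarrow> \<phi> i = 0" "\<And>y. (\<Sum>z\<in>UNIV. \<phi> (d y z) * f z) = 0"
    using thin_kernel[OF f, of m] m by auto
  have f1: "lev 1 f" and s: "(\<Sum>z\<in>UNIV. f z) = 0" using f sum_lev1[of f] by (auto simp: thin_vector_def)
  obtain \<eta> where e: "\<And>y. flat f y = \<eta> * f y" using f unfolding thin_vector_def by (metis funpow_0)
  obtain y0 where y0: "f y0 \<noteq> 0" using f by (auto simp: thin_vector_def)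
  then have y01: "d x y0 = 1" using f1 by (simp add: lev_def)
  have key: "\<exists>\<psi>. \<psi> 0 + \<eta> * \<psi> 1 - (1 + \<eta>) * \<psi> 2 = 0 \<and> \<psi> h \<noteq> 0 \<and> (\<forall>i<h. \<psi> i = 0)" if h: "h \<le> 2" for h :: nat
  proof -
    define k where "k = m + h"
    have k: "k \<le> D" using m h by (simp add: k_def)
    obtain \<psi> where \<psi>: "\<And>y z. (\<Sum>w\<in>UNIV. (if d y w = k then 1 else 0) * \<phi> (d w z)) = \<psi> (d y z)"
      using kernel_mult[of "\<lambda>i. if i = k then 1 else 0" \<phi>] by auto
    have "(\<psi> 0 + \<eta> * \<psi> 1 - (1 + \<eta>) * \<psi> 2) * f y0 = (\<Sum>z\<in>UNIV. \<psi> (d y0 z) * f z)"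
      by (rule local_kernel[OF f1 s e y01, symmetric])
    also have "\<dots> = (\<Sum>z\<in>UNIV. \<Sum>w\<in>UNIV. (if d y0 w = k then 1 else 0) * (\<phi> (d w z) * f z))"
      unfolding \<psi>[symmetric] by (simp add: sum_distrib_right mult.assoc)
    also have "\<dots> = (\<Sum>w\<in>UNIV. (if d y0 w = k then 1 else 0) * (\<Sum>z\<in>UNIV. \<phi> (d w z) * f z))"
      by (subst sum.swap) (simp add: sum_distrib_left)
    finally have 1: "\<psi> 0 + \<eta> * \<psi> 1 - (1 + \<eta>) * \<psi> 2 = 0" using \<phi>(3) y0 by simp
    have ge: "m + h \<le> i + d w z" if "d y z = i" "d y w = k" for y z w i
      using d_tri[of y w z] that by (simp add: k_def d_sym)
    have 2: "\<psi> i = 0" if i: "i < h" for i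
    proof -
      have "i \<le> D" using i h D4 by simp
      then obtain y z where yz: "d y z = i" using d_attained by blast
      have "\<psi> (d y z) = 0" unfolding \<psi>[symmetric]
        by (rule sum.neutral) (use ge[OF yz] i \<phi>(2) in fastforce)
      then show ?thesis using yz by simp
    qed
    have 3: "\<psi> h \<noteq> 0"
    proof -
      obtain y w0 where "d y w0 = h + m" using d_attained[of "h + m"] k by (auto simp: k_def add.commute)
      then obtain z where z: "d y z = h" "d z w0 = m" "d y w0 = k" using d_split[of y w0 h m] by (auto simp: k_def)
      have "\<psi> (d y z) = (\<Sum>w\<in>UNIV. (if d y w = k \<and> d w z = m then 1 else 0) * \<phi> m)" unfolding \<psi>[symmetric]
      proof (rule sum.cong[OF refl])
        fix w
        show "(if d y w = k then 1 else 0) * \<phi> (d w z) = (if d y w = k \<and> d w z = m then 1 else 0) * \<phi> m"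
          using ge[OF z(1), of w] \<phi>(2)[of "d w z"] by (cases "d w z = m") auto
      qed
      also have "\<dots> = real (card {w. d y w = k \<and> d w z = m}) * \<phi> m"
        by (simp add: sum_distrib_right[symmetric] sum.If_cases)
      finally have "\<psi> h = real (card {w. d y w = k \<and> d w z = m}) * \<phi> m" using z by simp
      moreover have "w0 \<in> {w. d y w = k \<and> d w z = m}" using z d_sym by simp
      then have "card {w. d y w = k \<and> d w z = m} \<noteq> 0" by auto
      ultimately show ?thesis using \<phi>(1) by simp
    qed
    show ?thesis using 1 2 3 by blast
  qed
  obtain \<psi> :: "nat \<Rightarrow> real" where "\<psi> 0 + \<eta> * \<psi> 1 - (1 + \<eta>) * \<psi> 2 = 0" "\<psi> 2 \<noteq> 0" "\<forall>i<2. \<psi> i = 0" using key[of 2] by auto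
  then have eta: "\<eta> = -1" by simp
  obtain \<psi>' :: "nat \<Rightarrow> real" where "\<psi>' 0 + \<eta> * \<psi>' 1 - (1 + \<eta>) * \<psi>' 2 = 0" "\<psi>' 1 \<noteq> 0" "\<forall>i<1. \<psi>' i = 0" using key[of 1] by auto
  then show False using eta by simp
qed

text \<open>With -1, \<open>E\<close> and \<open>E'\<close> are the roots of the cubic in
  \<open>Krein_cubic\<close>.\<close>

definition E where "E = n * (N - 1) - 1"
definition E' where "E' = n * (q * N - 1)"

text \<open>The left side is \<xi> times the expression in \<open>Krein_relation\<close>, with
  \<open>y\<close> for \<xi> (\<open>second_moment\<close>) and with \<alpha> \<xi> replaced by
  \<open>third_moment\<close>; the factor \<xi> avoids dividing by it. The coefficients of h^2, h
  and 1 are compared separately as \<open>2\<close>, \<open>1\<close>, \<open>0\<close>.\<close>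

lemma Krein_cubic:
  fixes h :: real
  defines "y \<equiv> b 0 - c 2 + (a 1 - c 2) * h - h\<^sup>2"
  shows "n * ((h - theta1) * (h - theta2) + y) * y + ((h - theta1 - theta2) * y +
      (b 0 * a 1 + h * (b 0 + a 1 ^ 2 + b 1 * c 2) - (1 + h) * (c 2 * a 1 + a 2 * c 2) - h^3 - 2 * h * y)) * (theta1 - h)
     = q * (theta1 + theta2 - a 1 + c 2) * ((h + 1) * (h - E) * (h - E'))"
proof -
  define e where "e = a 1 - c 2"
  define k where "k = b 0 - c 2"
  define s where "s = theta1 + theta2"
  define l0 where "l0 = b 0 * a 1 - (c 2 * a 1 + a 2 * c 2)"
  define l1 where "l1 = b 0 + a 1 ^ 2 + b 1 * c 2 - (c 2 * a 1 + a 2 * c 2)"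
  note defs = e_def k_def s_def l0_def l1_def b0 a1 c2 b1 a2 theta1_def theta2_def E_def E'_def n_def
  have 2: "n * ((e - s) * e - (k + theta1 * theta2)) + (s - e) * theta1 - (l1 - k - s * e) = q * (s - e) * (1 - E - E')"
    unfolding defs using q_ge by (simp add: divide_simps) (simp add: algebra_simps power2_eq_square)
  have 1: "n * ((e - s) * k + (k + theta1 * theta2) * e) + (l1 - k - s * e) * theta1 - (l0 - s * k) = q * (s - e) * (E * E' - E - E')"
    unfolding defs using q_ge by (simp add: divide_simps) (simp add: algebra_simps power2_eq_square)
  have 0: "n * (k + theta1 * theta2) * k + (l0 - s * k) * theta1 = q * (s - e) * (E * E')"
    unfolding defs using q_ge by (simp add: divide_simps) (simp add: algebra_simps power2_eq_square)
  have y: "y = k + e * h - h^2" by (simp add: y_def k_def e_def)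
  have "n * ((h - theta1) * (h - theta2) + y) * y + ((h - theta1 - theta2) * y +
      (b 0 * a 1 + h * (b 0 + a 1 ^ 2 + b 1 * c 2) - (1 + h) * (c 2 * a 1 + a 2 * c 2) - h^3 - 2 * h * y)) * (theta1 - h)
    = n * ((e - s) * h + (k + theta1 * theta2)) * (k + e * h - h^2) + ((s - e) * h^2 + (l1 - k - s * e) * h + (l0 - s * k)) * (theta1 - h)"
    unfolding y s_def l0_def l1_def by (simp add: algebra_simps power2_eq_square power3_eq_cube)
  also have "\<dots> = (n - 1) * (s - e) * h^3
      + (n * ((e - s) * e - (k + theta1 * theta2)) + (s - e) * theta1 - (l1 - k - s * e)) * h^2
      + (n * ((e - s) * k + (k + theta1 * theta2) * e) + (l1 - k - s * e) * theta1 - (l0 - s * k)) * h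
      + (n * (k + theta1 * theta2) * k + (l0 - s * k) * theta1)"
    by (simp add: algebra_simps power2_eq_square power3_eq_cube)
  also have "\<dots> = q * (s - e) * ((h + 1) * (h - E) * (h - E'))"
    unfolding 0 1 2 by (simp add: n_def algebra_simps power2_eq_square power3_eq_cube)
  also have "s - e = theta1 + theta2 - a 1 + c 2" by (simp add: s_def e_def)
  finally show ?thesis .
qed

context
  fixes f :: "'a \<Rightarrow> real" and \<eta> \<xi> \<alpha> :: real
  assumes f: "thin_vector f"
    and eta: "flat f = (\<lambda>y. \<eta> * f y)"
    and xi: "lower (raise f) = (\<lambda>y. \<xi> * f y)"
    and alpha: "flat (raise f) = (\<lambda>y. \<alpha> * raise f y)"
begin

section \<open>The first moments of a local eigenvector and the Krein equation\<close>

lemma f_lev: "lev 1 f" using f by (simp add: thin_vector_def)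
lemma f_lower: "lower f = (\<lambda>_. 0)" using f by (simp add: thin_vector_def)
lemma f_sum: "(\<Sum>z\<in>UNIV. f z) = 0" using sum_lev1[OF f_lev] f_lower by simp

lemma A_f: "adj_op f = (\<lambda>y. \<eta> * f y + raise f y)"
  by (rule ext) (simp add: adj_op_split eta f_lower)
lemma A_raise: "adj_op (raise f) = (\<lambda>y. \<xi> * f y + \<alpha> * raise f y + raise (raise f) y)"
  by (rule ext) (simp add: adj_op_split xi alpha)
lemma A_A_f: "adj_op (adj_op f) = (\<lambda>y. (\<eta>\<^sup>2 + \<xi>) * f y + (\<eta> + \<alpha>) * raise f y + raise (raise f) y)"
proof (rule ext)
  fix y
  have "adj_op (adj_op f) y = \<eta> * adj_op f y + adj_op (raise f) y"
    by (subst A_f) (simp only: adj_op_add adj_op_scale)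
  then show "adj_op (adj_op f) y = (\<eta>\<^sup>2 + \<xi>) * f y + (\<eta> + \<alpha>) * raise f y + raise (raise f) y"
    by (simp add: A_f A_raise algebra_simps power2_eq_square)
qed

lemma lev_zero: "lev i g \<Longrightarrow> d x y \<noteq> i \<Longrightarrow> g y = 0" by (auto simp: lev_def)

lemma adj_f_kernel: "adj_op f y = (\<Sum>z\<in>UNIV. (if d y z = 1 then 1 else 0) * f z)"
proof -
  have "(\<Sum>z\<in>UNIV. (if d y z = 1 then 1 else 0) * f z) = (\<Sum>z\<in>UNIV. if G y z then f z else 0)"
    by (rule sum.cong[OF refl]) (simp add: G_iff)
  also have "\<dots> = adj_op f y" by (simp add: adj_op_def sum.If_cases)
  finally show ?thesis by (rule sym)
qed

lemma adj_kernel: "adj_op (\<lambda>y. \<Sum>z\<in>UNIV. \<phi> (d y z) * f z) y = (\<Sum>z\<in>UNIV. transfer \<phi> (d y z) * f z)"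
proof -
  have "adj_op (\<lambda>y. \<Sum>z\<in>UNIV. \<phi> (d y z) * f z) y = adj_op (\<lambda>y. \<Sum>z\<in>UNIV. f z * \<phi> (d y z)) y"
    by (simp add: mult.commute)
  then show ?thesis by (simp add: adj_op_sum adj_op_scale adj_op_dist mult.commute)
qed

text \<open>Evaluate A^2 f at a neighbour of x twice: by the module action, and as a distance kernel
  through \<open>local_kernel\<close>.\<close>

lemma second_moment: "\<xi> = b 0 - c 2 + (a 1 - c 2) * \<eta> - \<eta>\<^sup>2"
proof -
  obtain y where y: "f y \<noteq> 0" using f by (auto simp: thin_vector_def)
  then have y1: "d x y = 1" using f_lev by (simp add: lev_def)
  define \<phi> where "\<phi> = (\<lambda>i::nat. if i = 1 then 1 else (0::real))"
  have "adj_op f = (\<lambda>y. \<Sum>z\<in>UNIV. \<phi> (d y z) * f z)" by (rule ext) (simp add: adj_f_kernel \<phi>_def)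
  then have "adj_op (adj_op f) y = (\<Sum>z\<in>UNIV. transfer \<phi> (d y z) * f z)" by (simp add: adj_kernel)
  also have "\<dots> = (transfer \<phi> 0 + \<eta> * transfer \<phi> 1 - (1 + \<eta>) * transfer \<phi> 2) * f y"
    by (rule local_kernel[OF f_lev f_sum _ y1]) (simp add: eta)
  also have "\<dots> = (b 0 + \<eta> * a 1 - (1 + \<eta>) * c 2) * f y" by (simp add: transfer_def \<phi>_def)
  finally have "adj_op (adj_op f) y = (b 0 + \<eta> * a 1 - (1 + \<eta>) * c 2) * f y" .
  moreover have "raise f y = 0" "raise (raise f) y = 0"
    using lev_zero[OF lev_raise[OF f_lev]] lev_zero[OF lev_raise[OF lev_raise[OF f_lev]]] y1 by auto
  ultimately have "(\<eta>\<^sup>2 + \<xi>) * f y = (b 0 + \<eta> * a 1 - (1 + \<eta>) * c 2) * f y" by (simp add: A_A_f)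
  then have "\<eta>\<^sup>2 + \<xi> = b 0 + \<eta> * a 1 - (1 + \<eta>) * c 2" by (simp only: mult_right_cancel[OF y])
  then show ?thesis by (simp add: algebra_simps)
qed

text \<open>The same comparison for A^3 f; here the flat scalar \<alpha> of the second component
  enters, multiplied by \<xi>.\<close>

lemma third_moment:
  "\<alpha> * \<xi> = b 0 * a 1 + \<eta> * (b 0 + a 1 ^ 2 + b 1 * c 2) - (1 + \<eta>) * (c 2 * a 1 + a 2 * c 2) - \<eta>^3 - 2 * \<eta> * \<xi>"
proof -
  obtain y where y: "f y \<noteq> 0" using f by (auto simp: thin_vector_def)
  then have y1: "d x y = 1" using f_lev by (simp add: lev_def)
  define \<phi> where "\<phi> = (\<lambda>i::nat. if i = 1 then 1 else (0::real))"
  have "adj_op f = (\<lambda>y. \<Sum>z\<in>UNIV. \<phi> (d y z) * f z)" by (rule ext) (simp add: adj_f_kernel \<phi>_def)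
  then have "adj_op (adj_op f) = (\<lambda>y. \<Sum>z\<in>UNIV. transfer \<phi> (d y z) * f z)" by (auto simp: adj_kernel)
  then have "adj_op (adj_op (adj_op f)) y = (\<Sum>z\<in>UNIV. transfer (transfer \<phi>) (d y z) * f z)" by (simp add: adj_kernel)
  also have "\<dots> = (transfer (transfer \<phi>) 0 + \<eta> * transfer (transfer \<phi>) 1 - (1 + \<eta>) * transfer (transfer \<phi>) 2) * f y"
    by (rule local_kernel[OF f_lev f_sum _ y1]) (simp add: eta)
  also have "\<dots> = (b 0 * a 1 + \<eta> * (b 0 + a 1 ^ 2 + b 1 * c 2) - (1 + \<eta>) * (c 2 * a 1 + a 2 * c 2)) * f y"
    using c1 by (simp add: transfer_def \<phi>_def a0 c0 numeral_2_eq_2 numeral_3_eq_3 power2_eq_square mult_ac)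
  finally have 1: "adj_op (adj_op (adj_op f)) y = (b 0 * a 1 + \<eta> * (b 0 + a 1 ^ 2 + b 1 * c 2) - (1 + \<eta>) * (c 2 * a 1 + a 2 * c 2)) * f y" .
  have z: "raise f y = 0" "raise (raise f) y = 0" "adj_op (raise (raise f)) y = 0"
  proof -
    have l: "lev (Suc 1) (raise f)" "lev (Suc (Suc 1)) (raise (raise f))" using f_lev lev_raise by auto
    then show "raise f y = 0" "raise (raise f) y = 0" using lev_zero y1 by auto
    show "adj_op (raise (raise f)) y = 0"
      unfolding adj_op_split using lev_zero[OF lev_raise[OF l(2)]] lev_zero[OF lev_flat[OF l(2)]] lev_zero[OF lev_lower[OF l(2)]] y1 by simp
  qed
  have "adj_op (adj_op (adj_op f)) y = (\<eta>\<^sup>2 + \<xi>) * adj_op f y + (\<eta> + \<alpha>) * adj_op (raise f) y + adj_op (raise (raise f)) y"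
    unfolding A_A_f by (simp add: adj_op_add adj_op_scale)
  also have "\<dots> = ((\<eta>\<^sup>2 + \<xi>) * \<eta> + (\<eta> + \<alpha>) * \<xi>) * f y"
    by (simp add: z A_raise) (simp add: A_f z algebra_simps)
  finally have "((\<eta>\<^sup>2 + \<xi>) * \<eta> + (\<eta> + \<alpha>) * \<xi>) = b 0 * a 1 + \<eta> * (b 0 + a 1 ^ 2 + b 1 * c 2) - (1 + \<eta>) * (c 2 * a 1 + a 2 * c 2)"
    using 1 y by simp
  then show ?thesis by (simp add: algebra_simps power2_eq_square power3_eq_cube)
qed

definition "Kf y = (\<Sum>z\<in>UNIV. f z * K z y)"

text \<open>Three linear equations for the inner products \<open>g\<close>, \<open>g1\<close>,
  \<open>g2\<close> of \<open>Kf\<close> with f, raise f and raise (raise f): \<open>Kf\<close> is a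
  \<open>theta1\<close> eigenvector because f sums to 0; \<open>F\<close> kills \<open>Kf\<close>;
  and \<open>F\<close> maps the product of \<open>Kf\<close> with the column \<open>K x\<close> to a
  constant, by \<open>F_product\<close>. Eliminating \<open>g1\<close> and \<open>g2\<close> leaves
  the claim times \<open>g\<close>.\<close>

lemma Krein_relation:
  assumes "\<eta> \<noteq> - n"
  shows "n * ((\<eta> - theta1) * (\<eta> - theta2) + \<xi>) + (\<eta> + \<alpha> - theta1 - theta2) * (theta1 - \<eta>) = 0"
proof -
  define \<alpha>0 where "\<alpha>0 = (\<eta> - theta1) * (\<eta> - theta2) + \<xi>"
  define \<beta>0 where "\<beta>0 = \<eta> + \<alpha> - theta1 - theta2"
  have Ff: "F f = (\<lambda>y. \<alpha>0 * f y + \<beta>0 * raise f y + raise (raise f) y)"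
    by (rule ext, unfold F_def A_A_f, unfold A_f) (simp add: \<alpha>0_def \<beta>0_def algebra_simps power2_eq_square)
  define g where "g = ip Kf f"
  define g1 where "g1 = ip Kf (raise f)"
  define g2 where "g2 = ip Kf (raise (raise f))"
  have "ip (adj_op Kf) f = theta1 * g"
  proof -
    have "adj_op Kf y = theta1 * Kf y" for y
    proof -
      have "adj_op Kf y = (\<Sum>z\<in>UNIV. f z * (theta1 * K z y + (b 0 / q - theta1)))"
        unfolding Kf_def by (simp add: adj_op_sum adj_op_scale adj_K)
      also have "\<dots> = theta1 * Kf y + (b 0 / q - theta1) * (\<Sum>z\<in>UNIV. f z)"
        unfolding Kf_def distrib_left[of "f _"] by (simp add: sum.distrib sum_distrib_left sum_distrib_right mult_ac)
      finally show ?thesis using f_sum by simp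
    qed
    then show ?thesis unfolding g_def ip_def by (simp add: sum_distrib_left mult.assoc)
  qed
  then have 1: "\<eta> * g + g1 = theta1 * g"
    unfolding ip_adj A_f ip_add ip_scale g_def g1_def by simp
  have "ip (F Kf) f = 0"
  proof -
    obtain s where s: "\<And>z y. F (K z) y = s" using F_K by blast
    have "F Kf y = 0" for y
    proof -
      have "F Kf y = (\<Sum>z\<in>UNIV. f z * s)" unfolding Kf_def by (simp add: F_sum F_scale s)
      then show ?thesis using f_sum by (simp add: sum_distrib_right[symmetric])
    qed
    then show ?thesis by (simp add: ip_def)
  qed
  then have "ip Kf (F f) = 0" using F_self_adjoint[of Kf f] by (simp add: ip_def)
  then have 2: "\<alpha>0 * g + \<beta>0 * g1 + g2 = 0" unfolding Ff ip_add ip_scale g_def g1_def g2_def by simp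
  define DK where "DK y = K x y * Kf y" for y
  have "ip (F DK) f = 0"
  proof -
    obtain s where s: "\<And>z u. F (\<lambda>y. K x y * K z y) u = s z" using F_product by metis
    have "F DK y = (\<Sum>z\<in>UNIV. f z * s z)" for y
    proof -
      have "DK = (\<lambda>y. \<Sum>z\<in>UNIV. f z * (K x y * K z y))"
        by (rule ext) (simp add: DK_def Kf_def sum_distrib_left mult_ac)
      then show ?thesis by (simp add: F_sum F_scale s)
    qed
    then show ?thesis by (simp add: ip_def sum_distrib_left[symmetric] f_sum)
  qed
  then have "ip DK (F f) = 0" using F_self_adjoint[of DK f] by (simp add: ip_def)
  \<comment> \<open>Multiplication by the column \<open>K x\<close> scales level i by q^(-i), so the
    third equation is independent of the second.\<close>
  moreover have DK: "ip DK h = (1/q)^i * ip Kf h" if "lev i h" for i h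
  proof -
    have "ip DK h = (\<Sum>y\<in>UNIV. (1/q)^i * (Kf y * h y))" unfolding ip_def
    proof (rule sum.cong[OF refl])
      fix y show "DK y * h y = (1/q)^i * (Kf y * h y)"
        using that by (cases "h y = 0") (auto simp: DK_def lev_def K_def d_sym)
    qed
    then show ?thesis by (simp add: ip_def sum_distrib_left)
  qed
  ultimately have 3: "\<alpha>0 * ((1/q) * g) + \<beta>0 * ((1/q)^2 * g1) + (1/q)^3 * g2 = 0"
    unfolding Ff ip_add ip_scale g_def g1_def g2_def
    using DK[OF f_lev] DK[OF lev_raise[OF f_lev]] DK[OF lev_raise[OF lev_raise[OF f_lev]]]
    by (simp add: eval_nat_numeral)
  have g1: "g1 = (theta1 - \<eta>) * g" using 1 by (simp add: algebra_simps)
  have g2: "g2 = - (\<alpha>0 + \<beta>0 * (theta1 - \<eta>)) * g" using 2 g1 by (simp add: algebra_simps)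
  have "q^3 * (\<alpha>0 * ((1/q) * g) + \<beta>0 * ((1/q)^2 * g1) + (1/q)^3 * g2) = q^2 * \<alpha>0 * g + q * \<beta>0 * g1 + g2"
    using q_ge by (simp add: field_simps eval_nat_numeral)
  then have "q^2 * \<alpha>0 * g + q * \<beta>0 * g1 + g2 = 0" using 3 by simp
  then have "(q - 1) * (n * \<alpha>0 + \<beta>0 * (theta1 - \<eta>)) * g = 0"
    unfolding g1 g2 n_def by (simp add: algebra_simps power2_eq_square)
  moreover have "g \<noteq> 0"
  proof -
    obtain y where y: "f y \<noteq> 0" using f by (auto simp: thin_vector_def)
    define l where "l = 1 + \<eta> * (1/q) - (1 + \<eta>) * (1/q)^2"
    have "g = l * ip f f"
    proof -
      have "Kf y * f y = l * (f y * f y)" for y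
      proof (cases "f y = 0")
        case False
        then have y1: "d x y = 1" using f_lev by (simp add: lev_def)
        have "Kf y = (\<Sum>z\<in>UNIV. (1/q)^(d y z) * f z)" by (simp add: Kf_def K_def mult.commute)
        also have "\<dots> = l * f y"
          using local_kernel[OF f_lev f_sum _ y1, of \<eta> "\<lambda>i. (1/q)^i"] eta by (simp add: l_def)
        finally show ?thesis by simp
      qed simp
      then show ?thesis unfolding g_def ip_def sum_distrib_left by (intro sum.cong refl)
    qed
    \<comment> \<open>On level 1, \<open>Kf\<close> is \<open>l\<close> times f, and
      \<open>l\<close> vanishes exactly for \<eta> = -n: this is the origin of the exceptional
      eigenvalue.\<close>
    moreover have "q^2 * l = (q - 1) * (\<eta> + n)"
      unfolding l_def n_def using q_ge by (simp add: field_simps power2_eq_square)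
    then have "l \<noteq> 0" using assms q_ge by auto
    ultimately show ?thesis using ip_pos[of f y] y by simp
  qed
  ultimately have "n * \<alpha>0 + \<beta>0 * (theta1 - \<eta>) = 0" using q_ge by simp
  then show ?thesis by (simp add: \<alpha>0_def \<beta>0_def)
qed

lemma local_eigenvalue: "\<eta> \<in> {- n, -1, E, E'}"
proof (cases "\<eta> = - n")
  case False
  have "\<xi> * (n * ((\<eta> - theta1) * (\<eta> - theta2) + \<xi>) + (\<eta> + \<alpha> - theta1 - theta2) * (theta1 - \<eta>)) = 0"
    using Krein_relation[OF False] by simp
  then have "n * ((\<eta> - theta1) * (\<eta> - theta2) + \<xi>) * \<xi> + ((\<eta> - theta1 - theta2) * \<xi> + \<alpha> * \<xi>) * (theta1 - \<eta>) = 0"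
    by (simp add: algebra_simps)
  moreover have "n * ((\<eta> - theta1) * (\<eta> - theta2) + \<xi>) * \<xi> + ((\<eta> - theta1 - theta2) * \<xi> + \<alpha> * \<xi>) * (theta1 - \<eta>)
     = q * (theta1 + theta2 - a 1 + c 2) * ((\<eta> + 1) * (\<eta> - E) * (\<eta> - E'))"
    unfolding third_moment unfolding second_moment by (rule Krein_cubic)
  moreover have "theta1 + theta2 - a 1 + c 2 > 0"
  proof -
    have "(N - n) * (n * N - q - 2) / q > 0"
    proof -
      have "n * N \<ge> 3 * N" using n_ge N_gt by (intro mult_right_mono) auto
      then have "N - n > 0" "n * N - q - 2 > 0" using N_gt unfolding n_def by linarith+
      then show ?thesis using q_ge by simp
    qed
    moreover have "(N - 1 - n) * (n * N - 1) \<ge> 0"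
    proof -
      have "q^2 \<ge> 0" by simp
      moreover have "q^3 \<ge> 2^3" using q_ge by (intro power_mono) auto
      then have "q^3 \<ge> 8" by simp
      ultimately have "N - 1 - n \<ge> 0" using N_ge unfolding n_def by linarith
      moreover have "n * N \<ge> 1" using b_pos(5) n_ge unfolding a1 by (simp add: zero_less_mult_iff)
      ultimately show ?thesis by simp
    qed
    moreover have "n * (n+1) > n + 1" using n_ge by simp
    ultimately show ?thesis unfolding theta1_def theta2_def a1 c2 by (simp add: algebra_simps)
  qed
  ultimately show ?thesis using q_ge by auto
qed simp

end

end

section \<open>Uniform structures and modules of the Terwilliger algebra\<close>

context pointed_drg
begin

abbreviation Adj where "Adj \<equiv> adjacency_matrix G"
abbreviation Est where "Est i \<equiv> dual_idempotent G x i"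

section \<open>From complex matrices to the real operators\<close>

definition embed :: "('a \<Rightarrow> real) \<Rightarrow> complex ^ 'a" where "embed f = (\<chi> y. complex_of_real (f y))"
definition re :: "complex ^ 'a \<Rightarrow> 'a \<Rightarrow> real" where "re v y = Re (v $ y)"
definition clev where "clev i v \<longleftrightarrow> (\<forall>y. v $ y \<noteq> 0 \<longrightarrow> d x y = i)" for v :: "complex ^ 'a"
definition cip where "cip u v = (\<Sum>y\<in>UNIV. u $ y * cnj (v $ y))" for u v :: "complex ^ 'a"

lemma Est_apply: "(Est i *v v) $ y = (if d x y = i then v $ y else 0)"
proof -
  have "(Est i *v v) $ y = (\<Sum>z\<in>UNIV. if y = z then (if d x y = i then v $ z else 0) else 0)"
    unfolding matrix_vector_mult_def dual_idempotent_def by (simp only: vec_lambda_beta) (intro sum.cong refl, auto)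
  then show ?thesis by simp
qed

lemma Adj_apply: "(Adj *v v) $ y = (\<Sum>z | G y z. v $ z)"
proof -
  have "(Adj *v v) $ y = (\<Sum>z\<in>UNIV. if G y z then v $ z else 0)"
    unfolding matrix_vector_mult_def adjacency_matrix_def by simp (intro sum.cong refl, auto)
  then show ?thesis by (simp add: sum.If_cases)
qed

lemma Est_mult_left: "(Est i ** M) $ y $ z = (if d x y = i then M $ y $ z else 0)"
proof -
  have "(Est i ** M) $ y $ z = (\<Sum>w\<in>UNIV. if y = w then (if d x y = i then M $ w $ z else 0) else 0)"
    unfolding matrix_matrix_mult_def dual_idempotent_def by (simp only: vec_lambda_beta) (intro sum.cong refl, auto)
  then show ?thesis by simp
qed

lemma Est_mult_right: "(M ** Est i) $ y $ z = (if d x z = i then M $ y $ z else 0)"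
proof -
  have "(M ** Est i) $ y $ z = (\<Sum>w\<in>UNIV. if w = z then (if d x z = i then M $ y $ w else 0) else 0)"
    unfolding matrix_matrix_mult_def dual_idempotent_def by (simp only: vec_lambda_beta) (intro sum.cong refl, auto)
  then show ?thesis by simp
qed

lemma lowering_entry: "lowering_matrix G x $ y $ z = (if G y z \<and> d x z = Suc (d x y) then 1 else 0)"
proof -
  have "lowering_matrix G x $ y $ z = (\<Sum>i=1..D. if i = d x z then (if G y z \<and> d x z = Suc (d x y) then 1 else 0) else 0)"
    unfolding lowering_matrix_def sum_component diam Est_mult_right Est_mult_left
    by (intro sum.cong refl) (auto simp: adjacency_matrix_def)
  then show ?thesis using d_le[of x z] by (auto simp: sum.delta)
qed

lemma raising_entry: "raising_matrix G x $ y $ z = (if G y z \<and> d x y = Suc (d x z) then 1 else 0)"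
proof -
  have "raising_matrix G x $ y $ z = (\<Sum>i\<in>{0..<D}. if i = d x z then (if G y z \<and> d x y = Suc (d x z) then 1 else 0) else 0)"
    unfolding raising_matrix_def sum_component diam Est_mult_right Est_mult_left
    by (intro sum.cong refl) (auto simp: adjacency_matrix_def)
  then show ?thesis using d_le[of x y] by (auto simp: sum.delta)
qed

lemma lowering_embed: "lowering_matrix G x *v embed f = embed (lower f)"
proof (rule vec_eq_iff[THEN iffD2], rule allI)
  fix y
  have "(lowering_matrix G x *v embed f) $ y = (\<Sum>z\<in>UNIV. if G y z \<and> d x z = Suc (d x y) then complex_of_real (f z) else 0)"
    unfolding matrix_vector_mult_def embed_def by (simp add: lowering_entry) (intro sum.cong refl, auto)
  then show "(lowering_matrix G x *v embed f) $ y = embed (lower f) $ y"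
    by (simp add: sum.If_cases embed_def lower_def)
qed

lemma raising_embed: "raising_matrix G x *v embed f = embed (raise f)"
proof (rule vec_eq_iff[THEN iffD2], rule allI)
  fix y
  have "(raising_matrix G x *v embed f) $ y = (\<Sum>z\<in>UNIV. if G y z \<and> d x y = Suc (d x z) then complex_of_real (f z) else 0)"
    unfolding matrix_vector_mult_def embed_def by (simp add: raising_entry) (intro sum.cong refl, auto)
  then show "(raising_matrix G x *v embed f) $ y = embed (raise f) $ y"
    by (simp add: sum.If_cases embed_def raise_def)
qed

lemma uniform_real:
  assumes "supports_uniform_structure G x"
  obtains e fi where "parameter_matrix D e"
    "\<And>i g y. i \<in> {1..D} \<Longrightarrow> lev i g \<Longrightarrow>
       e_minus e i * of_real (raise (lower (lower g)) y) + of_real (lower (raise (lower g)) y)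
       + e_plus D e i * of_real (lower (lower (raise g)) y) = fi i * of_real (lower g y)"
proof -
  obtain e fi where e: "parameter_matrix D e" and
    *: "\<forall>i\<in>{1..D}. \<forall>v\<in>module_component G x i UNIV.
            e_minus e i *s (raising_matrix G x *v (lowering_matrix G x *v (lowering_matrix G x *v v)))
              + lowering_matrix G x *v (raising_matrix G x *v (lowering_matrix G x *v v))
              + e_plus D e i *s (lowering_matrix G x *v (lowering_matrix G x *v (raising_matrix G x *v v)))
            = fi i *s (lowering_matrix G x *v v)"
    using assms unfolding supports_uniform_structure_def diam Let_def by blast
  show ?thesis
  proof (rule that[OF e])
    fix i g y assume i: "i \<in> {1..D}" and g: "lev i g"
    have "Est i *v embed g = embed g"
      using g by (auto simp: vec_eq_iff Est_apply embed_def lev_def)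
    then have mem: "embed g \<in> module_component G x i UNIV" unfolding module_component_def by (metis rangeI)
    have "e_minus e i *s embed (raise (lower (lower g))) + embed (lower (raise (lower g)))
       + e_plus D e i *s embed (lower (lower (raise g))) = fi i *s embed (lower g)"
      using bspec[OF bspec[OF * i] mem] unfolding lowering_embed raising_embed .
    then have "(e_minus e i *s embed (raise (lower (lower g))) + embed (lower (raise (lower g)))
       + e_plus D e i *s embed (lower (lower (raise g)))) $ y = (fi i *s embed (lower g)) $ y" by simp
    then show "e_minus e i * of_real (raise (lower (lower g)) y) + of_real (lower (raise (lower g)) y)
       + e_plus D e i * of_real (lower (lower (raise g)) y) = fi i * of_real (lower g y)"
      by (simp add: embed_def)
  qed
qed

lemma raise_zero: "raise (\<lambda>_. 0) = (\<lambda>_. 0)" by (auto simp: raise_def)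
lemma lower_zero: "lower (\<lambda>_. 0) = (\<lambda>_. 0)" by (auto simp: lower_def)
lemma op_scale': "raise (\<lambda>y. s * f y) = (\<lambda>y. s * raise f y)" "lower (\<lambda>y. s * f y) = (\<lambda>y. s * lower f y)"
  by (auto simp: op_scale)

lemma raise_power_zero: "(raise ^^ j) f = (\<lambda>_. 0) \<Longrightarrow> (raise ^^ (j + k)) f = (\<lambda>_. 0)"
  by (induction k) (simp_all add: raise_zero)

text \<open>Write lower (v (j+1)) = X (j+1) v j for the iterates \<open>v j\<close>. The uniform
  relation on level i + 2, applied to \<open>v (i+1)\<close> and divided by \<open>X (i+1)\<close>,
  links X i, X (i+1) and X (i+2). As X 0 = X (m+1) = 0, these are \<open>m\<close> equations with
  the rows and columns 2, ..., m+1 of the parameter matrix.\<close>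

lemma uniform_system:
  assumes e: "parameter_matrix D e"
    and eq: "\<And>i g y. i \<in> {1..D} \<Longrightarrow> lev i g \<Longrightarrow>
       e_minus e i * of_real (raise (lower (lower g)) y) + of_real (lower (raise (lower g)) y)
       + e_plus D e i * of_real (lower (lower (raise g)) y) = fi i * of_real (lower g y)"
    and f: "thin_vector f" and xi: "lower (raise f) = (\<lambda>y. \<xi> * f y)"
    and nz: "(raise ^^ m) f \<noteq> (\<lambda>_. 0)" and z: "(raise ^^ Suc m) f = (\<lambda>_. 0)" and m: "m + 1 \<le> D"
  obtains X :: "nat \<Rightarrow> real" where "X 1 = \<xi>"
    "\<And>i. i < m \<Longrightarrow> (\<Sum>l<m. e (2 + i) (2 + l) * of_real (X (Suc l))) = fi (2 + i)"
proof -
  define v where "v j = (raise ^^ j) f" for j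
  have vS: "v (Suc j) = raise (v j)" for j by (simp add: v_def)
  have "\<forall>j. \<exists>s. lower (v (Suc j)) = (\<lambda>y. s * v j y)" using f unfolding thin_vector_def v_def by blast
  then obtain Y where Y: "\<And>j. lower (v (Suc j)) = (\<lambda>y. Y j * v j y)" by metis
  \<comment> \<open>A shift by one, so that the lower boundary value is \<open>X 0 = 0\<close>,
    which matches lower f = 0.\<close>
  define X where "X j = (case j of 0 \<Rightarrow> 0 | Suc i \<Rightarrow> Y i)" for j
  have X0: "X 0 = 0" and XS: "\<And>j. X (Suc j) = Y j" by (simp_all add: X_def)
  have vnz: "v j \<noteq> (\<lambda>_. 0)" if "j \<le> m" for j
    using raise_power_zero[of j f "m - j"] nz that by (auto simp: v_def)
  \<comment> \<open>By adjointness, \<open>Y j\<close> is the ratio of the squared norms of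
    \<open>v (j+1)\<close> and \<open>v j\<close>.\<close>
  have Ynz: "Y j \<noteq> 0" if "j < m" for j
  proof
    assume "Y j = 0"
    then have "ip (v (Suc j)) (v (Suc j)) = 0"
      using ip_raise[of "v j" "v (Suc j)"] unfolding Y vS[symmetric] by (simp add: ip_def)
    moreover have "v (Suc j) \<noteq> (\<lambda>_. 0)" using vnz[of "Suc j"] that by simp
    then obtain y where "v (Suc j) y \<noteq> 0" by (auto simp: fun_eq_iff)
    ultimately show False using ip_pos by fastforce
  qed
  have Ym: "Y m = 0"
  proof -
    obtain y where "v m y \<noteq> 0" using vnz[of m] by auto
    moreover have "lower (v (Suc m)) y = 0" using z by (simp add: v_def lower_zero)
    ultimately show ?thesis using Y[of m] by simp
  qed
  have three: "e_minus e (i + 2) * of_real (X i) + of_real (X (Suc i)) + e_plus D e (i + 2) * of_real (X (Suc (Suc i))) = fi (i + 2)"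
    if i: "i < m" for i
  proof -
    obtain y where y: "v i y \<noteq> 0" using vnz[of i] i by auto
    have l: "lev (i + 2) (v (Suc i))" using thin_lev[OF f, of "Suc i"] by (simp add: v_def numeral_2_eq_2)
    have L: "lower (v (Suc i)) = (\<lambda>y. Y i * v i y)" by (rule Y)
    have RLL: "raise (lower (lower (v (Suc i)))) y = Y i * X i * v i y"
    proof (cases i)
      case 0
      have "lower f = (\<lambda>_. 0)" using f by (simp add: thin_vector_def)
      then show ?thesis unfolding L op_scale' using 0 by (simp add: v_def raise_zero X0)
    next
      case (Suc k)
      have "lower (v i) = (\<lambda>y. X i * v k y)" unfolding Suc XS by (rule Y)
      then have "raise (lower (lower (v (Suc i)))) = (\<lambda>y. Y i * (X i * raise (v k) y))"
        by (simp only: L op_scale')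
      then show ?thesis by (simp add: Suc vS)
    qed
    have LRL: "lower (raise (lower (v (Suc i)))) y = Y i * Y i * v i y"
      unfolding L op_scale' vS[symmetric] by (simp add: Y)
    have LLR: "lower (lower (raise (v (Suc i)))) y = Y i * Y (Suc i) * v i y"
      unfolding vS[symmetric] Y op_scale' by simp
    have "i + 2 \<in> {1..D}" using i m by auto
    from eq[OF this l, of y]
    have "(of_real (Y i * v i y) :: complex) * (e_minus e (i + 2) * of_real (X i) + of_real (X (Suc i)) + e_plus D e (i + 2) * of_real (X (Suc (Suc i))))
       = of_real (Y i * v i y) * fi (i + 2)"
      unfolding RLL LRL LLR unfolding L XS by (simp add: algebra_simps)
    moreover have "(of_real (Y i * v i y) :: complex) \<noteq> 0" using y Ynz[OF i] by simp
    ultimately show ?thesis by (simp only: mult_cancel_left) simp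
  qed
  show ?thesis
  proof
    obtain y where y: "f y \<noteq> 0" using f by (auto simp: thin_vector_def)
    have "(\<lambda>y. Y 0 * f y) = (\<lambda>y. \<xi> * f y)" using Y[of 0] xi by (simp add: v_def)
    then have "Y 0 * f y = \<xi> * f y" by (rule fun_cong)
    then show "X 1 = \<xi>" using y XS[of 0] by simp
  next
    fix i assume i: "i < m"
    have e': "\<And>i j. i \<in> {1..D} \<Longrightarrow> j \<in> {1..D} \<Longrightarrow> i + 1 < j \<or> j + 1 < i \<Longrightarrow> e i j = 0"
      "\<And>i. i \<in> {1..D} \<Longrightarrow> e i i = 1" using e unfolding parameter_matrix_def by blast+
    \<comment> \<open>Only three entries of a tridiagonal row survive. For i = 0 the index
      \<open>i - 1\<close> is truncated and would collide with l = 0; the inner conditional removes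
      that term.\<close>
    have "(\<Sum>l<m. e (2 + i) (2 + l) * of_real (X (Suc l))) =
       (\<Sum>l<m. (if l = i then of_real (X (Suc i)) else 0) + (if l = i - 1 then (if i = 0 then 0 else e_minus e (i + 2) * of_real (X i)) else 0)
          + (if l = Suc i then e_plus D e (i + 2) * of_real (X (Suc (Suc i))) else 0))"
    proof (rule sum.cong[OF refl])
      fix l assume l: "l \<in> {..<m}"
      have D2: "2 + i \<in> {1..D}" "2 + l \<in> {1..D}" using i l m by auto
      consider "l = i" | "Suc l = i" | "l = Suc i" | "Suc l < i \<or> Suc i < l" by linarith
      then show "e (2 + i) (2 + l) * of_real (X (Suc l)) = (if l = i then of_real (X (Suc i)) else 0) + (if l = i - 1 then (if i = 0 then 0 else e_minus e (i + 2) * of_real (X i)) else 0)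
          + (if l = Suc i then e_plus D e (i + 2) * of_real (X (Suc (Suc i))) else 0)"
      proof cases
        case 1 then show ?thesis using e'(2)[OF D2(1)] by auto
      next
        case 2 then show ?thesis by (auto simp: e_minus_def)
      next
        case 3 then show ?thesis using l m by (auto simp: e_plus_def)
      next
        case 4
        then have "e (2 + i) (2 + l) = 0" using D2 by (intro e'(1)) auto
        then show ?thesis using 4 by auto
      qed
    qed
    also have "\<dots> = of_real (X (Suc i)) + (if i = 0 then 0 else e_minus e (i + 2) * of_real (X i))
          + (if Suc i < m then e_plus D e (i + 2) * of_real (X (Suc (Suc i))) else 0)"
      using i by (simp add: sum.distrib sum.delta)
    also have "\<dots> = fi (2 + i)"
    proof -
      have "\<not> Suc i < m \<Longrightarrow> X (Suc (Suc i)) = 0" using i Ym XS by (metis Suc_lessI)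
      then show ?thesis using three[OF i] X0 by (auto simp: add_ac)
    qed
    finally show "(\<Sum>l<m. e (2 + i) (2 + l) * of_real (X (Suc l))) = fi (2 + i)" .
  qed
qed

text \<open>The nonsingular principal submatrices turn the uniform relations into a linear system whose
  only parameter is the diameter of the module.\<close>

lemma uniform_determines:
  assumes e: "parameter_matrix D e"
    and eq: "\<And>i g y. i \<in> {1..D} \<Longrightarrow> lev i g \<Longrightarrow>
       e_minus e i * of_real (raise (lower (lower g)) y) + of_real (lower (raise (lower g)) y)
       + e_plus D e i * of_real (lower (lower (raise g)) y) = fi i * of_real (lower g y)"
    and f: "thin_vector f" "lower (raise f) = (\<lambda>y. \<xi> * f y)" "(raise ^^ m) f \<noteq> (\<lambda>_. 0)" "(raise ^^ Suc m) f = (\<lambda>_. 0)"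
    and f': "thin_vector f'" "lower (raise f') = (\<lambda>y. \<xi>' * f' y)" "(raise ^^ m) f' \<noteq> (\<lambda>_. 0)" "(raise ^^ Suc m) f' = (\<lambda>_. 0)"
    and m: "1 \<le> m" "m + 1 \<le> D"
  shows "\<xi> = \<xi>'"
proof -
  obtain X where X: "X 1 = \<xi>" "\<And>i. i < m \<Longrightarrow> (\<Sum>l<m. e (2 + i) (2 + l) * of_real (X (Suc l))) = fi (2 + i)"
    using uniform_system[OF e eq f m(2)] by blast
  obtain X' where X': "X' 1 = \<xi>'" "\<And>i. i < m \<Longrightarrow> (\<Sum>l<m. e (2 + i) (2 + l) * of_real (X' (Suc l))) = fi (2 + i)"
    using uniform_system[OF e eq f' m(2)] by blast
  define M where "M = principal_submatrix e 2 (m + 1)"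
  have M: "M \<in> carrier_mat m m" by (simp add: M_def principal_submatrix_def)
  have "Determinant.det M \<noteq> 0" using e m unfolding parameter_matrix_def M_def by simp
  define u :: "complex Matrix.vec" where "u = Matrix.vec m (\<lambda>l. of_real (X (Suc l) - X' (Suc l)))"
  have u: "u \<in> carrier_vec m" by (simp add: u_def)
  have "M *\<^sub>v u = 0\<^sub>v m"
  proof (rule eq_vecI)
    fix i assume "i < dim_vec (0\<^sub>v m :: complex Matrix.vec)"
    then have i: "i < m" by simp
    have "vec_index (M *\<^sub>v u) i = (\<Sum>l<m. e (2 + i) (2 + l) * of_real (X (Suc l) - X' (Suc l)))"
      using i by (simp add: M_def principal_submatrix_def u_def scalar_prod_def lessThan_atLeast0)
    also have "\<dots> = 0" using X(2)[OF i] X'(2)[OF i] by (simp add: algebra_simps sum_subtractf)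
    finally show "vec_index (M *\<^sub>v u) i = vec_index (0\<^sub>v m) i" using i by simp
  qed (use M in auto)
  then have "u = 0\<^sub>v m" using det_0_iff_vec_prod_zero[OF M] \<open>Determinant.det M \<noteq> 0\<close> u by blast
  then have "vec_index u 0 = vec_index (0\<^sub>v m) 0" by simp
  then have "X 1 - X' 1 = 0" using m by (simp add: u_def)
  then show ?thesis using X X' by simp
qed

section \<open>Real parts of vectors in a module\<close>

lemma re_Adj: "re (Adj *v v) y = adj_op (re v) y"
  by (simp add: re_def Adj_apply adj_op_def)

lemma re_Est: "re (Est i *v v) y = (if d x y = i then re v y else 0)"
  by (simp add: re_def Est_apply)

lemma clev_iff: "clev i v \<longleftrightarrow> Est i *v v = v"
  by (auto simp: clev_def vec_eq_iff Est_apply)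

lemma clev_Est: "clev i (Est i *v v)" by (simp add: clev_def Est_apply)

lemma lev_re: "clev i v \<Longrightarrow> lev i (re v)"
  unfolding clev_def lev_def re_def by (metis zero_complex.sel(1))

lemma lev_ops:
  assumes "lev i g"
  shows "d x y \<noteq> Suc i \<Longrightarrow> raise g y = 0" "d x y \<noteq> i \<Longrightarrow> flat g y = 0" "Suc (d x y) \<noteq> i \<Longrightarrow> lower g y = 0"
  using assms by (auto simp: raise_def flat_def lower_def lev_def intro!: sum.neutral)

lemma re_raise: assumes "clev i v" shows "re (Est (Suc i) *v (Adj *v v)) = raise (re v)"
proof
  fix y show "re (Est (Suc i) *v (Adj *v v)) y = raise (re v) y"
    using lev_ops[OF lev_re[OF assms], of y] by (simp add: re_Est re_Adj adj_op_split)
qed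

lemma re_flat: assumes "clev i v" shows "re (Est i *v (Adj *v v)) = flat (re v)"
proof
  fix y show "re (Est i *v (Adj *v v)) y = flat (re v) y"
    using lev_ops[OF lev_re[OF assms], of y] by (simp add: re_Est re_Adj adj_op_split)
qed

lemma re_lower: assumes "clev (Suc i) v" shows "re (Est i *v (Adj *v v)) = lower (re v)"
proof
  fix y show "re (Est i *v (Adj *v v)) y = lower (re v) y"
    using lev_ops[OF lev_re[OF assms], of y] by (simp add: re_Est re_Adj adj_op_split)
qed

lemma cip_Adj: "cip (Adj *v u) v = cip u (Adj *v v)"
proof -
  have "cip (Adj *v u) v = (\<Sum>y\<in>UNIV. \<Sum>z | G y z. u $ z * cnj (v $ y))"
    by (simp add: cip_def Adj_apply sum_distrib_right)
  also have "\<dots> = (\<Sum>z\<in>UNIV. \<Sum>y | G z y. u $ z * cnj (v $ y))" by (rule sum_G_swap)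
  finally show ?thesis by (simp add: cip_def Adj_apply sum_distrib_left)
qed

lemma cip_Est: "cip (Est i *v u) v = cip u (Est i *v v)"
  unfolding cip_def by (rule sum.cong[OF refl]) (simp add: Est_apply)

lemma cip_scale: "cip (l *s u) v = l * cip u v" "cip u (l *s v) = cnj l * cip u v"
  by (simp_all add: cip_def sum_distrib_left mult_ac)

lemma cip_self: "cip v v = of_real (\<Sum>y\<in>UNIV. (cmod (v $ y))^2)"
  by (simp add: cip_def complex_norm_square[symmetric] del: of_real_power) 

lemma cip_self_nonzero: assumes "v \<noteq> 0" shows "cip v v \<noteq> 0"
proof -
  obtain y where y: "v $ y \<noteq> 0" using assms by (auto simp: vec_eq_iff)
  have "(\<Sum>y\<in>UNIV. (cmod (v $ y))^2) > 0" by (rule sum_pos2[of _ y]) (use y in auto)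
  then show ?thesis unfolding cip_self by (metis of_real_eq_0_iff less_irrefl)
qed

text \<open>The flat part of A is Hermitian. Here and in \<open>cip_lower_real\<close>, real scalars
  are wanted because taking real parts commutes only with those
  (\<open>re_scale_real\<close>).\<close>

lemma cip_flat_real:
  assumes v: "clev i v" "v \<noteq> 0" and e: "Est i *v (Adj *v v) = l *s v"
  shows "l \<in> \<real>"
proof -
  have E: "Est i *v v = v" using v by (simp add: clev_iff)
  have "l * cip v v = cip (Est i *v (Adj *v v)) v" by (simp add: e cip_scale)
  also have "\<dots> = cip v (Adj *v v)" by (simp add: cip_Est E cip_Adj)
  also have "\<dots> = cip v (Est i *v (Adj *v v))" using cip_Est[of i v "Adj *v v"] by (simp add: E)
  also have "\<dots> = cnj l * cip v v" by (simp add: e cip_scale)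
  finally have "l = cnj l" using cip_self_nonzero[OF v(2)] by simp
  then show ?thesis by (metis Reals_cnj_iff)
qed

text \<open>The scalar is the quotient of the squared norms of w and v.\<close>

lemma cip_lower_real:
  assumes v: "clev i v" "v \<noteq> 0" and w: "w = Est (Suc i) *v (Adj *v v)" and e: "Est i *v (Adj *v w) = l *s v"
  shows "l \<in> \<real>"
proof -
  have E: "Est i *v v = v" "Est (Suc i) *v w = w" using v w clev_Est by (auto simp: clev_iff)
  have "l * cip v v = cip (Est i *v (Adj *v w)) v" by (simp add: e cip_scale)
  also have "\<dots> = cip w (Adj *v v)" by (simp add: cip_Est E cip_Adj)
  also have "\<dots> = cip (Est (Suc i) *v w) (Adj *v v)" by (simp add: E)
  also have "\<dots> = cip w w" by (simp add: cip_Est w[symmetric])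
  finally have "l = cip w w / cip v v" using cip_self_nonzero[OF v(2)] by (simp add: field_simps)
  then show ?thesis by (simp add: cip_self)
qed

lemma re_scale_real: "l \<in> \<real> \<Longrightarrow> re (l *s v) = (\<lambda>y. Re l * re v y)"
  by (auto simp: re_def Reals_def)

lemma module_closed:
  assumes "T_module G x W" "v \<in> W"
  shows "Adj *v v \<in> W" "Est i *v v \<in> W"
proof -
  have T: "Adj \<in> terwilliger_algebra G x" "i \<le> D \<Longrightarrow> Est i \<in> terwilliger_algebra G x"
    unfolding terwilliger_algebra_def by (auto intro: generated_algebra.gen simp: diam)
  then show "Adj *v v \<in> W" using assms by (auto simp: T_module_def)
  show "Est i *v v \<in> W"
  proof (cases "i \<le> D")
    case True then show ?thesis using assms T by (auto simp: T_module_def)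
  next
    case False
    then have "Est i *v v = 0" using d_le by (auto simp: vec_eq_iff Est_apply)
    then show ?thesis using assms vec.subspace_0 by (auto simp: T_module_def)
  qed
qed

lemma module_intro:
  assumes W: "vec.subspace W" "\<And>v. v \<in> W \<Longrightarrow> Adj *v v \<in> W" "\<And>v i. v \<in> W \<Longrightarrow> Est i *v v \<in> W"
  shows "T_module G x W"
proof -
  have "\<forall>v\<in>W. M *v v \<in> W" if "M \<in> terwilliger_algebra G x" for M
    using that unfolding terwilliger_algebra_def
  proof (induction M rule: generated_algebra.induct)
    case (gen M) then show ?case using W by auto
  next
    case one then show ?case by simp
  next
    case (add M M')
    then show ?case using W(1) by (simp add: matrix_vector_mult_add_rdistrib vec.subspace_add)
  next
    case (scale M c)
    have "(\<chi> y z. c * M $ y $ z) *v v = c *s (M *v v)" for v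
      by (simp add: vec_eq_iff matrix_vector_mult_def sum_distrib_left mult.assoc)
    then show ?case using scale W(1) by (simp add: vec.subspace_scale)
  next
    case (mult M M')
    then show ?case by (simp add: matrix_vector_mul_assoc[symmetric])
  qed
  then show ?thesis using W(1) by (simp add: T_module_def)
qed

lemma thin_scalar:
  assumes W: "thin_module G x W" and v: "v \<in> W" "clev i v" "v \<noteq> 0" and w: "w \<in> W" "clev i w"
  obtains c where "w = c *s v"
proof -
  have "i \<le> D" using v d_le by (auto simp: clev_def vec_eq_iff)
  then have dim: "vec.dim (module_component G x i W) \<le> 1" using W by (simp add: thin_module_def diam)
  have mem: "v \<in> module_component G x i W" "w \<in> module_component G x i W"
    using v w by (auto simp: clev_iff module_component_def intro: rev_image_eqI)
  show ?thesis
  proof (cases "w = v")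
    case True then show ?thesis using that[of 1] by simp
  next
    case False
    have "vec.dependent {v, w}"
    proof (rule ccontr)
      assume "\<not> vec.dependent {v, w}"
      then have "card {v, w} \<le> vec.dim (module_component G x i W)"
        by (intro vec.independent_card_le_dim) (use mem in auto)
      then show False using dim False by auto
    qed
    then have "vec.dependent (insert w {v})" by (simp add: insert_commute)
    then have "w \<in> vec.span {v}"
      using v(3) False vec.independent_insert[of w "{v}"] vec.dependent_single[of v] by simp
    then show ?thesis using that by (auto simp: vec.span_singleton)
  qed
qed

lemma endpoint_zero:
  assumes W: "T_module G x W" "module_endpoint G x W = 1" and v: "v \<in> W"
  shows "Est 0 *v v = 0"
proof (rule ccontr)
  assume "Est 0 *v v \<noteq> 0"
  then have "module_component G x 0 W \<noteq> {0}" using v by (auto simp: module_component_def)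
  then have "Min {i. i \<le> D \<and> module_component G x i W \<noteq> {0}} \<le> 0" by (intro Min_le) auto
  then show False using W by (simp add: module_endpoint_def diam)
qed

text \<open>The vectors \<open>w j\<close> are complex counterparts of the iterates of
  \<open>raise\<close> and stay in W. Where \<open>w j\<close> is not 0, thinness makes its flat and
  lowered images multiples of basis vectors, by real scalars; endpoint 1 gives lower (re v) =
  0.\<close>

lemma module_thin_vector:
  assumes W: "T_module G x W" "module_endpoint G x W = 1" "thin_module G x W"
    and v: "v \<in> W" "clev 1 v" and nz: "re v \<noteq> (\<lambda>_. 0)"
  shows "thin_vector (re v)"
proof -
  define w where "w j = rec_nat v (\<lambda>j u. Est (Suc (Suc j)) *v (Adj *v u)) j" for j
  have w0: "w 0 = v" and wS: "w (Suc j) = Est (Suc (Suc j)) *v (Adj *v (w j))" for j by (simp_all add: w_def)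
  have wW: "w j \<in> W" for j by (induction j) (auto simp: w0 wS v intro: module_closed[OF W(1)])
  have wl: "clev (Suc j) (w j)" for j using v by (cases j) (simp_all add: w0 wS clev_Est)
  have rw: "re (w j) = (raise ^^ j) (re v)" for j
    by (induction j) (simp_all add: w0 wS re_raise[OF wl])
  have fl: "\<exists>s. flat ((raise ^^ j) (re v)) = (\<lambda>y. s * (raise ^^ j) (re v) y)" for j
  proof -
    define u where "u = Est (Suc j) *v (Adj *v (w j))"
    have u: "u \<in> W" "clev (Suc j) u" using wW module_closed[OF W(1)] clev_Est by (auto simp: u_def)
    have ru: "re u = flat (re (w j))" unfolding u_def by (rule re_flat[OF wl])
    show ?thesis
    proof (cases "w j = 0")
      case True
      then have "re u = (\<lambda>_. 0)" "re (w j) = (\<lambda>_. 0)" by (auto simp: u_def re_def)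
      then show ?thesis using ru rw by auto
    next
      case False
      then obtain c where c: "u = c *s w j" using thin_scalar[OF W(3) wW wl False u] by blast
      then have "c \<in> \<real>" using cip_flat_real[OF wl False] by (simp add: u_def)
      then have "re u = (\<lambda>y. Re c * re (w j) y)" unfolding c by (rule re_scale_real)
      then show ?thesis using ru unfolding rw by (intro exI[of _ "Re c"]) simp
    qed
  qed
  have lo: "\<exists>s. lower ((raise ^^ Suc j) (re v)) = (\<lambda>y. s * (raise ^^ j) (re v) y)" for j
  proof -
    define u where "u = Est (Suc j) *v (Adj *v (w (Suc j)))"
    have u: "u \<in> W" "clev (Suc j) u" using wW module_closed[OF W(1)] clev_Est by (auto simp: u_def)
    have ru: "re u = lower (re (w (Suc j)))" unfolding u_def by (rule re_lower[OF wl])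
    show ?thesis
    proof (cases "w j = 0")
      case True
      then have "re u = (\<lambda>_. 0)" "re (w j) = (\<lambda>_. 0)" by (auto simp: u_def wS re_def)
      then show ?thesis using ru unfolding rw by (intro exI[of _ 0]) simp
    next
      case False
      then obtain c where c: "u = c *s w j" using thin_scalar[OF W(3) wW wl False u] by blast
      then have "c \<in> \<real>" using cip_lower_real[OF wl False wS[of j]] by (simp add: u_def)
      then have "re u = (\<lambda>y. Re c * re (w j) y)" unfolding c by (rule re_scale_real)
      then show ?thesis using ru unfolding rw by (intro exI[of _ "Re c"]) simp
    qed
  qed
  have "re (Est 0 *v (Adj *v v)) = lower (re v)" using re_lower[of 0 v] v by simp
  moreover have "Est 0 *v (Adj *v v) = 0" using endpoint_zero[OF W(1,2)] module_closed[OF W(1) v(1)] by auto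
  ultimately have "lower (re v) = re 0" by simp
  then have "lower (re v) = (\<lambda>_. 0)" by (auto simp: re_def)
  then show ?thesis using nz fl lo lev_re[OF v(2)] by (auto simp: thin_vector_def)
qed

text \<open>The real inner product of HOL-Analysis is the real part of \<open>cip\<close>. On
  complex subspaces both define the same orthogonality, so real dimension and real orthogonal
  decomposition can be used for modules.\<close>

lemma inner_Adj: "(Adj *v u) \<bullet> v = u \<bullet> (Adj *v v)"
  and inner_Est: "(Est i *v u) \<bullet> v = u \<bullet> (Est i *v v)"
  and inner_scale: "(l *s u) \<bullet> v = u \<bullet> (cnj l *s v)"
proof -
  have re: "u \<bullet> v = Re (cip u v)" for u v
    by (simp add: inner_vec_def cip_def inner_complex_def)
  show "(Adj *v u) \<bullet> v = u \<bullet> (Adj *v v)" by (simp add: re cip_Adj)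
  show "(Est i *v u) \<bullet> v = u \<bullet> (Est i *v v)" by (simp add: re cip_Est)
  show "(l *s u) \<bullet> v = u \<bullet> (cnj l *s v)" by (simp add: re cip_scale)
qed

lemma real_subspace:
  fixes W :: "(complex ^ 'a) set"
  assumes "vec.subspace W" shows "subspace W"
proof -
  have "r *\<^sub>R v = complex_of_real r *s v" for r and v :: "complex ^ 'a"
    by (simp add: vec_eq_iff complex_eq_iff)
  then show ?thesis using assms unfolding subspace_def vec.subspace_def by auto
qed

lemma orthogonal_module:
  assumes Z: "T_module G x Z" and Z': "T_module G x Z'"
  shows "T_module G x {z\<in>Z. \<forall>w\<in>Z'. z \<bullet> w = 0}"
proof (rule module_intro)
  have sZ: "vec.subspace Z" and sZ': "vec.subspace Z'" using Z Z' by (auto simp: T_module_def)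
  show "vec.subspace {z\<in>Z. \<forall>w\<in>Z'. z \<bullet> w = 0}"
  proof (rule vec.subspaceI)
    fix c z assume "z \<in> {z\<in>Z. \<forall>w\<in>Z'. z \<bullet> w = 0}"
    then show "c *s z \<in> {z\<in>Z. \<forall>w\<in>Z'. z \<bullet> w = 0}"
      using sZ sZ' by (auto simp: inner_scale vec.subspace_scale)
  qed (use sZ in \<open>auto simp: vec.subspace_0 vec.subspace_add inner_add_left\<close>)
qed (use module_closed[OF Z] module_closed[OF Z'] in \<open>auto simp: inner_Adj inner_Est\<close>)

text \<open>Pair v with the indicator of a sphere around x: A maps that indicator to a combination
  of such indicators, to which v is orthogonal.\<close>

lemma sphere_sum_Adj:
  assumes "\<And>i. (\<Sum>z | d x z = i. v $ z) = 0"
  shows "(\<Sum>z | d x z = i. (Adj *v v) $ z) = 0"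
proof -
  define t where "t h = transfer (\<lambda>j. if j = i then 1 else 0) h" for h
  have t: "(\<Sum>z | G w z. if d x z = i then 1 else 0) = t (d x w)" for w
    using adj_op_dist[of "\<lambda>j. if j = i then 1 else 0" x w] by (simp add: t_def adj_op_def d_sym)
  have "(\<Sum>z | d x z = i. (Adj *v v) $ z) = (\<Sum>z\<in>UNIV. (Adj *v v) $ z * cnj (if d x z = i then 1 else 0))"
    by (simp add: sum.If_cases if_distrib[of "\<lambda>u. _ * cnj u"] cong: if_cong)
  also have "\<dots> = cip (Adj *v v) (\<chi> z. if d x z = i then 1 else 0)"
    by (simp add: cip_def)
  also have "\<dots> = cip v (Adj *v (\<chi> z. if d x z = i then 1 else 0))" by (rule cip_Adj)
  also have "\<dots> = (\<Sum>w\<in>UNIV. v $ w * of_real (t (d x w)))"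
  proof -
    have "(Adj *v (\<chi> z. if d x z = i then 1 else 0)) $ w = of_real (t (d x w))" for w
      unfolding t[symmetric] Adj_apply of_real_sum by (intro sum.cong refl) auto
    then show ?thesis by (simp add: cip_def)
  qed
  also have "(\<Sum>w\<in>UNIV. v $ w * of_real (t (d x w))) = (\<Sum>h\<le>D. \<Sum>w\<in>{w. w \<in> UNIV \<and> d x w = h}. v $ w * of_real (t (d x w)))"
    by (rule sum.group[symmetric]) (use d_le in auto)
  also have "\<dots> = (\<Sum>h\<le>D. (\<Sum>w | d x w = h. v $ w) * of_real (t h))"
    by (intro sum.cong refl) (simp add: sum_distrib_right)
  also have "\<dots> = 0" using assms by simp
  finally show ?thesis .
qed

text \<open>Complete reducibility at level 1. A nonzero u would embed in the submodule
  \<open>Y\<close> orthogonal to all irreducible modules of endpoint 1 and to all sphere indicators.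
  But a minimal submodule of \<open>Y\<close> that is nonzero at level 1 is itself irreducible of
  endpoint 1, hence orthogonal to itself.\<close>

lemma local_completeness:
  assumes thin: "\<forall>W. irreducible_T_module G x W \<and> module_endpoint G x W = 1 \<longrightarrow> thin_module G x W"
    and u: "lev 1 u" "(\<Sum>y\<in>UNIV. u y) = 0" "\<And>f. thin_vector f \<Longrightarrow> ip u f = 0"
  shows "u y = 0"
proof (rule ccontr)
  assume nz: "u y \<noteq> 0"
  define good where "good W \<longleftrightarrow> irreducible_T_module G x W \<and> module_endpoint G x W = 1" for W
  have goodT: "T_module G x W" "thin_module G x W" "module_endpoint G x W = 1" if "good W" for W
    using that thin by (auto simp: good_def irreducible_T_module_def)
  define Y where "Y = {v. (\<forall>W. good W \<longrightarrow> (\<forall>w\<in>W. v \<bullet> w = 0)) \<and> (\<forall>i. (\<Sum>z | d x z = i. v $ z) = 0)}"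
  have YT: "T_module G x Y"
  proof (rule module_intro)
    have sub: "c *s w \<in> W" if "good W" "w \<in> W" for c w W
      using goodT(1)[OF that(1)] that(2) by (simp add: T_module_def vec.subspace_scale)
    show "vec.subspace Y"
    proof (rule vec.subspaceI)
      fix c v assume "v \<in> Y"
      then show "c *s v \<in> Y" using sub by (auto simp: Y_def inner_scale sum_distrib_left[symmetric])
    qed (auto simp: Y_def inner_add_left sum.distrib)
    fix v assume v: "v \<in> Y"
    then show "Adj *v v \<in> Y"
      using sphere_sum_Adj[of v] module_closed(1)[OF goodT(1)] by (auto simp: Y_def inner_Adj)
    fix i
    have "(\<Sum>z | d x z = j. (Est i *v v) $ z) = (if i = j then (\<Sum>z | d x z = j. v $ z) else 0)" for j
      by (auto simp: Est_apply intro!: sum.neutral)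
    then show "Est i *v v \<in> Y"
      using v module_closed(2)[OF goodT(1)] by (auto simp: Y_def inner_Est)
  qed
  have uY: "embed u \<in> Y"
    unfolding Y_def
  proof (intro CollectI conjI allI impI ballI)
    fix W w assume W: "good W" and w: "w \<in> W"
    have w1: "Est 1 *v w \<in> W" "clev 1 (Est 1 *v w)" using module_closed[OF goodT(1)[OF W] w] clev_Est by auto
    have "embed u \<bullet> w = (\<Sum>y\<in>UNIV. u y * re w y)"
      by (simp add: inner_vec_def embed_def re_def inner_complex_def)
    also have "\<dots> = ip u (re (Est 1 *v w))" unfolding ip_def
      using u(1) by (intro sum.cong refl) (auto simp: re_Est lev_def)
    also have "\<dots> = 0"
    proof (cases "re (Est 1 *v w) = (\<lambda>_. 0)")
      case True then show ?thesis by (simp add: ip_def)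
    next
      case False
      then show ?thesis using u(3) module_thin_vector[OF goodT(1,3,2)[OF W] w1] by blast
    qed
    finally show "embed u \<bullet> w = 0" .
  next
    fix i
    have "(\<Sum>z | d x z = i. u z) = 0"
    proof (cases "i = 1")
      case True
      then have "(\<Sum>z | d x z = i. u z) = (\<Sum>z\<in>UNIV. u z)"
        using u(1) by (intro sum.mono_neutral_left) (auto simp: lev_def)
      then show ?thesis using u(2) by simp
    next
      case False
      then show ?thesis using u(1) by (intro sum.neutral) (auto simp: lev_def)
    qed
    then show "(\<Sum>z | d x z = i. embed u $ z) = 0"
      by (simp add: embed_def of_real_sum[symmetric] del: of_real_sum)
  qed
  define S where "S = {Z. T_module G x Z \<and> Z \<subseteq> Y \<and> (\<exists>z\<in>Z. Est 1 *v z \<noteq> 0)}"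
  have "(Est 1 *v embed u) $ y \<noteq> 0" using nz u(1) by (auto simp: Est_apply embed_def lev_def)
  then have "Est 1 *v embed u \<noteq> 0" by (metis zero_index)
  then have "Y \<in> S" using YT uY by (auto simp: S_def)
  then obtain Z where Z: "Z \<in> S" "\<And>Z'. Z' \<in> S \<Longrightarrow> dim Z \<le> dim Z'"
    using ex_has_least_nat[of "\<lambda>Z. Z \<in> S" Y dim] by auto
  have ZT: "T_module G x Z" and ZY: "Z \<subseteq> Y" using Z by (auto simp: S_def)
  obtain z0 where z0: "z0 \<in> Z" "Est 1 *v z0 \<noteq> 0" using Z by (auto simp: S_def)
  have sub: "subspace W" if "T_module G x W" for W using that real_subspace by (simp add: T_module_def)
  have smaller: "Z' \<notin> S" if "T_module G x Z'" "Z' \<subseteq> Z" "Z' \<noteq> Z" for Z'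
  proof
    assume "Z' \<in> S"
    moreover have "dim Z' < dim Z"
      using that sub ZT by (intro dim_psubset) (metis psubsetI span_eq_iff)
    ultimately show False using Z(2) by fastforce
  qed
  have "irreducible_T_module G x Z"
    unfolding irreducible_T_module_def
  proof (intro conjI allI impI)
    show "T_module G x Z" by (rule ZT)
    show "Z \<noteq> {0}" using z0 by auto
    fix Z' assume Z': "T_module G x Z' \<and> Z' \<subseteq> Z"
    show "Z' = {0} \<or> Z' = Z"
    proof (rule ccontr)
      \<comment> \<open>By minimality, a proper submodule and its orthogonal complement both vanish
        at level 1, hence so does their sum \<open>Z\<close>.\<close>
      assume ne: "\<not> (Z' = {0} \<or> Z' = Z)"
      define Z'' where "Z'' = {z\<in>Z. \<forall>w\<in>Z'. z \<bullet> w = 0}"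
      have Z''T: "T_module G x Z''" unfolding Z''_def using orthogonal_module ZT Z' by blast
      have "Z'' \<noteq> Z"
      proof
        assume "Z'' = Z"
        have "\<forall>z\<in>Z'. z \<bullet> z = 0"
        proof
          fix z assume z: "z \<in> Z'"
          then have "z \<in> Z''" using Z' \<open>Z'' = Z\<close> by blast
          then show "z \<bullet> z = 0" using z unfolding Z''_def by blast
        qed
        then have "Z' \<subseteq> {0}" by auto
        moreover have "0 \<in> Z'" using sub[of Z'] Z' subspace_0 by blast
        ultimately show False using ne by auto
      qed
      then have "Z'' \<notin> S" using smaller Z''T by (auto simp: Z''_def)
      moreover have "Z' \<notin> S" using smaller Z' ne by auto
      ultimately have 0: "\<And>z. z \<in> Z' \<union> Z'' \<Longrightarrow> Est 1 *v z = 0"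
        using Z' Z''T ZY by (auto simp: S_def Z''_def)
      have sp: "span Z' = Z'" using sub Z' by (simp add: span_eq_iff)
      obtain a b where ab: "a \<in> span Z'" "\<And>w. w \<in> span Z' \<Longrightarrow> orthogonal b w" "z0 = a + b"
        using orthogonal_subspace_decomp_exists[of Z' z0] by blast
      have "a \<in> Z'" using ab sp by simp
      moreover have "b \<in> Z''"
      proof -
        have "b = z0 - a" using ab by simp
        then have "b \<in> Z" using z0 \<open>a \<in> Z'\<close> Z' sub[OF ZT] subspace_diff by blast
        then show ?thesis using ab sp by (auto simp: Z''_def orthogonal_def)
      qed
      ultimately have "Est 1 *v z0 = 0" using 0 ab by (simp add: matrix_vector_right_distrib)
      then show False using z0 by simp
    qed
  qed
  moreover have "module_endpoint G x Z = 1"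
  proof -
    \<comment> \<open>The sphere of radius 0 is x alone, so its zero sum excludes endpoint
      0.\<close>
    have "module_component G x 0 Z = {0}"
    proof -
      have "Est 0 *v z = 0" if "z \<in> Z" for z
      proof -
        have "(\<Sum>w | d x w = 0. z $ w) = 0" using that ZY unfolding Y_def by blast
        then have "z $ x = 0" by simp
        then show ?thesis by (auto simp: vec_eq_iff Est_apply)
      qed
      then show ?thesis using z0 unfolding module_component_def by force
    qed
    moreover have "module_component G x 1 Z \<noteq> {0}" using z0 by (auto simp: module_component_def)
    ultimately have "Min {i. i \<le> D \<and> module_component G x i Z \<noteq> {0}} = 1"
    proof (intro Min_eqI)
      fix i assume "module_component G x 0 Z = {0}" "i \<in> {i. i \<le> D \<and> module_component G x i Z \<noteq> {0}}"
      then show "1 \<le> i" by (cases i) auto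
    qed (use D4 in auto)
    then show ?thesis by (simp add: module_endpoint_def diam)
  qed
  ultimately have "good Z" by (simp add: good_def)
  moreover have "z0 \<in> Y" using z0 ZY by blast
  ultimately have "z0 \<bullet> z0 = 0" using z0(1) unfolding Y_def by blast
  then have "z0 = 0" by simp
  then show False using z0 by simp
qed

end

section \<open>The local graph and its affine planes\<close>

context pointed_drg
begin

definition S where "S = {- n, -1, E, E'}"

lemma thin_eigen:
  assumes f: "thin_vector f"
  obtains h where "h \<in> S" "flat f = (\<lambda>y. h * f y)"
    "lower (raise f) = (\<lambda>y. (b 0 - c 2 + (a 1 - c 2) * h - h\<^sup>2) * f y)"
proof -
  have f': "\<forall>j. \<exists>s. flat ((raise ^^ j) f) = (\<lambda>y. s * (raise ^^ j) f y)"
    "\<forall>j. \<exists>s. lower ((raise ^^ Suc j) f) = (\<lambda>y. s * (raise ^^ j) f y)"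
    using f unfolding thin_vector_def by blast+
  obtain h where h: "flat f = (\<lambda>y. h * f y)" using spec[OF f'(1), of 0] by auto
  obtain l where l: "flat (raise f) = (\<lambda>y. l * raise f y)" using spec[OF f'(1), of 1] by auto
  obtain t where t: "lower (raise f) = (\<lambda>y. t * f y)" using spec[OF f'(2), of 0] by auto
  show ?thesis
    using that[of h] local_eigenvalue[OF f h t l] second_moment[OF f h t l] h t by (simp add: S_def)
qed

text \<open>\<open>third_moment\<close> determines the flat scalar after division by the scalar of
  LR, which is not 0 because raise f is not 0.\<close>

lemma thin_alpha:
  "\<exists>l. \<forall>f. thin_vector f \<and> flat f = (\<lambda>y. h * f y) \<longrightarrow> flat (raise f) = (\<lambda>y. l * raise f y)"
proof -
  define t where "t = b 0 - c 2 + (a 1 - c 2) * h - h\<^sup>2"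
  define l where "l = (b 0 * a 1 + h * (b 0 + a 1 ^ 2 + b 1 * c 2) - (1 + h) * (c 2 * a 1 + a 2 * c 2) - h^3 - 2 * h * t) / t"
  have "flat (raise f) = (\<lambda>y. l * raise f y)" if f: "thin_vector f" and h: "flat f = (\<lambda>y. h * f y)" for f
  proof -
    have f': "\<forall>j. \<exists>s. flat ((raise ^^ j) f) = (\<lambda>y. s * (raise ^^ j) f y)"
      "\<forall>j. \<exists>s. lower ((raise ^^ Suc j) f) = (\<lambda>y. s * (raise ^^ j) f y)"
      using f unfolding thin_vector_def by blast+
    obtain l' where l': "flat (raise f) = (\<lambda>y. l' * raise f y)" using spec[OF f'(1), of 1] by auto
    obtain t' where t': "lower (raise f) = (\<lambda>y. t' * f y)" using spec[OF f'(2), of 0] by auto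
    have tt: "t' = t" using second_moment[OF f h t' l'] by (simp add: t_def)
    have "t \<noteq> 0"
    proof
      assume "t = 0"
      then have "ip (raise f) (raise f) = 0" using t' tt ip_raise[of f "raise f"] by (simp add: ip_def)
      moreover obtain y where "raise f y \<noteq> 0" using thin_raise_nonzero[OF f, of 1] D4 by auto
      ultimately show False using ip_pos[of "raise f" y] by simp
    qed
    then have "l' = l" using third_moment[OF f h t' l'] unfolding tt l_def by (simp add: field_simps)
    then show ?thesis using l' by simp
  qed
  then show ?thesis by blast
qed

text \<open>Excludes that distinct h and h' give the same value of b 0 - c 2 + (a 1 - c 2) h -
  h^2.\<close>

lemma S_sum:
  assumes "h \<in> S" "h' \<in> S" "h \<noteq> h'"
  shows "h + h' \<noteq> a 1 - c 2"
proof -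
  have N: "N - n > 0" "N - q - 2 > 0"
  proof -
    have "q^2 \<ge> 0" by simp
    moreover have "q^3 \<ge> 2^3" using q_ge by (intro power_mono) auto
    then have "q^3 \<ge> 8" by simp
    ultimately show "N - n > 0" "N - q - 2 > 0" using N_ge unfolding n_def by linarith+
  qed
  have qN: "q * N \<ge> 2 * N" using q_ge N_gt by (intro mult_right_mono) auto
  have pos: "n * (N - n) > 0" "n * (N - q - 2) > 0" "n * (q * N - n) > 0" "n * (q * N - q - 2) > 0" "n * q > 0" "n * N > 0"
    "n * (n * N - n - 2) > 0"
  proof -
    have "n * N \<ge> 3 * N" using n_ge N_gt by (intro mult_right_mono) auto
    then have "n * N - n - 2 > 0" using N N_gt by linarith
    then show "n * (n * N - n - 2) > 0" using n_ge by simp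
    have "q * N - n > 0" "q * N - q - 2 > 0" using qN N N_gt by linarith+
    then show "n * (q * N - n) > 0" "n * (q * N - q - 2) > 0" using n_ge by simp_all
  qed (use N n_ge q_ge N_gt in auto)
  have "- n + -1 < a 1 - c 2" "- n + E < a 1 - c 2" "- n + E' < a 1 - c 2" "-1 + E < a 1 - c 2" "-1 + E' < a 1 - c 2" "E + E' > a 1 - c 2"
    using pos n_ge unfolding a1 c2 E_def E'_def by (simp_all add: algebra_simps n_def)
  then show ?thesis using assms unfolding S_def by auto
qed

lemma raise_top:
  assumes "thin_vector f" shows "(raise ^^ D) f = (\<lambda>_. 0)"
proof
  fix y show "(raise ^^ D) f y = 0"
    using thin_lev[OF assms, of D] d_le[of x y] by (auto simp: lev_def)
qed

lemma two_eigenvalues: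
  assumes unif: "supports_uniform_structure G x"
  obtains h1 h2 where "h1 \<in> S" "h2 \<in> S" "h1 \<noteq> h2"
    "\<And>f. thin_vector f \<Longrightarrow> flat f = (\<lambda>y. h1 * f y) \<or> flat f = (\<lambda>y. h2 * f y)"
proof -
  obtain e fi where e: "parameter_matrix D e" and
    eq: "\<And>i g y. i \<in> {1..D} \<Longrightarrow> lev i g \<Longrightarrow>
       e_minus e i * of_real (raise (lower (lower g)) y) + of_real (lower (raise (lower g)) y)
       + e_plus D e i * of_real (lower (lower (raise g)) y) = fi i * of_real (lower g y)"
    using uniform_real[OF unif] by blast
  \<comment> \<open>\<open>top f\<close> says that level D is missing, so the module has diameter D
    - 2 instead of D - 1.\<close>
  define top where "top f \<longleftrightarrow> (raise ^^ (D - 1)) f = (\<lambda>_. 0)" for f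
  define ev where "ev f h \<longleftrightarrow> thin_vector f \<and> h \<in> S \<and> flat f = (\<lambda>y. h * f y)
     \<and> lower (raise f) = (\<lambda>y. (b 0 - c 2 + (a 1 - c 2) * h - h\<^sup>2) * f y)" for f h
  have same: "h = h'" if ev: "ev f h" "ev f' h'" and t: "top f = top f'" for f f' h h'
  proof (rule ccontr)
    assume ne: "h \<noteq> h'"
    have thin: "thin_vector f" "thin_vector f'" using ev by (auto simp: ev_def)
    define m where "m = (if top f then D - 2 else D - 1)"
    have m: "1 \<le> m" "m + 1 \<le> D" using D4 by (auto simp: m_def)
    have Sm: "Suc m = (if top f then D - 1 else D)" using D4 by (auto simp: m_def)
    have *: "(raise ^^ m) g \<noteq> (\<lambda>_. 0) \<and> (raise ^^ Suc m) g = (\<lambda>_. 0)" if g: "thin_vector g" "top g = top f" for g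
    proof
      show "(raise ^^ m) g \<noteq> (\<lambda>_. 0)"
      proof (cases "top f")
        case True
        have "D - 2 + 2 \<le> D" using D4 by simp
        from thin_raise_nonzero[OF g(1) this] show ?thesis using True by (auto simp: m_def)
      next
        case False
        then show ?thesis using g(2) by (auto simp: m_def top_def)
      qed
      show "(raise ^^ Suc m) g = (\<lambda>_. 0)" unfolding Sm using raise_top[OF g(1)] g(2) by (auto simp: top_def)
    qed
    have "b 0 - c 2 + (a 1 - c 2) * h - h\<^sup>2 = b 0 - c 2 + (a 1 - c 2) * h' - h'\<^sup>2"
      using uniform_determines[OF e eq, of f _ m f'] * thin ev t m unfolding ev_def by blast
    then have "(h - h') * (h + h' - (a 1 - c 2)) = 0" by (simp add: algebra_simps power2_eq_square)
    then show False using ne S_sum ev unfolding ev_def by auto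
  qed
  have "\<exists>h\<in>S. \<forall>f h'. ev f h' \<and> top f = p \<longrightarrow> h' = h" for p
  proof (cases "\<exists>f h. ev f h \<and> top f = p")
    case True
    then obtain f h where "ev f h" "top f = p" by blast
    then show ?thesis using same by (intro bexI[of _ h]) (auto simp: ev_def)
  next
    case False then show ?thesis by (auto simp: S_def)
  qed
  then obtain H where H: "\<And>p. H p \<in> S" "\<And>p f h'. ev f h' \<Longrightarrow> top f = p \<Longrightarrow> h' = H p" by metis
  have cover: "flat f = (\<lambda>y. H True * f y) \<or> flat f = (\<lambda>y. H False * f y)" if f: "thin_vector f" for f
  proof -
    obtain h where "ev f h" using thin_eigen[OF f] f unfolding ev_def by blast
    then have "h = H (top f)" "flat f = (\<lambda>y. h * f y)" using H(2) by (auto simp: ev_def)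
    then show ?thesis by (cases "top f") auto
  qed
  show ?thesis
  proof (cases "H True = H False")
    case False then show ?thesis using that H(1) cover by blast
  next
    \<comment> \<open>Only one value is available; any other member of \<open>S\<close> supplies the
      second, since later steps divide by h1 - h2.\<close>
    case True
    have "\<exists>h\<in>S. h \<noteq> H True"
      using n_ge by (cases "H True = -1") (auto simp: S_def)
    then show ?thesis using that[of "H True"] H(1) cover True by metis
  qed
qed

section \<open>The quadratic equation of the local graph\<close>

definition delta where "delta z = (\<lambda>y. if y = z then 1 else (0::real))" for z :: 'a
definition ball1 where "ball1 y = (if d x y = 1 then 1 else (0::real))"

lemma ip_delta: "ip (delta z) f = f z"
  by (simp add: ip_def delta_def if_distrib[of "\<lambda>u. u * _"] cong: if_cong)
lemma lev_delta: "lev (d x z) (delta z)" by (simp add: lev_def delta_def)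
lemma flat_delta: "flat (delta z) y = (if G y z \<and> d x z = d x y then 1 else 0)"
  by (simp add: flat_def delta_def)
lemma lower_delta: "lower (delta z) y = (if G y z \<and> d x z = Suc (d x y) then 1 else 0)"
  by (simp add: lower_def delta_def)
lemma flat_ball1: "flat ball1 y = a 1 * ball1 y"
proof (cases "d x y = 1")
  case True
  have "flat ball1 y = real (card {w. G y w \<and> d w x = d y x})"
    unfolding flat_def ball1_def using True by (simp add: d_sym[of _ x])
  then show ?thesis using card_a[of y x] True by (simp add: ball1_def d_sym[of _ x])
next
  case False then show ?thesis by (auto simp: flat_def ball1_def intro: sum.neutral)
qed

lemma ip_ball1: assumes "lev 1 f" shows "ip ball1 f = (\<Sum>y\<in>UNIV. f y)"
  unfolding ip_def using assms by (intro sum.cong refl) (auto simp: ball1_def lev_def)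

lemma sum_flat: assumes "lev 1 f" shows "(\<Sum>y\<in>UNIV. flat f y) = a 1 * (\<Sum>y\<in>UNIV. f y)"
proof -
  have "(\<Sum>y\<in>UNIV. flat f y) = ip (flat f) ball1"
    using ip_ball1[OF lev_flat[OF assms]] by (simp add: ip_sym)
  also have "\<dots> = ip f (\<lambda>y. a 1 * ball1 y)" unfolding ip_flat using flat_ball1 by presburger
  also have "\<dots> = a 1 * (\<Sum>y\<in>UNIV. f y)" using ip_ball1[OF assms] by (simp add: ip_scale ip_sym)
  finally show ?thesis .
qed

lemma ball1_sum: "(\<Sum>y\<in>UNIV. ball1 y) = b 0"
  using card_G[of x] by (simp add: ball1_def sum.If_cases G_iff)

lemma ip_lin: "ip (\<lambda>y. f y - s * g y + t * h y - l * k y) u = ip f u - s * ip g u + t * ip h u - l * ip k u"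
  by (simp add: ip_def algebra_simps sum.distrib sum_subtractf sum_distrib_left)

definition V where "V = {z. G x z}"

lemma V_iff: "z \<in> V \<longleftrightarrow> d x z = 1" by (simp add: V_def G_iff)

lemma flat_flat_delta:
  assumes "z \<in> V" "w \<in> V"
  shows "flat (flat (delta z)) w = real (card {v\<in>V. G z v \<and> G w v})"
proof -
  have "flat (flat (delta z)) w = (\<Sum>v | G w v \<and> d x v = d x w. if G v z then 1 else 0)"
    unfolding flat_def[of "flat (delta z)"] using assms by (intro sum.cong refl) (auto simp: flat_delta V_iff)
  also have "\<dots> = real (card ({v. G w v \<and> d x v = d x w} \<inter> {v. G v z}))" by (simp add: sum.If_cases)
  also have "{v. G w v \<and> d x v = d x w} \<inter> {v. G v z} = {v\<in>V. G z v \<and> G w v}"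
    using assms G_sym by (auto simp: V_iff)
  finally show ?thesis .
qed

lemma V_neighbours: assumes "z \<in> V" shows "real (card {w\<in>V. G z w}) = a 1"
proof -
  have "{w\<in>V. G z w} = {w. G z w \<and> d w x = d z x}" using assms by (auto simp: V_iff d_sym[of _ x])
  then show ?thesis using card_a[of z x] assms by (simp add: V_iff d_sym[of _ x])
qed

text \<open>This is (B - h1)(B - h2) = l J in entries, where B is the local adjacency matrix. The
  constant \<open>l\<close> makes the difference of both sides, applied to \<open>delta z\<close>,
  sum to 0; every thin vector is orthogonal to it, so \<open>local_completeness\<close>
  applies.\<close>

lemma local_quadratic:
  assumes thin: "\<forall>W. irreducible_T_module G x W \<and> module_endpoint G x W = 1 \<longrightarrow> thin_module G x W"
    and cover: "\<And>f. thin_vector f \<Longrightarrow> flat f = (\<lambda>y. h1 * f y) \<or> flat f = (\<lambda>y. h2 * f y)"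
  shows "\<And>z w. z \<in> V \<Longrightarrow> w \<in> V \<Longrightarrow> real (card {v\<in>V. G z v \<and> G w v})
      = (h1 + h2) * (if G z w then 1 else 0) - h1 * h2 * (if z = w then 1 else 0) + (a 1 - h1) * (a 1 - h2) / b 0"
proof -
  fix z w assume z: "z \<in> V" and w: "w \<in> V"
  define l where "l = (a 1 - h1) * (a 1 - h2) / b 0"
  define u where "u = (\<lambda>y. flat (flat (delta z)) y - (h1 + h2) * flat (delta z) y + (h1 * h2) * delta z y - l * ball1 y)"
  have l1: "lev 1 (delta z)" using lev_delta[of z] z by (simp add: V_iff)
  then have l2: "lev 1 (flat (delta z))" "lev 1 (flat (flat (delta z)))" by (auto intro: lev_flat)
  have u1: "lev 1 u" using l1 l2 unfolding lev_def u_def ball1_def by (auto split: if_splits) (metis add_0 diff_self mult_zero_right)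
  have d1: "(\<Sum>y\<in>UNIV. delta z y) = 1" by (simp add: delta_def)
  have "(\<Sum>y\<in>UNIV. u y) = a 1 * a 1 - (h1 + h2) * a 1 + h1 * h2 - l * b 0"
    unfolding u_def by (simp add: sum.distrib sum_subtractf sum_distrib_left[symmetric] sum_flat[OF l1] sum_flat[OF l2(1)] d1 ball1_sum)
  moreover have "l * b 0 = (a 1 - h1) * (a 1 - h2)" using b_pos(6) by (simp add: l_def)
  ultimately have s: "(\<Sum>y\<in>UNIV. u y) = 0" by (simp add: algebra_simps)
  have orth: "ip u f = 0" if f: "thin_vector f" for f
  proof -
    have f1: "lev 1 f" and f0: "(\<Sum>y\<in>UNIV. f y) = 0" using f sum_lev1[of f] by (auto simp: thin_vector_def)
    obtain h where h: "flat f = (\<lambda>y. h * f y)" "h = h1 \<or> h = h2" using cover[OF f] by blast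
    have "flat (flat f) = (\<lambda>y. h * (h * f y))" unfolding h(1) by (rule ext) (simp add: op_scale h(1))
    then have "ip u f = (h * h - (h1 + h2) * h + h1 * h2) * f z - l * 0"
      unfolding u_def ip_lin ip_flat ip_delta ip_ball1[OF f1] f0 h(1) by (simp add: algebra_simps)
    then show ?thesis using h(2) by (auto simp: algebra_simps)
  qed
  have "u w = 0" by (rule local_completeness[OF thin u1 s orth])
  moreover have "flat (delta z) w = (if G z w then 1 else 0)"
    using flat_delta[of z w] z w G_sym by (auto simp: V_iff)
  moreover have "delta z w = (if z = w then 1 else 0)" "ball1 w = 1"
    using w by (auto simp: delta_def ball1_def V_iff)
  ultimately have "real (card {v\<in>V. G z v \<and> G w v}) - (h1 + h2) * (if G z w then 1 else 0)
      + h1 * h2 * (if z = w then 1 else 0) - l = 0"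
    unfolding u_def using flat_flat_delta[OF z w] by simp
  then show "real (card {v\<in>V. G z v \<and> G w v})
      = (h1 + h2) * (if G z w then 1 else 0) - h1 * h2 * (if z = w then 1 else 0) + (a 1 - h1) * (a 1 - h2) / b 0"
    unfolding l_def by linarith
qed

text \<open>With -1 in the pair the equation gives b 0 = a 1 + 1, so b 1 = 0. For -n,
  \<open>E'\<close> the left side is negative and the right side positive. For \<open>E\<close>,
  \<open>E'\<close> it gives a 1 + E E' = n, although a 1 >= n.\<close>

lemma eigenvalue_pair:
  assumes "h1 \<in> S" "h2 \<in> S" "h1 \<noteq> h2" and eq: "b 0 * (a 1 + h1 * h2) = (a 1 - h1) * (a 1 - h2)"
  shows "{h1, h2} = {- n, E}"
proof -
  have NN: "n * N > 0" "n * N - 1 > 0" "n * (q * N - 1) > 0" "E > 0"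
  proof -
    have "N > 7" using N_gt by simp
    have "n * N \<ge> 3 * N" using n_ge \<open>N > 7\<close> by (intro mult_right_mono) auto
    then show "n * N > 0" "n * N - 1 > 0" using \<open>N > 7\<close> by linarith+
    have "q * N \<ge> 2 * N" using q_ge \<open>N > 7\<close> by (intro mult_right_mono) auto
    then have "q * N - 1 > 0" using \<open>N > 7\<close> by linarith
    then show "n * (q * N - 1) > 0" using n_ge by simp
    have "n * (N - 1) \<ge> 3 * (N - 1)" using n_ge \<open>N > 7\<close> by (intro mult_right_mono) auto
    moreover have "3 * (N - 1) > 1" using \<open>N > 7\<close> by simp
    ultimately have "n * (N - 1) > 1" by (rule less_le_trans[rotated])
    then show "E > 0" by (simp add: E_def)
  qed
  have aE: "a 1 - E = q * n * N + 1" "a 1 - E' = n * N" unfolding a1 E_def E'_def n_def by (simp_all add: algebra_simps)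
  have qnN: "q * n * N > 0" using NN(1) q_ge by (simp add: mult.assoc)
  have minus1: False if h: "h \<in> S" "h \<noteq> -1" "b 0 * (a 1 - h) = (a 1 + 1) * (a 1 - h)" for h
  proof -
    have "a 1 - h > 0" using h(1,2) aE NN qnN b_pos(5) n_ge unfolding S_def by auto
    then have "b 0 = a 1 + 1" using h(3) by simp
    then show False using b_pos(1) c1 by (simp add: a_def)
  qed
  have m1: "h1 \<noteq> -1" "h2 \<noteq> -1"
    using minus1[of h2] minus1[of h1] assms by (auto simp: algebra_simps)
  have pn: False if "b 0 * (a 1 + (- n) * E') = (a 1 + n) * (a 1 - E')"
  proof -
    have "a 1 + (- n) * E' = n * (q - (q - 1) * (n * N))" unfolding a1 E'_def n_def by (simp add: algebra_simps)
    moreover have "(q - 1) * (n * N) > q"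
    proof -
      have "N > q" using N_gt by simp
      moreover have "n * N \<ge> 1 * N" using n_ge N_gt by (intro mult_right_mono) auto
      moreover have "(q - 1) * (n * N) \<ge> 1 * (n * N)" using q_ge NN by (intro mult_right_mono) auto
      ultimately show ?thesis by linarith
    qed
    ultimately have "a 1 + (- n) * E' < 0" using n_ge by (simp add: mult_less_0_iff)
    then have "b 0 * (a 1 + (- n) * E') < 0" using b_pos(6) by (simp add: mult_less_0_iff)
    moreover have "(a 1 + n) * (a 1 - E') > 0" using aE NN b_pos(5) n_ge by simp
    ultimately show False using that by simp
  qed
  have EE: False if "b 0 * (a 1 + E * E') = (a 1 - E) * (a 1 - E')"
  proof -
    have "(a 1 - E) * (a 1 - E') = b 0 * n" unfolding aE b0 by (simp add: algebra_simps)
    then have "a 1 + E * E' = n" using that b_pos(6) by simp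
    moreover have "E * E' > 0" using NN by (simp add: E'_def)
    moreover have "a 1 \<ge> n"
    proof -
      have "n * N \<ge> 1 * N" using n_ge N_gt by (intro mult_right_mono) auto
      then have "n * N - 1 \<ge> 1" using N_gt by linarith
      then have "n * (n * N - 1) \<ge> n * 1" using n_ge by (intro mult_left_mono) auto
      then show ?thesis unfolding a1 by simp
    qed
    ultimately show False by linarith
  qed
  show ?thesis using assms(1,2,3) m1 eq pn EE unfolding S_def by (auto simp: mult.commute)
qed

lemma common_split:
  assumes "z \<in> V" "w \<in> V" "z \<noteq> w"
  shows "card {v. G z v \<and> G w v} = 1 + card {v\<in>V. G z v \<and> G w v} + card {v. d x v = 2 \<and> G z v \<and> G w v}"
proof -
  have "{v. G z v \<and> G w v} = insert x ({v\<in>V. G z v \<and> G w v} \<union> {v. d x v = 2 \<and> G z v \<and> G w v})"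
  proof (intro equalityI subsetI)
    fix v assume v: "v \<in> {v. G z v \<and> G w v}"
    then have "d x v \<le> d x z + d z v" "d z v = 1" using d_tri[of x v z] G_iff by auto
    then have "d x v = 0 \<or> d x v = 1 \<or> d x v = 2" using assms(1) unfolding V_iff by linarith
    then show "v \<in> insert x ({v\<in>V. G z v \<and> G w v} \<union> {v. d x v = 2 \<and> G z v \<and> G w v})"
      using v by (auto simp: V_iff)
  qed (use assms G_sym in \<open>auto simp: V_def\<close>)
  moreover have "x \<notin> {v\<in>V. G z v \<and> G w v} \<union> {v. d x v = 2 \<and> G z v \<and> G w v}" by (auto simp: V_iff)
  moreover have "card ({v\<in>V. G z v \<and> G w v} \<union> {v. d x v = 2 \<and> G z v \<and> G w v}) = card {v\<in>V. G z v \<and> G w v} + card {v. d x v = 2 \<and> G z v \<and> G w v}"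
    by (rule card_Un_disjoint) (auto simp: V_iff)
  ultimately show ?thesis by simp
qed

lemma common_adjacent: assumes "G z w" shows "real (card {v. G z v \<and> G w v}) = a 1"
proof -
  have "{v. G z v \<and> G w v} = {v. G z v \<and> d v w = d z w}" using assms by (auto simp: G_iff d_sym[of _ w])
  then show ?thesis using card_a[of z w] assms by (simp add: G_iff)
qed

lemma common_distance2: assumes "d z w = 2" shows "real (card {v. G z v \<and> G w v}) = c 2"
proof -
  have "{v. G z v \<and> G w v} = {v. G z v \<and> Suc (d v w) = d z w}" using assms by (auto simp: G_iff d_sym[of _ w])
  then show ?thesis using card_c[of z w] assms by simp
qed

section \<open>The common neighbours of x and a vertex at distance 2\<close>

definition mu_set where "mu_set y = {z\<in>V. G z y}"

text \<open>\<open>H y z\<close> and \<open>P y z\<close> are the values at z of flat (lower (delta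
  y)) and lower (flat (delta y)): paths from z to y of length 2 through level 1 and level 2.\<close>

definition H where "H y z = real (card {w\<in>V. G z w \<and> G w y})"
definition P where "P y z = real (card {w. d x w = 2 \<and> G z w \<and> G w y})"

lemma PH:
  assumes "z \<in> V" "d x y = 2" shows "P y z + H y z = real (card {w. G z w \<and> G y w})"
proof -
  have "{w. G z w \<and> G y w} = {w. d x w = 2 \<and> G z w \<and> G w y} \<union> {w\<in>V. G z w \<and> G w y}"
  proof (intro equalityI subsetI)
    fix w assume w: "w \<in> {w. G z w \<and> G y w}"
    then have "d x w \<le> d x z + d z w" "d z w = 1" using d_tri[of x w z] G_iff by auto
    then have "d x w = 0 \<or> d x w = 1 \<or> d x w = 2" using assms(1) unfolding V_iff by linarith
    moreover have "d x w \<noteq> 0" using w assms(2) by (auto simp: G_iff d_sym[of y])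
    ultimately show "w \<in> {w. d x w = 2 \<and> G z w \<and> G w y} \<union> {w\<in>V. G z w \<and> G w y}"
      using w G_sym by (auto simp: V_iff)
  qed (use G_sym in auto)
  moreover have "card ({w. d x w = 2 \<and> G z w \<and> G w y} \<union> {w\<in>V. G z w \<and> G w y}) = card {w. d x w = 2 \<and> G z w \<and> G w y} + card {w\<in>V. G z w \<and> G w y}"
    by (rule card_Un_disjoint) (auto simp: V_iff)
  ultimately show ?thesis by (simp add: P_def H_def)
qed

lemma raise_flat_scale: "flat f = (\<lambda>y. h * f y) \<Longrightarrow> raise (flat f) = (\<lambda>y. h * raise f y)"
  by (auto simp: op_scale)

text \<open>The flat scalar on raise f depends only on h (\<open>thin_alpha\<close>), and a function
  of two values is affine: it is s + t h. Passing to adjoints, lower (flat \<delta>) - s lower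
  \<delta> - t flat (lower \<delta>) is orthogonal to all thin vectors, hence equal to a constant
  \<open>\<nu>\<close> on the neighbours of x.\<close>

lemma mu_relation:
  assumes thin: "\<forall>W. irreducible_T_module G x W \<and> module_endpoint G x W = 1 \<longrightarrow> thin_module G x W"
    and h: "h1 \<noteq> h2"
    and cover: "\<And>f. thin_vector f \<Longrightarrow> flat f = (\<lambda>y. h1 * f y) \<or> flat f = (\<lambda>y. h2 * f y)"
  obtains s t where "\<And>y z. d x y = 2 \<Longrightarrow> z \<in> V \<Longrightarrow> P y z = s * (if G z y then 1 else 0) + t * H y z"
proof -
  obtain l1 where l1: "\<And>f. thin_vector f \<Longrightarrow> flat f = (\<lambda>y. h1 * f y) \<Longrightarrow> flat (raise f) = (\<lambda>y. l1 * raise f y)"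
    using thin_alpha[of h1] by blast
  obtain l2 where l2: "\<And>f. thin_vector f \<Longrightarrow> flat f = (\<lambda>y. h2 * f y) \<Longrightarrow> flat (raise f) = (\<lambda>y. l2 * raise f y)"
    using thin_alpha[of h2] by blast
  define t where "t = (l1 - l2) / (h1 - h2)"
  define s where "s = l1 - t * h1"
  have "t * (h1 - h2) = l1 - l2" using h by (simp add: t_def)
  then have st: "l1 = s + t * h1" "l2 = s + t * h2" by (auto simp: s_def algebra_simps)
  show ?thesis
  proof (rule that[of s t])
    fix y0 z0 assume y0: "d x y0 = 2" and z0: "z0 \<in> V"
    define \<delta> where "\<delta> = delta y0"
    have d2: "lev (Suc 1) \<delta>" "lev (Suc 1) (flat \<delta>)"
      using lev_delta[of y0] y0 lev_flat by (auto simp: \<delta>_def numeral_2_eq_2)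
    have lv: "lev 1 (lower (flat \<delta>))" "lev 1 (lower \<delta>)" "lev 1 (flat (lower \<delta>))"
      using lev_lower[OF d2(1)] lev_lower[OF d2(2)] lev_flat by auto
    define g where "g = (\<lambda>z. lower (flat \<delta>) z - s * lower \<delta> z + (- t) * flat (lower \<delta>) z)"
    define \<nu> where "\<nu> = (\<Sum>z\<in>UNIV. g z) / b 0"
    define u where "u = (\<lambda>z. lower (flat \<delta>) z - s * lower \<delta> z + (- t) * flat (lower \<delta>) z - \<nu> * ball1 z)"
    have u1: "lev 1 u" using lv unfolding lev_def u_def ball1_def by (auto split: if_splits) (metis add_0 diff_0_right mult_zero_right neg_0_equal_iff_equal)
    have "(\<Sum>z\<in>UNIV. u z) = (\<Sum>z\<in>UNIV. g z) - \<nu> * b 0"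
      unfolding u_def g_def ball1_sum[symmetric] by (simp add: sum.distrib sum_subtractf sum_distrib_left)
    then have u0: "(\<Sum>z\<in>UNIV. u z) = 0" using b_pos by (simp add: \<nu>_def)
    have orth: "ip u f = 0" if f: "thin_vector f" for f
    proof -
      have f1: "lev 1 f" and f0: "(\<Sum>y\<in>UNIV. f y) = 0" using f sum_lev1[of f] by (auto simp: thin_vector_def)
      have low: "ip (lower k) f = ip k (raise f)" for k f using ip_raise[of f k] by (simp add: ip_sym)
      obtain h where h: "flat f = (\<lambda>y. h * f y)" "flat (raise f) = (\<lambda>y. (s + t * h) * raise f y)"
        using cover[OF f] l1[OF f] l2[OF f] st by metis
      have "ip u f = ip (lower (flat \<delta>)) f - s * ip (lower \<delta>) f + (- t) * ip (flat (lower \<delta>)) f - \<nu> * ip ball1 f"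
        unfolding u_def by (rule ip_lin)
      also have "\<dots> = ip \<delta> (flat (raise f)) - s * ip \<delta> (raise f) + (- t) * ip \<delta> (raise (flat f))"
        unfolding low ip_flat ip_ball1[OF f1] f0 by simp
      also have "\<dots> = 0"
        unfolding raise_flat_scale[OF h(1)] h(2) \<delta>_def ip_delta by (simp add: algebra_simps)
      finally show ?thesis .
    qed
    have u: "u z = 0" for z by (rule local_completeness[OF thin u1 u0 orth])
    have eq: "P y0 z = s * (if G z y0 then 1 else 0) + t * H y0 z + \<nu>" if z: "z \<in> V" for z
    proof -
      have "lower (flat \<delta>) z = (\<Sum>w | G z w \<and> d x w = 2. if G w y0 then 1 else 0)"
        unfolding lower_def[of "flat \<delta>"] using z y0 by (intro sum.cong) (auto simp: \<delta>_def flat_delta V_iff)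
      also have "\<dots> = real (card ({w. G z w \<and> d x w = 2} \<inter> {w. G w y0}))" by (simp add: sum.If_cases)
      also have "{w. G z w \<and> d x w = 2} \<inter> {w. G w y0} = {w. d x w = 2 \<and> G z w \<and> G w y0}" by auto
      finally have 1: "lower (flat \<delta>) z = P y0 z" by (simp add: P_def)
      have 2: "lower \<delta> z = (if G z y0 then 1 else 0)" using z y0 by (auto simp: \<delta>_def lower_delta V_iff)
      have "flat (lower \<delta>) z = (\<Sum>w | G z w \<and> d x w = 1. if G w y0 then 1 else 0)"
        unfolding flat_def[of "lower \<delta>"] using z y0 by (intro sum.cong) (auto simp: \<delta>_def lower_delta V_iff)
      also have "\<dots> = real (card ({w. G z w \<and> d x w = 1} \<inter> {w. G w y0}))" by (simp add: sum.If_cases)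
      also have "{w. G z w \<and> d x w = 1} \<inter> {w. G w y0} = {w\<in>V. G z w \<and> G w y0}" by (auto simp: V_iff)
      finally have 3: "flat (lower \<delta>) z = H y0 z" by (simp add: H_def)
      show ?thesis using u[of z] z unfolding u_def 1 2 3 by (simp add: ball1_def V_iff)
    qed
    \<comment> \<open>As b 2 > 0, some neighbour of x has distance 3 from \<open>y0\<close>; all
      counts vanish there, which gives \<open>\<nu> = 0\<close>.\<close>
    have "real (card {w. G x w \<and> d w y0 = Suc (d x y0)}) > 0" using card_b[of x y0] y0 b_pos(2) by simp
    then have "{w. G x w \<and> d w y0 = Suc (d x y0)} \<noteq> {}" by (metis card.empty less_irrefl of_nat_0)
    then obtain z3 where z3: "z3 \<in> V" "d z3 y0 = 3" using y0 by (auto simp: V_def)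
    have far: "\<not> (G z3 w \<and> G w y0)" for w using d_tri[of z3 y0 w] z3(2) by (auto simp: G_iff)
    have "P y0 z3 = 0" "H y0 z3 = 0" using far by (auto simp: P_def H_def)
    then have "\<nu> = 0" using eq[OF z3(1)] z3(2) by (simp add: G_iff)
    then show "P y0 z0 = s * (if G z0 y0 then 1 else 0) + t * H y0 z0" using eq[OF z0] by simp
  qed
qed

lemma card_mu: assumes "d x y = 2" shows "real (card (mu_set y)) = c 2"
proof -
  have "mu_set y = {v. G x v \<and> G y v}" using G_sym by (auto simp: mu_set_def V_def)
  then show ?thesis using common_distance2[OF assms] by simp
qed

text \<open>Counting pairs of adjacent members of \<open>mu_set y\<close> in two ways evaluates the two valencies.\<close>

lemma mu_valencies:
  assumes rel: "\<And>y z. d x y = 2 \<Longrightarrow> z \<in> V \<Longrightarrow> P y z = s * (if G z y then 1 else 0) + t * H y z"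
    and count: "\<And>z w. z \<in> V \<Longrightarrow> w \<in> V \<Longrightarrow> G z w \<Longrightarrow> real (card {v. d x v = 2 \<and> G z v \<and> G w v}) = n * q * (N - 1)"
  shows "\<And>y z. d x y = 2 \<Longrightarrow> z \<in> mu_set y \<Longrightarrow> H y z = n^2"
    and "\<And>y z. d x y = 2 \<Longrightarrow> z \<in> V \<Longrightarrow> z \<notin> mu_set y \<Longrightarrow> H y z = 0 \<or> H y z = n + 1"
proof -
  \<comment> \<open>The sum P + H is a 1 or c 2 according to the distance, so the relation becomes
    linear in H with coefficient 1 + t: H is constant on each distance class.\<close>
  have near: "a 1 - H y z = s + t * H y z" if "d x y = 2" "z \<in> V" "G z y" for y z
    using rel[of y z] PH[of z y] common_adjacent[of z y] that by simp
  have mid: "c 2 = (1 + t) * H y z" if "d x y = 2" "z \<in> V" "d z y = 2" for y z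
    using rel[of y z] PH[of z y] common_distance2[of z y] that by (simp add: G_iff algebra_simps)
  have ex2: "real (card {z\<in>V. d z y = 2}) = a 2" if "d x y = 2" for y
    using card_a[of x y] that by (simp add: V_def Collect_conj_eq)
  obtain x0 y2 where "d x0 y2 = 2" using d_attained[of 2] D4 by auto
  obtain z1 where z1: "z1 \<in> V"
  proof -
    have "real (card V) > 0" using card_G[of x] b_pos(6) by (simp add: V_def)
    then have "V \<noteq> {}" by (metis card.empty less_irrefl of_nat_0)
    then show ?thesis using that by auto
  qed
  have cb: "real (card {y. d x y = 2 \<and> G z y}) = b 1" if z: "z \<in> V" for z
  proof -
    have "{y. d x y = 2 \<and> G z y} = {w. G z w \<and> d w x = Suc (d z x)}"
      using z by (auto simp: V_iff d_sym[of _ x])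
    then show ?thesis using card_b[of z x] z by (simp add: V_iff d_sym[of _ x])
  qed
  have "real (card {y. d x y = 2 \<and> G z1 y}) > 0" using cb[OF z1] b_pos(1) by simp
  then have "{y. d x y = 2 \<and> G z1 y} \<noteq> {}" by (metis card.empty less_irrefl of_nat_0)
  then obtain y1 where y1: "d x y1 = 2" "G z1 y1" by auto
  have t1: "1 + t \<noteq> 0"
  proof
    assume t: "1 + t = 0"
    have "{z\<in>V. d z y1 = 2} \<noteq> {}" using ex2[OF y1(1)] b_pos(3) by (metis card.empty less_irrefl of_nat_0)
    then obtain z where "z \<in> V" "d z y1 = 2" by auto
    then show False using mid[OF y1(1)] t b_pos(4) by simp
  qed
  define g0 where "g0 = (a 1 - s) / (1 + t)"
  define h0 where "h0 = c 2 / (1 + t)"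
  have g0: "H y z = g0" if "d x y = 2" "z \<in> V" "G z y" for y z
    using near[OF that] t1 by (simp add: g0_def field_simps)
  have h0: "H y z = h0" if "d x y = 2" "z \<in> V" "d z y = 2" for y z
    using mid[OF that] t1 by (simp add: h0_def field_simps)
  have dc: "(\<Sum>u\<in>X. real (card {w\<in>Y. Q u w})) = (\<Sum>w\<in>Y. real (card {u\<in>X. Q u w}))" for X Y :: "'a set" and Q
    unfolding of_nat_sum[symmetric] using double_count[of X Y Q] by simp
  \<comment> \<open>First count, for fixed \<open>z1\<close>: pairs (y, w) with y at distance 2 from
    x, w in \<open>V\<close>, and \<open>z1\<close>, w, y mutually adjacent.\<close>
  have "b 1 * g0 = (\<Sum>y\<in>{y. d x y = 2 \<and> G z1 y}. H y z1)"
    using g0 z1 cb[OF z1] by simp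
  also have "\<dots> = (\<Sum>y\<in>{y. d x y = 2 \<and> G z1 y}. real (card {w\<in>{w\<in>V. G z1 w}. G w y}))"
    by (simp add: H_def conj_assoc)
  also have "\<dots> = (\<Sum>w\<in>{w\<in>V. G z1 w}. real (card {y\<in>{y. d x y = 2 \<and> G z1 y}. G w y}))" by (rule dc)
  also have "\<dots> = (\<Sum>w\<in>{w\<in>V. G z1 w}. n * q * (N - 1))"
    by (rule sum.cong[OF refl]) (use count[OF z1] in \<open>simp add: conj_assoc\<close>)
  also have "\<dots> = a 1 * (n * q * (N - 1))" using V_neighbours[OF z1] by simp
  also have "\<dots> = b 1 * n^2" unfolding a1 b1 by (simp add: power2_eq_square)
  finally have g0n: "g0 = n^2" using b_pos(1) by simp
  \<comment> \<open>Second count, for fixed \<open>y1\<close>: adjacent pairs (z, w) with z in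
    \<open>V\<close> and w in \<open>mu_set y1\<close>.\<close>
  have "a 2 * h0 + c 2 * g0 = (\<Sum>z\<in>V. H y1 z)"
  proof -
    have "(\<Sum>z\<in>V. H y1 z) = (\<Sum>z\<in>V. (if G z y1 then g0 else 0) + (if d z y1 = 2 then h0 else 0))"
    proof (rule sum.cong[OF refl])
      fix z assume z: "z \<in> V"
      have "d z y1 \<noteq> 0" using z y1 by (auto simp: V_iff)
      then consider "G z y1" "d z y1 = 1" | "d z y1 = 2" | "d z y1 > 2" using G_iff[of z y1] by linarith
      then show "H y1 z = (if G z y1 then g0 else 0) + (if d z y1 = 2 then h0 else 0)"
      proof cases
        case 3
        have "\<not> (G z w \<and> G w y1)" for w using d_tri[of z y1 w] 3 by (auto simp: G_iff)
        then have "H y1 z = 0" by (simp add: H_def)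
        then show ?thesis using 3 by (simp add: G_iff)
      qed (use g0[OF y1(1) z] h0[OF y1(1) z] in \<open>auto simp: G_iff\<close>)
    qed
    also have "\<dots> = real (card (mu_set y1)) * g0 + real (card {z\<in>V. d z y1 = 2}) * h0"
      by (simp add: sum.distrib sum.If_cases mu_set_def Int_def)
    finally show ?thesis using card_mu[OF y1(1)] ex2[OF y1(1)] by simp
  qed
  also have "(\<Sum>z\<in>V. H y1 z) = (\<Sum>z\<in>V. real (card {w\<in>mu_set y1. G z w}))"
    by (simp add: H_def mu_set_def conj_ac)
  also have "\<dots> = (\<Sum>w\<in>mu_set y1. real (card {z\<in>V. G z w}))" by (rule dc)
  also have "\<dots> = (\<Sum>w\<in>mu_set y1. a 1)"
  proof (rule sum.cong[OF refl])
    fix w assume "w \<in> mu_set y1"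
    then have "w \<in> V" by (simp add: mu_set_def)
    moreover have "{z\<in>V. G z w} = {z\<in>V. G w z}" using G_sym by auto
    ultimately show "real (card {z\<in>V. G z w}) = a 1" using V_neighbours by simp
  qed
  also have "\<dots> = c 2 * a 1" using card_mu[OF y1(1)] by simp
  finally have "a 2 * h0 = c 2 * (a 1 - n^2)" unfolding g0n by (simp add: algebra_simps)
  also have "\<dots> = a 2 * (n + 1)" unfolding c2 a1 a2 by (simp add: algebra_simps power2_eq_square)
  finally have h0n: "h0 = n + 1" using b_pos(3) by simp
  show "H y z = n^2" if "d x y = 2" "z \<in> mu_set y" for y z
    using g0 g0n that by (simp add: mu_set_def)
  show "H y z = 0 \<or> H y z = n + 1" if y: "d x y = 2" and z: "z \<in> V" "z \<notin> mu_set y" for y z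
  proof (cases "d z y = 2")
    case True then show ?thesis using h0 h0n y z by simp
  next
    case False
    have "d z y \<noteq> 0" "d z y \<noteq> 1" using y z by (auto simp: V_iff mu_set_def G_iff)
    then have "d z y > 2" using False by linarith
    then have "\<not> (G z w \<and> G w y)" for w using d_tri[of z y w] by (auto simp: G_iff)
    then show ?thesis by (simp add: H_def)
  qed
qed

lemma real_to_int: "real k = real_of_int m \<Longrightarrow> int k = m"
  by linarith

theorem no_uniform_structure:
  assumes thin: "\<forall>W. irreducible_T_module G x W \<and> module_endpoint G x W = 1 \<longrightarrow> thin_module G x W"
    and unif: "supports_uniform_structure G x"
  shows False
proof -
  obtain h1 h2 where h: "h1 \<in> S" "h2 \<in> S" "h1 \<noteq> h2"
    and cover: "\<And>f. thin_vector f \<Longrightarrow> flat f = (\<lambda>y. h1 * f y) \<or> flat f = (\<lambda>y. h2 * f y)"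
    using two_eigenvalues[OF unif] by blast
  define l where "l = (a 1 - h1) * (a 1 - h2) / b 0"
  have quad: "real (card {v\<in>V. G z v \<and> G w v})
      = (h1 + h2) * (if G z w then 1 else 0) - h1 * h2 * (if z = w then 1 else 0) + l" if "z \<in> V" "w \<in> V" for z w
    using local_quadratic[OF thin cover that] by (simp add: l_def)
  have "V \<noteq> {}"
  proof -
    have "real (card V) > 0" using card_G[of x] b_pos(6) by (simp add: V_def)
    then show ?thesis by (metis card.empty less_irrefl of_nat_0)
  qed
  then obtain z0 where z0: "z0 \<in> V" by auto
  \<comment> \<open>The diagonal entry z = w of the quadratic identity.\<close>
  have l: "l = a 1 + h1 * h2" using quad[OF z0 z0] V_neighbours[OF z0] G_irrefl by simp
  moreover have "l * b 0 = (a 1 - h1) * (a 1 - h2)" using b_pos(6) by (simp add: l_def)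
  ultimately have "b 0 * (a 1 + h1 * h2) = (a 1 - h1) * (a 1 - h2)" by (simp only: mult.commute)
  then have "{h1, h2} = {- n, E}" by (rule eigenvalue_pair[OF h])
  then have hh: "h1 + h2 = E - n" "h1 * h2 = - n * E" by (auto simp: doubleton_eq_iff)
  then have ln: "l = n^2" unfolding l a1 E_def by (simp add: algebra_simps power2_eq_square)
  have adj: "real (card {v\<in>V. G z v \<and> G w v}) = n * N - 2 + (n - 1)^2" if "z \<in> V" "w \<in> V" "G z w" for z w
  proof -
    have "z \<noteq> w" using that G_irrefl by auto
    then have "real (card {v\<in>V. G z v \<and> G w v}) = E - n + n^2"
      using quad[OF that(1,2)] that(3) hh ln by simp
    then show ?thesis unfolding E_def by (simp add: algebra_simps power2_eq_square)
  qed
  have nonadj: "real (card {v\<in>V. G z v \<and> G w v}) = n^2" if "z \<in> V" "w \<in> V" "z \<noteq> w" "\<not> G z w" for z w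
    using quad[OF that(1,2)] that ln by simp
  have far_adj: "real (card {v. d x v = 2 \<and> G z v \<and> G w v}) = n * q * (N - 1)" if "z \<in> V" "w \<in> V" "G z w" for z w
  proof -
    have "z \<noteq> w" using that G_irrefl by auto
    then have "a 1 = 1 + (n * N - 2 + (n - 1)^2) + real (card {v. d x v = 2 \<and> G z v \<and> G w v})"
      using common_split[OF that(1,2)] common_adjacent[OF that(3)] adj[OF that] by linarith
    then show ?thesis unfolding a1 n_def by (simp add: algebra_simps power2_eq_square)
  qed
  have far_nonadj: "real (card {v. d x v = 2 \<and> G z v \<and> G w v}) = q" if "z \<in> V" "w \<in> V" "z \<noteq> w" "\<not> G z w" for z w
  proof -
    have "d z w \<noteq> 0" "d z w \<noteq> 1" "d z w \<le> 2"
      using that d_tri[of z w x] d_sym[of z x] G_iff[of z w] by (auto simp: V_iff)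
    then have "d z w = 2" by linarith
    then have "c 2 = 1 + n^2 + real (card {v. d x v = 2 \<and> G z v \<and> G w v})"
      using common_split[OF that(1-3)] common_distance2[of z w] nonadj[OF that] by linarith
    then show ?thesis unfolding c2 n_def by (simp add: algebra_simps power2_eq_square)
  qed
  obtain s t where rel: "\<And>y z. d x y = 2 \<Longrightarrow> z \<in> V \<Longrightarrow> P y z = s * (if G z y then 1 else 0) + t * H y z"
    using mu_relation[OF thin h(3) cover] by blast
  have val: "H y z = n^2" if "d x y = 2" "z \<in> mu_set y" for y z
    by (rule mu_valencies(1)[OF _ _ that]) (assumption | rule rel far_adj)+
  have val': "H y z = 0 \<or> H y z = n + 1" if "d x y = 2" "z \<in> V" "z \<notin> mu_set y" for y z
    by (rule mu_valencies(2)[OF _ _ that]) (assumption | rule rel far_adj)+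
  define Ni where "Ni = (\<Sum>k<D. qi ^ k)"
  have Ni: "real_of_int Ni = N" by (simp add: Ni_def N_def q_bracket_def q_def)
  have ni: "real_of_int (qi + 1) = n" by (simp add: n_def q_def)
  interpret steiner_parameters V G "qi + 1" "(qi + 1) * Ni"
  proof
    show "finite V" by simp
    show "\<And>z w. G z w \<Longrightarrow> G w z" by (rule G_sym)
    show "\<And>z. \<not> G z z" by (rule G_irrefl)
    show "int (card {w\<in>V. G z w}) = (qi + 1) * ((qi + 1) * Ni - 1)" if "z \<in> V" for z
      by (rule real_to_int) (use V_neighbours[OF that, unfolded a1] ni Ni in simp)
    show "int (card {u\<in>V. G z u \<and> G w u}) = (qi + 1) * Ni - 2 + (qi + 1 - 1)^2" if "z \<in> V" "w \<in> V" "G z w" for z w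
      by (rule real_to_int) (use adj[OF that] ni Ni in \<open>simp add: n_def q_def\<close>)
    show "int (card {u\<in>V. G z u \<and> G w u}) = (qi + 1)^2" if "z \<in> V" "w \<in> V" "z \<noteq> w" "\<not> G z w" for z w
      by (rule real_to_int) (use nonadj[OF that] ni in simp)
    show "qi + 1 \<ge> 3" using q2 by simp
    have "1 + qi + qi^2 + qi^3 = (\<Sum>k<4. qi ^ k)" by (simp add: eval_nat_numeral)
    also have "\<dots> \<le> Ni" unfolding Ni_def using D4 q2 by (intro sum_mono2) auto
    finally show "(qi + 1) * Ni \<ge> (qi + 1) * (1 + (qi + 1 - 1) + (qi + 1 - 1)^2 + (qi + 1 - 1)^3)"
      using q2 by (intro mult_left_mono) auto
  qed
  have Hnb: "H y z = real (card (nb z \<inter> mu_set y))" for y z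
  proof -
    have "nb z \<inter> mu_set y = {w\<in>V. G z w \<and> G w y}" by (auto simp: nb_def mu_set_def)
    then show ?thesis by (simp add: H_def)
  qed
  have planar: "planar (mu_set y)" if y: "d x y = 2" for y
    unfolding planar_def
  proof (intro conjI ballI)
    show "mu_set y \<subseteq> V" by (auto simp: mu_set_def)
    show "int (card (mu_set y)) = (qi + 1) * (qi + 1 + 1)"
      by (rule real_to_int) (use card_mu[OF y, unfolded c2] ni in simp)
    fix z
    show "int (card (nb z \<inter> mu_set y)) = (qi + 1)^2" if "z \<in> mu_set y"
      by (rule real_to_int) (use val[OF y that] ni Hnb in simp)
    show "nb z \<inter> mu_set y = {} \<or> int (card (nb z \<inter> mu_set y)) = qi + 1 + 1" if "z \<in> V - mu_set y"
    proof -
      have "H y z = 0 \<or> H y z = n + 1" using val'[OF y] that by auto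
      then show ?thesis
      proof
        assume "H y z = 0" then show ?thesis unfolding Hnb by (simp add: mu_set_def)
      next
        assume "H y z = n + 1"
        then have "int (card (nb z \<inter> mu_set y)) = qi + 1 + 1"
          by (intro real_to_int) (use ni Hnb[of y z] in simp)
        then show ?thesis by blast
      qed
    qed
  qed
  have "real (card {w\<in>V. G z0 w}) > 0" using V_neighbours[OF z0] b_pos(5) by simp
  then have "{w\<in>V. G z0 w} \<noteq> {}" by (metis card.empty less_irrefl of_nat_0)
  then obtain u0 where u0: "u0 \<in> V" "G z0 u0" by auto
  define Y where "Y = {y. d x y = 2 \<and> G z0 y \<and> G u0 y}"
  have cY: "real (card Y) = n * q * (N - 1)" using far_adj[OF z0 u0] by (simp add: Y_def)
  have big: "n * q * (N - 1) > q"
  proof -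
    have "n * (N - 1) \<ge> 3 * (N - 1)" using n_ge N_gt by (intro mult_right_mono) auto
    moreover have "3 * (N - 1) > 1" using N_gt by simp
    ultimately have "n * (N - 1) > 1" by (rule less_le_trans[rotated])
    then have "q * (n * (N - 1)) > q * 1" using q_ge by (intro mult_strict_left_mono) auto
    then show ?thesis by (simp add: mult_ac)
  qed
  have "Y \<noteq> {}" using cY big q_ge by auto
  then obtain y1 where y1: "y1 \<in> Y" by auto
  have mem: "z0 \<in> mu_set y" "u0 \<in> mu_set y" "d x y = 2" if "y \<in> Y" for y
    using that z0 u0 by (auto simp: Y_def mu_set_def)
  \<comment> \<open>A line parallel to \<open>z0\<close> exists because the plane has n^2 + n lines,
    more than \<open>z0\<close> and the n^2 lines meeting it.\<close>
  obtain w where w: "w \<in> mu_set y1" "w \<noteq> z0" "\<not> G z0 w"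
  proof -
    have "\<not> mu_set y1 \<subseteq> insert z0 (nb z0 \<inter> mu_set y1)"
    proof
      assume "mu_set y1 \<subseteq> insert z0 (nb z0 \<inter> mu_set y1)"
      then have "card (mu_set y1) \<le> card (insert z0 (nb z0 \<inter> mu_set y1))" by (intro card_mono) auto
      also have "\<dots> \<le> card (nb z0 \<inter> mu_set y1) + 1" by (simp add: card_insert_if)
      finally have "c 2 \<le> n^2 + 1" using card_mu[OF mem(3)[OF y1]] val[OF mem(3,1)[OF y1]] Hnb[of y1 z0] by linarith
      then show False using n_ge unfolding c2 by (simp add: power2_eq_square algebra_simps)
    qed
    then show ?thesis using that by (auto simp: nb_def mu_set_def)
  qed
  have wV: "w \<in> V" using w by (simp add: mu_set_def)
  have "Y \<subseteq> {y. d x y = 2 \<and> G z0 y \<and> G w y}"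
  proof
    fix y assume y: "y \<in> Y"
    \<comment> \<open>Both planes contain the adjacent lines \<open>z0\<close> and
      \<open>u0\<close>, so w, chosen in one of them, lies in all of them.\<close>
    have "mu_set y1 \<subseteq> mu_set y"
      by (rule planar_subset[OF planar planar, of y1 y z0 u0]) (use mem y y1 u0 in auto)
    then show "y \<in> {y. d x y = 2 \<and> G z0 y \<and> G w y}" using w y by (auto simp: mu_set_def Y_def)
  qed
  then have "card Y \<le> card {y. d x y = 2 \<and> G z0 y \<and> G w y}" by (intro card_mono) auto
  then have "real (card Y) \<le> q" using far_nonadj[OF z0 wV] w by simp
  then show False using cY big by simp
qed

end

theorem theorem8p1:
  fixes D :: nat and q :: int
  assumes "D \<ge> 4" and "q \<ge> 2"
  shows "\<not> (\<exists>G :: ('a::finite) graph.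
    \<not> bipartite_graph G \<and>
    has_classical_parameters G D (of_int q) (of_int q + 1)
      ((of_int q ^ (D + 1) * (of_int q + 1) - of_int q ^ 2 - 1) / (of_int q - 1)) \<and>
    (\<exists>x. (\<forall>W. irreducible_T_module G x W \<and> module_endpoint G x W = 1 \<longrightarrow> thin_module G x W) \<and>
         supports_uniform_structure G x))"
proof
  assume "\<exists>G :: ('a::finite) graph.
    \<not> bipartite_graph G \<and>
    has_classical_parameters G D (of_int q) (of_int q + 1)
      ((of_int q ^ (D + 1) * (of_int q + 1) - of_int q ^ 2 - 1) / (of_int q - 1)) \<and>
    (\<exists>x. (\<forall>W. irreducible_T_module G x W \<and> module_endpoint G x W = 1 \<longrightarrow> thin_module G x W) \<and>
         supports_uniform_structure G x)"
  then obtain G :: "'a graph" and x where par: "has_classical_parameters G D (of_int q) (of_int q + 1)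
      ((of_int q ^ (D + 1) * (of_int q + 1) - of_int q ^ 2 - 1) / (of_int q - 1))"
    and thin: "\<forall>W. irreducible_T_module G x W \<and> module_endpoint G x W = 1 \<longrightarrow> thin_module G x W"
    and unif: "supports_uniform_structure G x" by blast
  interpret pointed_drg G D q x
    using par assms by unfold_locales (auto simp: has_classical_parameters_def)
  show False using no_uniform_structure[OF thin unif] .
qed

end
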